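(* Let $v_n\rightharpoonup0$ weakly in $W^{1,2}(\Omega;\mathbb{R}^m)$, and let $\alpha_n>0$ be such that $\alpha_nv_n$ is bounded in $W^{1,\infty}(\Omega;\mathbb{R}^m)$. Let $(\tilde\pi,\tilde\mu_x,\tilde\lambda_x)$ be representation measures for $(\alpha_n,v_n)$ along a subsequence (not relabeled). Then for $\tilde\pi$-a.e. $x_0\in(\Omega\cup\overline{\partial\Omega_1})\cap\mathrm{supp}\,\tilde\pi$ the following holds. Let $\{\theta^r_k\}_{k\ge1}$, for each $r>0$, be any cut-off functions with: - $\theta^r_k\in C^\infty_c(B(x_0,r))$; - $\sup_{k,r}\|\theta^r_k\|_\infty<\infty$; - $\theta^r_k\to\chi_{B_\Omega(x_0,r)}$ pointwise on $\overline\Omega$ as $k\to\infty$. For all such families, $$\lim_{r\to0}\lim_{k\to\infty}\lim_{n\to\infty}\frac{1}{\tilde\pi(B_\Omega(x_0,r))}\int_{B_\Omega(x_0,r)}\mathcal F\big(x_0,\alpha_n,\nabla(\theta^r_k v_n)(x)\big)\,dx=\mathcal I(x_0,\tilde\mu_{x_0},\tilde\lambda_{x_0}).$$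
   Context: $\Omega\subset\mathbb{R}^d$ is a bounded domain with $C^1$ boundary, and $\partial\Omega_1\subset\partial\Omega$ is relatively open. $B_\Omega(x_0,r)=B(x_0,r)\cap\overline\Omega$. $(A,B)=\mathrm{tr}(AB^T)$ and $|\cdot|$ is the Frobenius norm. $U:\overline\Omega\times\mathbb{R}^{m\times d}\to\mathbb{R}$ is continuous with $U(x,0)=0$, and $\mathsf L$ is a continuous fourth-order tensor field on $\overline\Omega$. Notation: - $\mathcal F(x,\alpha,G)=U(x,\alpha G)|G|^2+\tfrac12(\mathsf L(x)G,G)$; - $\mathcal I(x,\mu,\lambda)=\int U(x,F)\,d\mu(F)+\tfrac12\int_{\mathcal S}(\mathsf L(x)F,F)\,d\lambda(F)$, where $\mathcal S$ is the unit sphere in $\mathbb{R}^{m\times d}$. Representation measures for $(\alpha_n,v_n)$: with $R=\sup_n\|\alpha_n\nabla v_n\|_\infty$, these are a nonnegative Radon measure $\tilde\pi$ on $\overline\Omega$ and probability measures $\tilde\mu_x$ on $\overline{\mathcal B(0,R)}\subset\mathbb{R}^{m\times d}$ and $\tilde\lambda_x$ on $\mathcal S$ such that, along the subsequence, $\mathcal F(x,\alpha_n,\nabla v_n)\,dx\overset{*}{\rightharpoonup}\mathcal I(x,\tilde\mu_x,\tilde\lambda_x)\,d\tilde\pi$ as measures on $\overline\Omega$, for every continuous $U$ with $U(\cdot,0)=0$ and every continuous $\mathsf L$. *)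

theory Defs
  imports "HOL-Analysis.Analysis" "HOL-Probability.Probability"
begin

text \<open>Points of the domain: real^'d. Matrices m x d: real^'d^'m, so that
  inner A B = tr(A B^T) and norm is the Frobenius norm.\<close>

text \<open>C-infinity functions: all partial derivatives of all orders exist (and are then continuous).\<close>
definition smooth_fun :: "(real^'d \<Rightarrow> real) \<Rightarrow> bool" where
  "smooth_fun f \<longleftrightarrow> (\<exists>S. f \<in> S \<and> (\<forall>g\<in>S. \<exists>Dg :: 'd \<Rightarrow> real^'d \<Rightarrow> real.
       (\<forall>x. (g has_derivative (\<lambda>h. \<Sum>i\<in>UNIV. h $ i * Dg i x)) (at x)) \<and> (\<forall>i. Dg i \<in> S)))"

definition test_fun :: "(real^'d) set \<Rightarrow> (real^'d \<Rightarrow> real) \<Rightarrow> bool" where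
  "test_fun A \<phi> \<longleftrightarrow> smooth_fun \<phi> \<and> compact (closure {x. \<phi> x \<noteq> 0}) \<and> closure {x. \<phi> x \<noteq> 0} \<subseteq> A"

definition weak_grad :: "(real^'d) set \<Rightarrow> (real^'d \<Rightarrow> real^'m) \<Rightarrow> (real^'d \<Rightarrow> real^'d^'m) \<Rightarrow> bool" where
  "weak_grad \<Omega> v G \<longleftrightarrow>
     v \<in> borel_measurable (lebesgue_on \<Omega>) \<and> G \<in> borel_measurable (lebesgue_on \<Omega>) \<and>
     (\<forall>\<phi> D\<phi>. test_fun \<Omega> \<phi> \<and> (\<forall>x. (\<phi> has_derivative (\<lambda>h. inner (D\<phi> x) h)) (at x)) \<longrightarrow>
        (\<forall>i j. integrable (lebesgue_on \<Omega>) (\<lambda>x. v x $ i * D\<phi> x $ j) \<and>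
               integrable (lebesgue_on \<Omega>) (\<lambda>x. G x $ i $ j * \<phi> x) \<and>
               (LINT x|lebesgue_on \<Omega>. v x $ i * D\<phi> x $ j) = - (LINT x|lebesgue_on \<Omega>. G x $ i $ j * \<phi> x)))"

definition wgrad :: "(real^'d) set \<Rightarrow> (real^'d \<Rightarrow> real^'m) \<Rightarrow> (real^'d \<Rightarrow> real^'d^'m)" where
  "wgrad \<Omega> v = (SOME G. weak_grad \<Omega> v G)"

definition sobolev12 :: "(real^'d) set \<Rightarrow> (real^'d \<Rightarrow> real^'m) \<Rightarrow> bool" where
  "sobolev12 \<Omega> v \<longleftrightarrow> (\<exists>G. weak_grad \<Omega> v G \<and>
      integrable (lebesgue_on \<Omega>) (\<lambda>x. (norm (v x))\<^sup>2) \<and> integrable (lebesgue_on \<Omega>) (\<lambda>x. (norm (G x))\<^sup>2))"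

definition W12_inner :: "(real^'d) set \<Rightarrow> (real^'d \<Rightarrow> real^'m) \<Rightarrow> (real^'d \<Rightarrow> real^'m) \<Rightarrow> real" where
  "W12_inner \<Omega> u w = (LINT x|lebesgue_on \<Omega>. inner (u x) (w x)) + (LINT x|lebesgue_on \<Omega>. inner (wgrad \<Omega> u x) (wgrad \<Omega> w x))"

text \<open>Weak convergence to 0 in the Hilbert space W^{1,2} (Riesz: test against all elements).\<close>
definition weak_conv_zero_W12 :: "(real^'d) set \<Rightarrow> (nat \<Rightarrow> real^'d \<Rightarrow> real^'m) \<Rightarrow> bool" where
  "weak_conv_zero_W12 \<Omega> v \<longleftrightarrow> (\<forall>n. sobolev12 \<Omega> (v n)) \<and>
     (\<forall>w. sobolev12 \<Omega> w \<longrightarrow> (\<lambda>n. W12_inner \<Omega> (v n) w) \<longlonglongrightarrow> 0)"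

text \<open>Bounded domain with C^1 boundary: locally, in a rotated frame with d-th axis e,
  \<Omega> is the supergraph of a C^1 function of the coordinates orthogonal to e.\<close>
definition C1_domain :: "(real^'d) set \<Rightarrow> bool" where
  "C1_domain \<Omega> \<longleftrightarrow> open \<Omega> \<and> connected \<Omega> \<and> \<Omega> \<noteq> {} \<and> bounded \<Omega> \<and>
     (\<forall>p\<in>frontier \<Omega>. \<exists>r>0. \<exists>e \<gamma> \<gamma>'. norm e = 1 \<and>
        (\<forall>x. (\<gamma> has_derivative (\<lambda>h. inner (\<gamma>' x) h)) (at x)) \<and> continuous_on UNIV \<gamma>' \<and>
        \<Omega> \<inter> ball p r = {x \<in> ball p r. inner x e > \<gamma> (x - inner x e *\<^sub>R e)})"

definition tens_app :: "real^'d^'m^'d^'m \<Rightarrow> real^'d^'m \<Rightarrow> real^'d^'m" where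
  "tens_app T G = (\<chi> i j. \<Sum>k\<in>UNIV. \<Sum>l\<in>UNIV. T $ i $ j $ k $ l * G $ k $ l)"

definition Fden :: "(real^'d \<Rightarrow> real^'d^'m \<Rightarrow> real) \<Rightarrow> (real^'d \<Rightarrow> real^'d^'m^'d^'m)
   \<Rightarrow> real^'d \<Rightarrow> real \<Rightarrow> real^'d^'m \<Rightarrow> real" where
  "Fden U L x \<alpha> G = U x (\<alpha> *\<^sub>R G) * (norm G)\<^sup>2 + 1/2 * inner (tens_app (L x) G) G"

definition Ifun :: "(real^'d \<Rightarrow> real^'d^'m \<Rightarrow> real) \<Rightarrow> (real^'d \<Rightarrow> real^'d^'m^'d^'m)
   \<Rightarrow> real^'d \<Rightarrow> (real^'d^'m) measure \<Rightarrow> (real^'d^'m) measure \<Rightarrow> real" where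
  "Ifun U L x \<mu> lam = (\<integral>F. U x F \<partial>\<mu>) + 1/2 * (\<integral>F. inner (tens_app (L x) F) F \<partial>lam)"

definition repr_measures :: "(real^'d) set \<Rightarrow> (nat \<Rightarrow> real) \<Rightarrow> (nat \<Rightarrow> real^'d \<Rightarrow> real^'m) \<Rightarrow> (nat \<Rightarrow> nat)
   \<Rightarrow> (real^'d) measure \<Rightarrow> (real^'d \<Rightarrow> (real^'d^'m) measure) \<Rightarrow> (real^'d \<Rightarrow> (real^'d^'m) measure) \<Rightarrow> bool" where
  "repr_measures \<Omega> \<alpha> v s \<pi> \<mu> lam \<longleftrightarrow>
     (let R = real_of_ereal (SUP n. esssup (lebesgue_on \<Omega>) (\<lambda>x. ereal (norm (\<alpha> n *\<^sub>R wgrad \<Omega> (v n) x)))) in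
     strict_mono s \<and>
     sets \<pi> = sets borel \<and> finite_measure \<pi> \<and> emeasure \<pi> (UNIV - closure \<Omega>) = 0 \<and>
     (\<forall>x\<in>closure \<Omega>. prob_space (\<mu> x) \<and> sets (\<mu> x) = sets borel \<and> emeasure (\<mu> x) (UNIV - cball 0 R) = 0) \<and>
     (\<forall>x\<in>closure \<Omega>. prob_space (lam x) \<and> sets (lam x) = sets borel \<and> emeasure (lam x) (UNIV - sphere 0 1) = 0) \<and>
     (\<forall>U L. continuous_on (closure \<Omega> \<times> UNIV) (\<lambda>(x, F). U x F) \<and> (\<forall>x\<in>closure \<Omega>. U x 0 = 0) \<and>
            continuous_on (closure \<Omega>) L \<longrightarrow>
        set_integrable \<pi> (closure \<Omega>) (\<lambda>x. Ifun U L x (\<mu> x) (lam x)) \<and>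
        (\<forall>\<phi>. continuous_on (closure \<Omega>) \<phi> \<longrightarrow>
           (\<lambda>n. LINT x|lebesgue_on \<Omega>. \<phi> x * Fden U L x (\<alpha> (s n)) (wgrad \<Omega> (v (s n)) x))
             \<longlonglongrightarrow> (LINT x:closure \<Omega>|\<pi>. \<phi> x * Ifun U L x (\<mu> x) (lam x)))))"

definition measure_supp :: "(real^'d) measure \<Rightarrow> (real^'d) set" where
  "measure_supp \<pi> = {x. \<forall>r>0. emeasure \<pi> (ball x r) > 0}"

end

theory Submission
  imports Defs "HOL-Real_Asymp.Real_Asymp"
begin

text \<open>Write \<open>\<nabla>(\<theta> v) = \<theta> \<nabla>v + v \<otimes> \<nabla>\<theta>\<close>. The second term tends to zero in \<open>L\<^sup>2\<close>: translating
  into the domain along a cone of directions, which a \<open>C\<^sup>1\<close> boundary provides, compares a function with its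
  averages over small balls at a cost controlled by its gradient, and the averages tend to zero by weak
  convergence. Weak convergence is only given against elements of \<open>W\<^sup>1\<^sup>,\<^sup>2\<close>; a Banach--Saks argument replaces
  the Riesz representation of the averaging functionals. It is run on \<open>v\<^sub>n / max(1, \<parallel>v\<^sub>n\<parallel>)\<close>, so that no
  a priori \<open>L\<^sup>2\<close> bound is required.

  The remaining term \<open>\<F>(x\<^sub>0, \<alpha>, \<theta> \<nabla>v)\<close> is the energy density of the integrands \<open>\<theta>(x)\<^sup>2 U(x\<^sub>0, \<theta>(x) F)\<close>
  and \<open>\<theta>(x)\<^sup>2 L(x\<^sub>0)\<close>, to which the representation measures apply. Dominated convergence gives the limit
  in \<open>k\<close>, and the limit \<open>r \<rightarrow> 0\<close> is the Lebesgue differentiation theorem for \<open>\<pi>\<close>. Since \<open>\<pi>\<close> need not be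
  doubling, that theorem rests on the Besicovitch overlap bound; openness of the level sets of the
  maximal function reduces it to finitely many radii, for which the greedy selection is exact.\<close>

section \<open>Differentiation of measures along centred balls\<close>

text \<open>The order of quantifiers shapes the proof: the exceptional null set has to be fixed
  before the cut-offs are known. It is therefore produced once, by differentiating the single
  function \<open>Ifun U L x (\<mu> x) (lam x)\<close> of \<open>x\<close>; every other step works
  at an arbitrary point of the closure. Freezing the first argument at \<open>x0\<close> is paid for
  by uniform continuity, which is available because all \<open>\<mu> x\<close> live in one compact
  ball and all \<open>lam x\<close> on the unit sphere. The cut-off sits inside the nonlinear
  \<open>U\<close>, so it cannot serve as a test function of the weak-star convergence and is moved
  into the integrand. As the cut-offs converge at every point of the closure, spheres charged by
  \<open>\<pi>\<close> do no harm. The functions \<alpha> v are bounded but may stay of order one,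
  so the term with the gradient of \<theta> can shift the argument of \<open>U\<close> by a fixed
  amount. On the set where it does, the square of the main gradient is controlled by that of the
  error term. The bound on the gradients in L2 is read off from the representation with
  \<open>U = 0\<close> and the identity tensor.\<close>

lemma separated_subset_card_bound:
  fixes K :: "'a::metric_space set"
  assumes "compact K" "0 < m"
  shows "\<exists>N. \<forall>S. S \<subseteq> K \<and> (\<forall>x\<in>S. \<forall>y\<in>S. x \<noteq> y \<longrightarrow> m \<le> dist x y) \<longrightarrow> finite S \<and> card S \<le> N"
proof -
  \<comment> \<open>Half of the separation: two points of \<open>S\<close> in one of these balls
    would be closer than \<open>m\<close>, so assigning a ball to each point is injective.\<close>
  obtain C where C: "finite C" "K \<subseteq> (\<Union>c\<in>C. ball c (m/2))"
    using assms compact_eq_totally_bounded by (metis half_gt_zero)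
  have "finite S \<and> card S \<le> card C" if S: "S \<subseteq> K" "\<forall>x\<in>S. \<forall>y\<in>S. x \<noteq> y \<longrightarrow> m \<le> dist x y" for S
  proof -
    have "\<forall>x\<in>S. \<exists>c\<in>C. x \<in> ball c (m/2)" using S(1) C(2) by blast
    then obtain f where f: "\<And>x. x \<in> S \<Longrightarrow> f x \<in> C \<and> x \<in> ball (f x) (m/2)" by metis
    have "inj_on f S"
    proof (rule inj_onI, rule ccontr)
      fix x y assume xy: "x \<in> S" "y \<in> S" "f x = f y" "x \<noteq> y"
      have "dist x y \<le> dist (f x) x + dist (f x) y" by (metis dist_commute dist_triangle2)
      then show False using f[OF xy(1)] f[OF xy(2)] S(2) xy by force
    qed
    moreover have "f ` S \<subseteq> C" using f by auto
    ultimately show ?thesis using C(1) by (metis card_inj_on_le inj_on_finite)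
  qed
  then show ?thesis by (intro exI[of _ "card C"]) simp
qed

text \<open>In a triangle the strictly longest side faces an angle of more than 60 degrees, and unit
  vectors enclosing such an angle are at least 1 apart.\<close>

lemma unit_vectors_far_apart:
  fixes a b :: "'a::real_inner"
  assumes "norm a < norm (a - b)" "norm b < norm (a - b)" "b \<noteq> 0" "a \<noteq> 0"
  shows "1 \<le> dist (sgn a) (sgn b)"
proof -
  \<comment> \<open>By symmetry \<open>a\<close> may be the longer vector. Then
    \<open>norm a < norm (a - b)\<close> says \<open>2 * inner a b < (norm b)\<^sup>2\<close>, so
    the cosine is at most 1/2.\<close>
  have main: "1 \<le> dist (sgn a) (sgn b)"
    if ba: "norm b \<le> norm a" and far: "norm a < norm (a - b)" and b: "b \<noteq> 0" for a b :: 'a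
  proof -
    have a0: "norm a > 0" and b0: "norm b > 0" using ba b by auto
    have "(norm a)\<^sup>2 < (norm (a - b))\<^sup>2" using far by (simp add: power_strict_mono)
    also have "\<dots> = (norm a)\<^sup>2 + (norm b)\<^sup>2 - 2 * inner a b"
      by (simp add: power2_norm_eq_inner inner_diff_left inner_diff_right inner_commute)
    finally have "2 * inner a b < (norm b)\<^sup>2" by simp
    also have "\<dots> \<le> norm a * norm b" using ba by (simp add: power2_eq_square mult_right_mono)
    finally have "2 * (inner a b / (norm a * norm b)) \<le> 1" using a0 b0 by (simp add: field_simps)
    then have "2 * inner (sgn a) (sgn b) \<le> 1"
      by (simp add: sgn_div_norm divide_inverse mult_ac)
    moreover have "(norm (sgn a - sgn b))\<^sup>2 = 2 - 2 * inner (sgn a) (sgn b)"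
      using a0 b0 by (simp add: power2_norm_eq_inner inner_diff_left inner_diff_right inner_commute)
        (simp add: power2_norm_eq_inner[symmetric] norm_sgn)
    ultimately have "1\<^sup>2 \<le> (norm (sgn a - sgn b))\<^sup>2" by simp
    then show ?thesis unfolding dist_norm by (rule power2_le_imp_le) simp
  qed
  show ?thesis
  proof (cases "norm b \<le> norm a")
    case True then show ?thesis using main assms by blast
  next
    case False
    then show ?thesis using main[of a b] assms
      by (metis dist_commute linear main norm_minus_commute)
  qed
qed

text \<open>Seen from \<open>y\<close>, the centres whose balls contain \<open>y\<close> lie in
  directions that are 1 apart on the unit sphere, because
  \<open>norm (x - y) < \<rho> x \<le> norm (x - x')\<close>. Compactness of the sphere bounds their
  number by a constant of the space alone.\<close>

lemma besicovitch_overlap: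
  "\<exists>N. \<forall>(S :: 'a::euclidean_space set) \<rho> y. finite S \<and>
     (\<forall>x\<in>S. \<forall>x'\<in>S. x \<noteq> x' \<longrightarrow> max (\<rho> x) (\<rho> x') \<le> dist x x') \<longrightarrow> card {x\<in>S. y \<in> ball x (\<rho> x)} \<le> N"
proof -
  obtain N where N: "\<And>S::'a set. S \<subseteq> sphere 0 1 \<Longrightarrow> (\<forall>x\<in>S. \<forall>y\<in>S. x \<noteq> y \<longrightarrow> 1 \<le> dist x y)
      \<Longrightarrow> finite S \<and> card S \<le> N"
    using separated_subset_card_bound[OF compact_sphere[of "0::'a" 1] zero_less_one] by metis
  \<comment> \<open>The \<open>1\<close> covers the case where \<open>y\<close> is itself a centre
    and has no direction; with two or more centres in \<open>T\<close> this cannot occur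
    (\<open>ny\<close>).\<close>
  have "card {x\<in>S. y \<in> ball x (\<rho> x)} \<le> max 1 N"
    if fS: "finite S" and S: "\<forall>x\<in>S. \<forall>x'\<in>S. x \<noteq> x' \<longrightarrow> max (\<rho> x) (\<rho> x') \<le> dist x x'"
    for S :: "'a set" and \<rho> y
  proof -
    define T where "T = {x\<in>S. y \<in> ball x (\<rho> x)}"
    have T: "norm (x - y) < norm (x - x')" "norm (x' - y) < norm (x - x')"
      if "x \<in> T" "x' \<in> T" "x \<noteq> x'" for x x'
    proof -
      have "max (\<rho> x) (\<rho> x') \<le> dist x x'" "y \<in> ball x (\<rho> x)" "y \<in> ball x' (\<rho> x')"
        using S[rule_format, of x x'] that unfolding T_def by simp_all
      then show "norm (x - y) < norm (x - x')" "norm (x' - y) < norm (x - x')"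
        by (simp_all add: dist_norm)
    qed
    show ?thesis
    proof (cases "card T \<le> 1")
      case True then show ?thesis by (simp add: T_def)
    next
      case False
      have ny: "x \<noteq> y" if x: "x \<in> T" for x
      proof
        assume "x = y"
        have "\<not> T \<subseteq> {x}" using False card_mono[of "{x}" T] by auto
        then obtain x' where "x' \<in> T" "x' \<noteq> x" by auto
        then show False using T(2)[of x x'] x \<open>x = y\<close> by (simp add: norm_minus_commute)
      qed
      let ?f = "\<lambda>x. sgn (x - y)"
      have far: "1 \<le> dist (?f x) (?f x')" if "x \<in> T" "x' \<in> T" "x \<noteq> x'" for x x'
        using unit_vectors_far_apart[of "x - y" "x' - y"] T[OF that] ny that by simp
      have inj: "inj_on ?f T" using far by (metis (no_types, lifting) dist_self inj_onI not_one_le_zero)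
      have "card (?f ` T) \<le> N"
        proof (rule conjunct2[OF N])
          show "?f ` T \<subseteq> sphere 0 1" using ny by (auto simp: norm_sgn)
          show "\<forall>u\<in>?f ` T. \<forall>w\<in>?f ` T. u \<noteq> w \<longrightarrow> 1 \<le> dist u w"
          proof (intro ballI impI)
            fix u w assume "u \<in> ?f ` T" "w \<in> ?f ` T" "u \<noteq> w"
            then obtain x x' where "x \<in> T" "x' \<in> T" "u = ?f x" "w = ?f x'" "x \<noteq> x'" by blast
            then show "1 \<le> dist u w" using far by simp
          qed
        qed
      then show ?thesis using card_image[OF inj] by (simp add: T_def)
    qed
  qed
  then show ?thesis by blast
qed

text \<open>Radii are treated from the largest to the smallest. The points left uncovered by the
  larger balls all carry the current radius \<open>m\<close>, and a maximal
  \<open>m\<close>-separated set of them covers the rest.\<close>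

lemma besicovitch_selection:
  fixes A :: "'a::euclidean_space set" and P :: "real set"
  assumes "finite P" "\<forall>p\<in>P. p > 0" "bounded A" "\<rho> ` A \<subseteq> P"
  shows "\<exists>S\<subseteq>A. finite S \<and> A \<subseteq> (\<Union>x\<in>S. ball x (\<rho> x)) \<and>
    (\<forall>x\<in>S. \<forall>x'\<in>S. x \<noteq> x' \<longrightarrow> max (\<rho> x) (\<rho> x') \<le> dist x x')"
  using assms
proof (induction P arbitrary: A rule: finite_linorder_min_induct)
  case empty
  then have "A = {}" by auto
  then show ?case by auto
next
  case (insert m P)
  define A' where "A' = {x\<in>A. \<rho> x \<in> P}"
  have "bounded A'" "\<rho> ` A' \<subseteq> P" using insert.prems bounded_subset[of A A'] by (auto simp: A'_def)
  with insert.IH insert.prems obtain S where S: "S \<subseteq> A'" "finite S" "A' \<subseteq> (\<Union>x\<in>S. ball x (\<rho> x))"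
    "\<forall>x\<in>S. \<forall>x'\<in>S. x \<noteq> x' \<longrightarrow> max (\<rho> x) (\<rho> x') \<le> dist x x'" by (metis insert_iff)
  define B where "B = A - (\<Union>x\<in>S. ball x (\<rho> x))"
  have Bm: "\<rho> x = m" if "x \<in> B" for x using that S(3) insert.prems unfolding B_def A'_def by blast
  have m: "m > 0" using insert.prems by auto
  have "bounded B" using insert.prems bounded_subset unfolding B_def by blast
  then have "compact (closure B)" by (simp add: compact_closure)
  from separated_subset_card_bound[OF this m] obtain N where
    N: "\<And>T. T \<subseteq> closure B \<Longrightarrow> (\<forall>x\<in>T. \<forall>y\<in>T. x \<noteq> y \<longrightarrow> m \<le> dist x y) \<Longrightarrow> finite T \<and> card T \<le> N" by blast
  define Q where "Q T \<longleftrightarrow> T \<subseteq> B \<and> (\<forall>x\<in>T. \<forall>y\<in>T. x \<noteq> y \<longrightarrow> m \<le> dist x y)" for T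
  have QN: "finite T \<and> card T \<le> N" if "Q T" for T using N[of T] that closure_subset unfolding Q_def by blast
  \<comment> \<open>Separated sets in the compact closure have bounded size, so one of greatest
    cardinality exists; a point that it failed to cover could be added to it.\<close>
  have "\<exists>T. Q T \<and> (\<forall>T'. Q T' \<longrightarrow> card T' \<le> card T)"
  proof (rule ex_has_greatest_nat)
    show "Q {}" by (simp add: Q_def)
    show "\<forall>T. Q T \<longrightarrow> card T < Suc N" using QN by (simp add: less_Suc_eq_le)
  qed
  then obtain T where T: "Q T" "\<And>T'. Q T' \<Longrightarrow> card T' \<le> card T" by blast
  have cov: "x \<in> (\<Union>z\<in>T. ball z m)" if "x \<in> B" for x
  proof (rule ccontr)
    assume no: "x \<notin> (\<Union>z\<in>T. ball z m)"
    then have "x \<notin> T" using m by auto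
    have "Q (insert x T)" using T(1) no that unfolding Q_def by (auto simp: dist_commute not_less)
    then have "card (insert x T) \<le> card T" by (rule T(2))
    then show False using \<open>x \<notin> T\<close> QN[OF T(1)] by simp
  qed
  have TB: "T \<subseteq> B" using T(1) Q_def by blast
  \<comment> \<open>The new centre lies outside the older ball, whose radius is the larger of the
    two.\<close>
  have 1: "max (\<rho> x) (\<rho> x') \<le> dist x x'" if "x \<in> S" "x' \<in> T" for x x'
  proof -
    have "\<rho> x' = m" using Bm TB that by blast
    moreover have "m < \<rho> x" using insert.hyps(2) S(1) that A'_def by auto
    moreover have "x' \<notin> ball x (\<rho> x)" using TB that B_def by blast
    ultimately show ?thesis by simp
  qed
  show ?case
  proof (intro exI[of _ "S \<union> T"] conjI)
    show "S \<union> T \<subseteq> A" using S(1) TB A'_def B_def by blast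
    show "finite (S \<union> T)" using S(2) QN[OF T(1)] by blast
    show "A \<subseteq> (\<Union>x\<in>S \<union> T. ball x (\<rho> x))"
    proof
      fix x assume "x \<in> A"
      show "x \<in> (\<Union>x\<in>S \<union> T. ball x (\<rho> x))"
      proof (cases "x \<in> B")
        case True
        then obtain z where "z \<in> T" "x \<in> ball z m" using cov by blast
        then show ?thesis using Bm TB by (intro UN_I[of z]) auto
      next
        case False then show ?thesis using \<open>x \<in> A\<close> B_def by blast
      qed
    qed
    show "\<forall>x\<in>S \<union> T. \<forall>x'\<in>S \<union> T. x \<noteq> x' \<longrightarrow> max (\<rho> x) (\<rho> x') \<le> dist x x'"
    proof (intro ballI impI)
      fix x x' assume "x \<in> S \<union> T" "x' \<in> S \<union> T" "x \<noteq> x'"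
      then consider "x \<in> S" "x' \<in> S" | "x \<in> S" "x' \<in> T" | "x \<in> T" "x' \<in> S" | "x \<in> T" "x' \<in> T" by blast
      then show "max (\<rho> x) (\<rho> x') \<le> dist x x'"
      proof cases
        case 1 then show ?thesis using S(4) \<open>x \<noteq> x'\<close> by blast
      next
        case 2 then show ?thesis using 1 by blast
      next
        case 3 then show ?thesis using 1[of x' x] by (simp add: dist_commute max.commute)
      next
        case 4
        then have "\<rho> x = m" "\<rho> x' = m" using Bm TB by blast+
        then show ?thesis using T(1) \<open>x \<noteq> x'\<close> 4 unfolding Q_def by auto
      qed
    qed
  qed
qed

text \<open>One radius serves all nearby centres. Continuity from below shrinks the \<nu>-ball to
  some \<open>s < r\<close> while keeping the strict inequality, and then \<open>ball x s
  \<subseteq> ball y (s + \<delta>) \<subseteq> ball x r\<close> for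
  \<open>\<delta> = (r - s) / 2\<close>. This gives both the openness of the level sets and, on
  compact sets, finitely many radii.\<close>

lemma ball_density_locally_uniform:
  fixes \<pi> \<nu> :: "'a::euclidean_space measure"
  assumes fin: "finite_measure \<pi>" "finite_measure \<nu>" and sets: "sets \<pi> = sets borel" "sets \<nu> = sets borel"
    and t: "t \<ge> 0" and r: "r > 0" "t * measure \<pi> (ball x r) < measure \<nu> (ball x r)"
  shows "\<exists>\<delta>>0. \<exists>\<rho>>0. \<forall>y\<in>ball x \<delta>. t * measure \<pi> (ball y \<rho>) < measure \<nu> (ball y \<rho>)"
proof -
  interpret p: finite_measure \<pi> by fact
  interpret n: finite_measure \<nu> by fact
  \<comment> \<open>The \<open>2\<close> keeps the radius positive already for
    \<open>n = 0\<close>.\<close>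
  define b where "b n = ball x (r - r / real (n + 2))" for n :: nat
  have "incseq b"
    unfolding b_def by (intro incseq_SucI subset_ball) (use r in \<open>auto simp: field_simps\<close>)
  have "(\<lambda>n. r - r / real (n + 2)) \<longlonglongrightarrow> r - 0"
    by (intro tendsto_diff tendsto_const LIMSEQ_ignore_initial_segment lim_const_over_n)
  then have lim: "(\<lambda>n. r - r / real (n + 2)) \<longlonglongrightarrow> r" by simp
  have "(\<Union>n. b n) = ball x r"
  proof (intro equalityI subsetI)
    fix y assume "y \<in> (\<Union>n. b n)"
    then obtain n where "y \<in> ball x (r - r / real (n + 2))" unfolding b_def by blast
    moreover have "r / real (n + 2) \<ge> 0" using r by simp
    ultimately show "y \<in> ball x r" unfolding mem_ball by linarith
  next
    fix y assume "y \<in> ball x r"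
    then have "eventually (\<lambda>n. dist x y < r - r / real (n + 2)) sequentially"
      using order_tendstoD(1)[OF lim] by simp
    then obtain n where "dist x y < r - r / real (n + 2)" using eventually_happens by force
    then show "y \<in> (\<Union>n. b n)" by (auto simp: b_def)
  qed
  moreover have "(\<lambda>n. measure \<nu> (b n)) \<longlonglongrightarrow> measure \<nu> (\<Union>n. b n)"
    by (rule n.finite_Lim_measure_incseq[OF _ \<open>incseq b\<close>]) (use sets in \<open>auto simp: b_def\<close>)
  ultimately have "eventually (\<lambda>n. t * measure \<pi> (ball x r) < measure \<nu> (b n)) sequentially"
    using order_tendstoD(1) r(2) by metis
  then obtain n where n: "t * measure \<pi> (ball x r) < measure \<nu> (b n)" using eventually_happens by force
  define s where "s = r - r / real (n + 2)"
  have s: "0 < s" "s < r"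
  proof -
    have "r / real (n + 2) < r / 1" using r(1) by (intro divide_strict_left_mono) auto
    then show "0 < s" by (simp add: s_def)
    show "s < r" using r(1) by (simp add: s_def)
  qed
  define \<delta> where "\<delta> = (r - s) / 2"
  have "t * measure \<pi> (ball y (s + \<delta>)) < measure \<nu> (ball y (s + \<delta>))" if y: "y \<in> ball x \<delta>" for y
  proof -
    have "ball y (s + \<delta>) \<subseteq> ball x r"
    proof
      fix z assume "z \<in> ball y (s + \<delta>)"
      then show "z \<in> ball x r" using y dist_triangle[of x z y] by (simp add: \<delta>_def field_simps)
    qed
    then have "t * measure \<pi> (ball y (s + \<delta>)) \<le> t * measure \<pi> (ball x r)"
      using t sets by (intro mult_left_mono p.finite_measure_mono) auto
    also have "\<dots> < measure \<nu> (ball x s)" using n unfolding b_def s_def .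
    also have "\<dots> \<le> measure \<nu> (ball y (s + \<delta>))"
    proof (rule n.finite_measure_mono)
      show "ball x s \<subseteq> ball y (s + \<delta>)"
      proof
        fix z assume "z \<in> ball x s"
        then show "z \<in> ball y (s + \<delta>)" using y dist_triangle[of y z x] by (simp add: dist_commute)
      qed
    qed (use sets in auto)
    finally show ?thesis .
  qed
  moreover have "\<delta> > 0" using s by (simp add: \<delta>_def)
  moreover have "s + \<delta> > 0" using s \<open>\<delta> > 0\<close> by linarith
  ultimately show ?thesis by blast
qed

text \<open>The weak type bound for the centred maximal function of \<nu> with respect to \<pi>. The
  constant is the overlap number, chosen before the measures; it takes the place of a doubling
  constant.\<close>

lemma maximal_inequality:
  "\<exists>N::nat. \<forall>(\<pi> :: 'a::euclidean_space measure) \<nu> t. finite_measure \<pi> \<and> finite_measure \<nu> \<and>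
     sets \<pi> = sets borel \<and> sets \<nu> = sets borel \<and> t \<ge> 0 \<longrightarrow>
     open {x. \<exists>r>0. t * measure \<pi> (ball x r) < measure \<nu> (ball x r)} \<and>
     t * measure \<pi> {x. \<exists>r>0. t * measure \<pi> (ball x r) < measure \<nu> (ball x r)} \<le> real N * measure \<nu> UNIV"
proof -
  obtain N where N: "\<And>(S :: 'a set) \<rho> y. finite S \<Longrightarrow>
     (\<forall>x\<in>S. \<forall>x'\<in>S. x \<noteq> x' \<longrightarrow> max (\<rho> x) (\<rho> x') \<le> dist x x') \<Longrightarrow> card {x\<in>S. y \<in> ball x (\<rho> x)} \<le> N"
    using besicovitch_overlap[where 'a='a] by metis
  have "open A \<and> t * measure \<pi> A \<le> real N * measure \<nu> UNIV"
    if fin: "finite_measure \<pi>" "finite_measure \<nu>" and sets: "sets \<pi> = sets borel" "sets \<nu> = sets borel"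
      and t: "t \<ge> 0" and A_def: "A = {x. \<exists>r>0. t * measure \<pi> (ball x r) < measure \<nu> (ball x r)}"
    for \<pi> \<nu> :: "'a measure" and t A
  proof -
    interpret p: finite_measure \<pi> by fact
    interpret n: finite_measure \<nu> by fact
    have loc: "\<exists>\<delta>>0. \<exists>\<rho>>0. \<forall>y\<in>ball x \<delta>. t * measure \<pi> (ball y \<rho>) < measure \<nu> (ball y \<rho>)" if "x \<in> A" for x
      using that ball_density_locally_uniform[OF fin sets t] unfolding A_def by blast
    then obtain \<delta> q where dq: "\<And>x. x \<in> A \<Longrightarrow> \<delta> x > 0 \<and> q x > 0 \<and>
        (\<forall>y\<in>ball x (\<delta> x). t * measure \<pi> (ball y (q x)) < measure \<nu> (ball y (q x)))" by metis
    have "open A"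
      unfolding open_contains_ball
    proof
      fix x assume x: "x \<in> A"
      have "ball x (\<delta> x) \<subseteq> A" using dq[OF x] unfolding A_def by blast
      then show "\<exists>e>0. ball x e \<subseteq> A" using dq[OF x] by blast
    qed
    have comp: "t * measure \<pi> K \<le> real N * measure \<nu> UNIV" if K: "compact K" "K \<subseteq> A" for K
    proof -
      obtain D where D: "D \<subseteq> K" "finite D" "K \<subseteq> (\<Union>x\<in>D. ball x (\<delta> x))"
      proof (rule compactE_image[OF K(1), of K "\<lambda>x. ball x (\<delta> x)"])
        show "K \<subseteq> (\<Union>c\<in>K. ball c (\<delta> c))" using dq K(2) by force
      qed auto
      then have "\<forall>x\<in>K. \<exists>d\<in>D. x \<in> ball d (\<delta> d)" by blast
      then obtain c where c: "\<And>x. x \<in> K \<Longrightarrow> c x \<in> D \<and> x \<in> ball (c x) (\<delta> (c x))" by metis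
      \<comment> \<open>Each point inherits the radius of the member of the finite subcover that
        contains it, so only finitely many radii occur.\<close>
      define \<rho> where "\<rho> x = q (c x)" for x
      have "\<exists>S\<subseteq>K. finite S \<and> K \<subseteq> (\<Union>x\<in>S. ball x (\<rho> x)) \<and>
        (\<forall>x\<in>S. \<forall>x'\<in>S. x \<noteq> x' \<longrightarrow> max (\<rho> x) (\<rho> x') \<le> dist x x')"
      proof (rule besicovitch_selection[of "q ` D"])
        show "\<rho> ` K \<subseteq> q ` D" using c by (auto simp: \<rho>_def)
        show "\<forall>p\<in>q ` D. 0 < p" using D(1) K(2) dq by blast
      qed (use D compact_imp_bounded[OF K(1)] in auto)
      then obtain S where S: "S \<subseteq> K" "finite S" "K \<subseteq> (\<Union>x\<in>S. ball x (\<rho> x))"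
        "\<forall>x\<in>S. \<forall>x'\<in>S. x \<noteq> x' \<longrightarrow> max (\<rho> x) (\<rho> x') \<le> dist x x'" by blast
      have "measure \<pi> K \<le> measure \<pi> (\<Union>x\<in>S. ball x (\<rho> x))"
        by (rule p.finite_measure_mono) (use S(2,3) sets in auto)
      also have "\<dots> \<le> (\<Sum>x\<in>S. measure \<pi> (ball x (\<rho> x)))"
        by (rule measure_UNION_le) (use S(2) sets in auto)
      finally have "t * measure \<pi> K \<le> (\<Sum>x\<in>S. t * measure \<pi> (ball x (\<rho> x)))"
        using t by (simp add: sum_distrib_left[symmetric] mult_left_mono)
      also have "\<dots> \<le> (\<Sum>x\<in>S. measure \<nu> (ball x (\<rho> x)))"
      proof (rule sum_mono)
        fix x assume "x \<in> S"
        then have "x \<in> K" using S(1) by blast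
        with c have "c x \<in> A" "x \<in> ball (c x) (\<delta> (c x))" using D(1) K(2) by blast+
        then show "t * measure \<pi> (ball x (\<rho> x)) \<le> measure \<nu> (ball x (\<rho> x))"
          using dq unfolding \<rho>_def by (meson less_imp_le)
      qed
      \<comment> \<open>The sum of the measures is the integral of the overlap count, which is at
        most \<open>N\<close>.\<close>
      also have "\<dots> = (\<Sum>x\<in>S. LINT y|\<nu>. indicator (ball x (\<rho> x)) y)"
        using sets by (simp add: space_borel sets_eq_imp_space_eq)
      also have "\<dots> = (LINT y|\<nu>. (\<Sum>x\<in>S. indicator (ball x (\<rho> x)) y))"
        by (rule Bochner_Integration.integral_sum[symmetric])
          (use sets in \<open>auto intro!: integrable_real_indicator simp: n.emeasure_finite less_top[symmetric]\<close>)
      also have "\<dots> \<le> (LINT y|\<nu>. real N)"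
      proof (rule integral_mono)
        fix y
        have "(\<Sum>x\<in>S. indicator (ball x (\<rho> x)) y) = real (card {x\<in>S. y \<in> ball x (\<rho> x)})"
          using S(2) by (simp add: indicator_def sum.If_cases Int_def)
        also have "\<dots> \<le> real N" using N[OF S(2,4)] by simp
        finally show "(\<Sum>x\<in>S. indicator (ball x (\<rho> x)) y) \<le> real N" .
      qed (use sets in \<open>auto intro!: integrable_real_indicator simp: n.emeasure_finite less_top[symmetric]\<close>)
      also have "\<dots> = real N * measure \<nu> UNIV"
        using sets by (simp add: sets_eq_imp_space_eq)
      finally show ?thesis .
    qed
    have "t * measure \<pi> A \<le> real N * measure \<nu> UNIV"
    proof (rule field_le_epsilon)
      fix e :: real assume e: "e > 0"
      \<comment> \<open>Inner regularity passes from compact sets to the open level set; the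
        \<open>1\<close> in the denominator admits \<open>t = 0\<close>.\<close>
      define e' where "e' = e / (t + 1)"
      have e': "e' > 0" using e t by (simp add: e'_def)
      have "emeasure \<pi> A = (SUP K\<in>{K. K \<subseteq> A \<and> compact K}. emeasure \<pi> K)"
        by (rule inner_regular) (use sets \<open>open A\<close> p.emeasure_finite in auto)
      moreover have "\<exists>K. K \<subseteq> A \<and> compact K \<and> measure \<pi> A < measure \<pi> K + e'"
      proof (rule ccontr)
        assume no: "\<nexists>K. K \<subseteq> A \<and> compact K \<and> measure \<pi> A < measure \<pi> K + e'"
        have "(SUP K\<in>{K. K \<subseteq> A \<and> compact K}. emeasure \<pi> K) \<le> ennreal (measure \<pi> A - e')"
        proof (rule SUP_least)
          fix K assume "K \<in> {K. K \<subseteq> A \<and> compact K}"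
          then have "measure \<pi> K \<le> measure \<pi> A - e'" using no by force
          then show "emeasure \<pi> K \<le> ennreal (measure \<pi> A - e')"
            by (simp add: p.emeasure_eq_measure ennreal_leI)
        qed
        then have "ennreal (measure \<pi> A) \<le> ennreal (measure \<pi> A - e')"
          using calculation by (simp add: p.emeasure_eq_measure)
        moreover have "0 \<le> measure \<pi> A - e'" using no by (metis compact_empty empty_subsetI measure_empty add_0 not_less diff_ge_0_iff_ge)
        ultimately show False using e' by (simp add: ennreal_le_iff)
      qed
      ultimately obtain K where K: "K \<subseteq> A" "compact K" "measure \<pi> A < measure \<pi> K + e'" by blast
      have "t * measure \<pi> A \<le> t * measure \<pi> K + t * e'"
        using K(3) t by (metis distrib_left less_imp_le mult_left_mono)
      also have "t * e' \<le> e" using e t by (simp add: e'_def field_simps)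
      finally show "t * measure \<pi> A \<le> real N * measure \<nu> UNIV + e" using comp[OF K(2,1)] by linarith
    qed
    then show ?thesis using \<open>open A\<close> by blast
  qed
  then show ?thesis by blast
qed

text \<open>Outside the support of \<pi> the quotient would be a division by zero on small balls, so
  the property is made vacuous there.\<close>

abbreviation has_ball_density_limit :: "'a::euclidean_space measure \<Rightarrow> ('a \<Rightarrow> real) \<Rightarrow> 'a \<Rightarrow> bool" where
  "has_ball_density_limit \<pi> f x \<equiv> (\<forall>r>0. measure \<pi> (ball x r) > 0) \<longrightarrow>
     ((\<lambda>r. (LINT y:ball x r|\<pi>. f y) / measure \<pi> (ball x r)) \<longlongrightarrow> f x) (at_right 0)"

text \<open>Differentiability along balls is closed under limits in L1: the maximal inequality
  controls the ball averages of the error, Markov's inequality the error at the point itself. The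
  restriction to \<open>X\<close> allows the use for an indicator off its own set.\<close>

lemma ball_density_limit_approx:
  fixes \<pi> :: "'a::euclidean_space measure" and f :: "'a \<Rightarrow> real"
  assumes fin: "finite_measure \<pi>" and sets: "sets \<pi> = sets borel" and f: "integrable \<pi> f"
    and approx: "\<And>e. e > 0 \<Longrightarrow> \<exists>g. integrable \<pi> g \<and>
        (AE x in \<pi>. x \<in> X \<longrightarrow> has_ball_density_limit \<pi> g x) \<and> (LINT x|\<pi>. \<bar>f x - g x\<bar>) \<le> e"
  shows "AE x in \<pi>. x \<in> X \<longrightarrow> has_ball_density_limit \<pi> f x"
proof -
  interpret p: finite_measure \<pi> by fact
  have spU: "space \<pi> = UNIV" using sets by (metis sets_eq_imp_space_eq space_borel)
  obtain N where N: "\<And>\<nu> t. finite_measure \<nu> \<Longrightarrow> sets \<nu> = sets borel \<Longrightarrow> t \<ge> 0 \<Longrightarrow>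
     open {x. \<exists>r>0. t * measure \<pi> (ball x r) < measure \<nu> (ball x r)} \<and>
     t * measure \<pi> {x. \<exists>r>0. t * measure \<pi> (ball x r) < measure \<nu> (ball x r)} \<le> real N * measure \<nu> UNIV"
    using maximal_inequality[where 'a='a] fin sets by blast
  have "\<forall>n. \<exists>g. integrable \<pi> g \<and> (AE x in \<pi>. x \<in> X \<longrightarrow> has_ball_density_limit \<pi> g x) \<and>
      (LINT x|\<pi>. \<bar>f x - g x\<bar>) \<le> inverse (real (Suc n))"
    by (intro allI approx) simp
  from choice[OF this] obtain g where "\<forall>n. integrable \<pi> (g n) \<and> (AE x in \<pi>. x \<in> X \<longrightarrow> has_ball_density_limit \<pi> (g n) x) \<and>
      (LINT x|\<pi>. \<bar>f x - g n x\<bar>) \<le> inverse (real (Suc n))" ..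
  then have g: "integrable \<pi> (g n)" "AE x in \<pi>. x \<in> X \<longrightarrow> has_ball_density_limit \<pi> (g n) x"
      "(LINT x|\<pi>. \<bar>f x - g n x\<bar>) \<le> inverse (real (Suc n))" for n by simp_all
  define \<nu> where "\<nu> n = density \<pi> (\<lambda>x. ennreal \<bar>f x - g n x\<bar>)" for n
  have int: "integrable \<pi> (\<lambda>x. \<bar>f x - g n x\<bar>)" for n using f g(1) by simp
  have \<nu>: "emeasure (\<nu> n) B = ennreal (LINT x:B|\<pi>. \<bar>f x - g n x\<bar>)" if "B \<in> sets borel" for n B
  proof -
    have "emeasure (\<nu> n) B = (\<integral>\<^sup>+x. ennreal \<bar>f x - g n x\<bar> * indicator B x \<partial>\<pi>)"
      unfolding \<nu>_def using int[of n] that sets by (intro emeasure_density) auto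
    also have "\<dots> = (\<integral>\<^sup>+x. ennreal (indicator B x * \<bar>f x - g n x\<bar>) \<partial>\<pi>)"
      by (intro nn_integral_cong) (simp split: split_indicator)
    also have "\<dots> = ennreal (LINT x|\<pi>. indicator B x * \<bar>f x - g n x\<bar>)"
      using integrable_mult_indicator[OF _ int[of n], of B] that sets by (intro nn_integral_eq_integral) auto
    finally show ?thesis by (simp add: set_lebesgue_integral_def)
  qed
  have m\<nu>: "measure (\<nu> n) B = (LINT x:B|\<pi>. \<bar>f x - g n x\<bar>)" if "B \<in> sets borel" for n B
    unfolding measure_def \<nu>[OF that] by (simp add: set_lebesgue_integral_def integral_nonneg_AE)
  have sets\<nu>: "sets (\<nu> n) = sets borel" for n by (simp add: \<nu>_def sets)
  have fin\<nu>: "finite_measure (\<nu> n)" for n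
    by (rule finite_measureI) (use \<nu>[of UNIV n] spU in \<open>simp add: \<nu>_def\<close>)
  have total: "measure (\<nu> n) UNIV \<le> inverse (real (Suc n))" for n
    using m\<nu>[of UNIV n] g(3)[of n] by (simp add: set_lebesgue_integral_def)
  \<comment> \<open>Three errors of size \<open>t\<close>: the ball average of
    \<open>f - g n\<close> (small off \<open>A n\<close>), the convergence for \<open>g n\<close>,
    and \<open>f x - g n x\<close> (small off \<open>E n\<close>).\<close>
  have level: "AE x in \<pi>. x \<in> X \<longrightarrow> (\<forall>r>0. measure \<pi> (ball x r) > 0) \<longrightarrow>
      eventually (\<lambda>r. \<bar>(LINT y:ball x r|\<pi>. f y) / measure \<pi> (ball x r) - f x\<bar> < 3 * t) (at_right 0)"
    if t: "t > 0" for t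
  proof -
    define A where "A n = {x. \<exists>r>0. t * measure \<pi> (ball x r) < measure (\<nu> n) (ball x r)}" for n
    define E where "E n = {x\<in>space \<pi>. \<bar>f x - g n x\<bar> \<ge> t}" for n
    have A: "A n \<in> sets \<pi>" "t * measure \<pi> (A n) \<le> real N * inverse (real (Suc n))" for n
    proof -
      have "open (A n)" "t * measure \<pi> (A n) \<le> real N * measure (\<nu> n) UNIV"
        using N[OF fin\<nu>[of n] sets\<nu>[of n], of t] t unfolding A_def by auto
      moreover have "real N * measure (\<nu> n) UNIV \<le> real N * inverse (real (Suc n))"
        by (rule mult_left_mono[OF total]) simp
      ultimately show "A n \<in> sets \<pi>" "t * measure \<pi> (A n) \<le> real N * inverse (real (Suc n))"
        using sets by (auto simp del: of_nat_Suc)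
    qed
    have E: "E n \<in> sets \<pi>" "t * measure \<pi> (E n) \<le> inverse (real (Suc n))" for n
    proof -
      show "E n \<in> sets \<pi>" unfolding E_def using int[of n] by measurable
      have "measure \<pi> (E n) \<le> (LINT x|\<pi>. \<bar>f x - g n x\<bar>) / t"
        unfolding E_def by (rule integral_Markov_inequality_measure[where A="{}"]) (use int t in auto)
      then show "t * measure \<pi> (E n) \<le> inverse (real (Suc n))"
        using g(3)[of n] t by (simp add: pos_le_divide_eq mult.commute del: of_nat_Suc)
    qed
    \<comment> \<open>A point outside \<open>Z\<close> has one good index \<open>n\<close>, which
      suffices. \<open>Z\<close> is null because \<open>A n\<close> and \<open>E n\<close> together
      have measure at most \<open>(N + 1) / (t * Suc n)\<close>.\<close>
    define Z where "Z = (\<Inter>n. A n \<union> E n)"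
    have Zs: "Z \<in> sets \<pi>" unfolding Z_def using A(1) E(1) by (intro sets.countable_INT) auto
    have "measure \<pi> Z \<le> (real N + 1) / t * inverse (real (Suc n))" for n
    proof -
      have "measure \<pi> Z \<le> measure \<pi> (A n \<union> E n)"
        by (rule p.finite_measure_mono) (use A(1) E(1) in \<open>auto simp: Z_def\<close>)
      also have "\<dots> \<le> measure \<pi> (A n) + measure \<pi> (E n)" by (rule measure_Un_le) (use A E in auto)
      finally have "t * measure \<pi> Z \<le> t * measure \<pi> (A n) + t * measure \<pi> (E n)"
        using t by (metis distrib_left less_imp_le mult_left_mono)
      also have "\<dots> \<le> (real N + 1) * inverse (real (Suc n))"
        using A(2)[of n] E(2)[of n] by (simp only: distrib_right mult_1)
      finally have "measure \<pi> Z \<le> (real N + 1) * inverse (real (Suc n)) / t"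
        using t by (simp add: pos_le_divide_eq mult.commute del: of_nat_Suc)
      then show ?thesis by (simp only: times_divide_eq_left)
    qed
    moreover have "(\<lambda>n. (real N + 1) / t * inverse (real (Suc n))) \<longlonglongrightarrow> (real N + 1) / t * 0"
      by (intro tendsto_mult_left LIMSEQ_inverse_real_of_nat)
    ultimately have "measure \<pi> Z \<le> (real N + 1) / t * 0"
      by (intro LIMSEQ_le_const) auto
    then have "Z \<in> null_sets \<pi>" using Zs
      by (simp add: null_sets_def p.emeasure_eq_measure measure_le_0_iff)
    then have "AE x in \<pi>. x \<notin> Z" by (rule AE_not_in)
    moreover have "AE x in \<pi>. \<forall>n. x \<in> X \<longrightarrow> has_ball_density_limit \<pi> (g n) x"
      unfolding AE_all_countable using g(2) by blast
    ultimately show ?thesis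
    proof eventually_elim
      case (elim x)
      show ?case
      proof (intro impI)
        assume X: "x \<in> X" and supp: "\<forall>r>0. measure \<pi> (ball x r) > 0"
        obtain n where n: "x \<notin> A n" "x \<notin> E n" using elim(1) by (auto simp: Z_def)
        have "((\<lambda>r. (LINT y:ball x r|\<pi>. g n y) / measure \<pi> (ball x r)) \<longlongrightarrow> g n x) (at_right 0)"
          using elim(2) X supp by blast
        then have "eventually (\<lambda>r. dist ((LINT y:ball x r|\<pi>. g n y) / measure \<pi> (ball x r)) (g n x) < t) (at_right 0)"
          using t by (rule tendstoD)
        moreover have "eventually (\<lambda>r::real. r > 0) (at_right 0)" by (simp add: eventually_at_right_less)
        ultimately show "eventually (\<lambda>r. \<bar>(LINT y:ball x r|\<pi>. f y) / measure \<pi> (ball x r) - f x\<bar> < 3 * t) (at_right 0)"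
        proof eventually_elim
          case (elim r)
          have b: "measure \<pi> (ball x r) > 0" using supp elim by blast
          have si: "set_integrable \<pi> (ball x r) h" if "integrable \<pi> h" for h :: "'a \<Rightarrow> real"
            using that sets unfolding set_integrable_def by (intro integrable_mult_indicator) auto
          have "\<bar>(LINT y:ball x r|\<pi>. f y) - (LINT y:ball x r|\<pi>. g n y)\<bar> = \<bar>LINT y:ball x r|\<pi>. f y - g n y\<bar>"
            using si f g(1) by (simp add: set_integral_diff)
          also have "\<dots> \<le> (LINT y:ball x r|\<pi>. \<bar>f y - g n y\<bar>)"
            using set_integral_norm_bound[OF si, of "\<lambda>y. f y - g n y"] f g(1)[of n] by simp
          also have "\<dots> \<le> t * measure \<pi> (ball x r)"
            using n(1) elim m\<nu>[of "ball x r" n] unfolding A_def by force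
          finally have "\<bar>(LINT y:ball x r|\<pi>. f y) / measure \<pi> (ball x r) - (LINT y:ball x r|\<pi>. g n y) / measure \<pi> (ball x r)\<bar> \<le> t"
            using b by (simp add: diff_divide_distrib[symmetric] field_simps)
          moreover have "\<bar>f x - g n x\<bar> < t" using n(2) spU by (simp add: E_def)
          ultimately show ?case using elim by (simp add: dist_real_def)
        qed
      qed
    qed
  qed
  have "AE x in \<pi>. \<forall>k. x \<in> X \<longrightarrow> (\<forall>r>0. measure \<pi> (ball x r) > 0) \<longrightarrow>
      eventually (\<lambda>r. \<bar>(LINT y:ball x r|\<pi>. f y) / measure \<pi> (ball x r) - f x\<bar> < 3 * inverse (real (Suc k))) (at_right 0)"
    unfolding AE_all_countable by (intro allI level) simp
  then show ?thesis
  proof eventually_elim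
    case (elim x)
    show ?case
    proof (intro impI tendstoI)
      fix e :: real
      assume X: "x \<in> X" "\<forall>r>0. measure \<pi> (ball x r) > 0" and e: "e > 0"
      obtain k where "inverse (real (Suc k)) < e / 3" using reals_Archimedean[of "e/3"] e by auto
      moreover have "eventually (\<lambda>r. \<bar>(LINT y:ball x r|\<pi>. f y) / measure \<pi> (ball x r) - f x\<bar> < 3 * inverse (real (Suc k))) (at_right 0)"
        using elim X by blast
      ultimately show "eventually (\<lambda>r. dist ((LINT y:ball x r|\<pi>. f y) / measure \<pi> (ball x r)) (f x) < e) (at_right 0)"
        by (elim eventually_mono) (simp add: dist_real_def)
    qed
  qed
qed

text \<open>A compact subset \<open>K\<close> approximates \<open>A\<close> in measure, and the
  averages of its indicator vanish on small balls around a point outside \<open>A\<close>, since the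
  complement of \<open>K\<close> is open.\<close>

lemma ball_density_limit_indicator_complement:
  fixes \<pi> :: "'a::euclidean_space measure"
  assumes fin: "finite_measure \<pi>" and sets: "sets \<pi> = sets borel" and A: "A \<in> sets borel"
  shows "AE x in \<pi>. x \<in> - A \<longrightarrow> has_ball_density_limit \<pi> (indicator A) x"
proof (rule ball_density_limit_approx[OF fin sets])
  interpret p: finite_measure \<pi> by fact
  have int: "integrable \<pi> (indicator B :: 'a \<Rightarrow> real)" if "B \<in> sets borel" for B
    using that sets p.emeasure_finite by (intro integrable_real_indicator) (auto simp: less_top[symmetric])
  show "integrable \<pi> (indicator A :: 'a \<Rightarrow> real)" by (rule int[OF A])
  fix e :: real assume e: "e > 0"
  have reg: "emeasure \<pi> A = (SUP K\<in>{K. K \<subseteq> A \<and> compact K}. emeasure \<pi> K)"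
    by (rule inner_regular) (use sets A p.emeasure_finite in auto)
  have ne: "{K. K \<subseteq> A \<and> compact K} \<noteq> {}" by (auto intro: exI[of _ "{}"])
  have "emeasure \<pi> A \<noteq> \<infinity>" by (simp add: p.emeasure_finite)
  then have "\<exists>K\<in>{K. K \<subseteq> A \<and> compact K}. emeasure \<pi> A < emeasure \<pi> K + ennreal e"
    by (rule SUP_approx_ennreal[OF e ne reg])
  then obtain K where K: "K \<subseteq> A" "compact K" "emeasure \<pi> A < emeasure \<pi> K + ennreal e" by blast
  have "measure \<pi> A < measure \<pi> K + e"
    using K(3) e by (simp add: p.emeasure_eq_measure ennreal_plus[symmetric] ennreal_less_iff del: ennreal_plus)
  have Kb: "K \<in> sets borel" using K(2) by (simp add: borel_compact)
  have "(LINT x|\<pi>. \<bar>indicator A x - indicator K x\<bar>) = (LINT x|\<pi>. indicator A x - indicator K x :: real)"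
    using K(1) by (intro Bochner_Integration.integral_cong) (auto split: split_indicator)
  also have "\<dots> = measure \<pi> A - measure \<pi> K"
    using int[OF A] int[OF Kb] A Kb sets by (simp add: sets_eq_imp_space_eq[OF sets])
  finally have "(LINT x|\<pi>. \<bar>indicator A x - indicator K x\<bar>) \<le> e" using \<open>measure \<pi> A < measure \<pi> K + e\<close> by simp
  moreover have "has_ball_density_limit \<pi> (indicator K) x" if x: "x \<in> - A" for x
  proof
    assume "\<forall>r>0. measure \<pi> (ball x r) > 0"
    have "open (- K)" using K(2) by (simp add: compact_imp_closed open_Compl)
    then obtain d where d: "d > 0" "ball x d \<subseteq> - K" using x K(1) open_contains_ball by blast
    have "eventually (\<lambda>r. r < d) (at_right (0::real))" using d(1) by (auto simp: eventually_at_right_field)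
    then have "eventually (\<lambda>r. (LINT y:ball x r|\<pi>. indicator K y) / measure \<pi> (ball x r) = (indicator K x :: real)) (at_right 0)"
    proof eventually_elim
      case (elim r)
      have "ball x r \<inter> K = {}" using d(2) elim subset_ball[of r d x] by auto
      then have "(LINT y:ball x r|\<pi>. indicator K y) = (LINT y|\<pi>. 0 :: real)"
        unfolding set_lebesgue_integral_def
        by (intro Bochner_Integration.integral_cong) (auto split: split_indicator)
      then show ?case using x K(1) by (auto split: split_indicator)
    qed
    then show "((\<lambda>r. (LINT y:ball x r|\<pi>. indicator K y) / measure \<pi> (ball x r)) \<longlongrightarrow> (indicator K x :: real)) (at_right 0)"
      by (rule tendsto_eventually)
  qed
  ultimately show "\<exists>g. integrable \<pi> g \<and> (AE x in \<pi>. x \<in> - A \<longrightarrow> has_ball_density_limit \<pi> g x) \<and>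
      (LINT x|\<pi>. \<bar>indicator A x - g x\<bar>) \<le> e"
    using int[OF Kb] by (intro exI[of _ "indicator K"]) auto
qed

text \<open>For an indicator, the preceding lemma is applied to the set and to its complement;
  linearity and the closure under limits in L1 do the rest.\<close>

theorem lebesgue_besicovitch_differentiation:
  fixes \<pi> :: "'a::euclidean_space measure" and f :: "'a \<Rightarrow> real"
  assumes fin: "finite_measure \<pi>" and sets: "sets \<pi> = sets borel" and f: "integrable \<pi> f"
  shows "AE x in \<pi>. has_ball_density_limit \<pi> f x"
  using f
proof (induction rule: integrable_induct)
  case (base A c)
  interpret p: finite_measure \<pi> by fact
  have A: "A \<in> sets borel" using base sets by simp
  have int: "integrable \<pi> (indicator B :: 'a \<Rightarrow> real)" if "B \<in> sets borel" for B
    using that sets p.emeasure_finite by (intro integrable_real_indicator) (auto simp: less_top[symmetric])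
  have "AE x in \<pi>. x \<in> - A \<longrightarrow> has_ball_density_limit \<pi> (indicator A) x"
    by (rule ball_density_limit_indicator_complement[OF fin sets A])
  moreover have "AE x in \<pi>. x \<in> - (- A) \<longrightarrow> has_ball_density_limit \<pi> (indicator (- A)) x"
    by (rule ball_density_limit_indicator_complement[OF fin sets]) (use A in auto)
  ultimately show ?case
  proof eventually_elim
    case (elim x)
    show ?case
    proof
      assume supp: "\<forall>r>0. measure \<pi> (ball x r) > 0"
      have "((\<lambda>r. (LINT y:ball x r|\<pi>. indicator A y) / measure \<pi> (ball x r)) \<longlongrightarrow> (indicator A x :: real)) (at_right 0)"
      proof (cases "x \<in> A")
        case False then show ?thesis using elim(1) supp by simp
      next
        case True
        \<comment> \<open>At a point of \<open>A\<close> the averages are one minus those of the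
          complement, to which the preceding lemma applies.\<close>
        then have "((\<lambda>r. 1 - (LINT y:ball x r|\<pi>. indicator (-A) y) / measure \<pi> (ball x r)) \<longlongrightarrow> (1 - indicator (-A) x :: real)) (at_right 0)"
          using elim(2) supp by (intro tendsto_diff tendsto_const) simp
        moreover have "eventually (\<lambda>r. 1 - (LINT y:ball x r|\<pi>. indicator (-A) y) / measure \<pi> (ball x r)
            = (LINT y:ball x r|\<pi>. indicator A y) / measure \<pi> (ball x r)) (at_right 0)"
          using eventually_at_right_less[of "0::real"]
        proof eventually_elim
          case (elim r)
          have b: "measure \<pi> (ball x r) > 0" using supp elim by blast
          have eq: "(LINT y:ball x r|\<pi>. indicator B y) = measure \<pi> (ball x r \<inter> B)" if "B \<in> sets borel" for B
          proof -
            have "(LINT y:ball x r|\<pi>. indicator B y) = (LINT y|\<pi>. indicator (ball x r \<inter> B) y :: real)"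
              unfolding set_lebesgue_integral_def by (simp add: indicator_inter_arith)
            then show ?thesis using that sets by (simp add: sets_eq_imp_space_eq[OF sets])
          qed
          have "measure \<pi> (ball x r \<inter> A) + measure \<pi> (ball x r \<inter> - A) = measure \<pi> (ball x r)"
            using A sets by (subst p.finite_measure_Union[symmetric]) (auto intro!: arg_cong[where f="measure \<pi>"])
          then show ?case using b A eq[OF A] eq[of "-A"] by (auto simp: field_simps)
        qed
        ultimately show ?thesis using True by (auto elim: Lim_transform_eventually)
      qed
      then have "((\<lambda>r. (LINT y:ball x r|\<pi>. indicator A y) / measure \<pi> (ball x r) * c) \<longlongrightarrow> indicator A x * c) (at_right 0)"
        by (rule tendsto_mult_right)
      then show "((\<lambda>r. (LINT y:ball x r|\<pi>. indicator A y *\<^sub>R c) / measure \<pi> (ball x r)) \<longlongrightarrow> indicator A x *\<^sub>R c) (at_right 0)"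
        by (simp add: set_integral_mult_left)
    qed
  qed
next
  case (add f g)
  show ?case using add.IH
  proof eventually_elim
    case (elim x)
    have si: "set_integrable \<pi> (ball x r) h" if "integrable \<pi> h" for h :: "'a \<Rightarrow> real" and r
      using that sets unfolding set_integrable_def by (intro integrable_mult_indicator) auto
    show ?case
    proof
      assume "\<forall>r>0. measure \<pi> (ball x r) > 0"
      with elim have "((\<lambda>r. (LINT y:ball x r|\<pi>. f y) / measure \<pi> (ball x r) + (LINT y:ball x r|\<pi>. g y) / measure \<pi> (ball x r))
          \<longlongrightarrow> f x + g x) (at_right 0)" by (intro tendsto_add) auto
      then show "((\<lambda>r. (LINT y:ball x r|\<pi>. f y + g y) / measure \<pi> (ball x r)) \<longlongrightarrow> f x + g x) (at_right 0)"
        using si add.hyps by (simp add: set_integral_add add_divide_distrib)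
    qed
  qed
next
  case (lim f s)
  have "AE x in \<pi>. x \<in> UNIV \<longrightarrow> has_ball_density_limit \<pi> f x"
  proof (rule ball_density_limit_approx[OF fin sets])
    show "integrable \<pi> f" by fact
    fix e :: real assume e: "e > 0"
    have "(\<lambda>i. LINT x|\<pi>. \<bar>f x - s i x\<bar>) \<longlonglongrightarrow> (LINT x|\<pi>. 0)"
    \<comment> \<open>The induction rule supplies
      \<open>\<bar>s i x\<bar> \<le> 2 * \<bar>f x\<bar>\<close>, hence the factor 3.\<close>
    proof (rule integral_dominated_convergence[where w="\<lambda>x. 3 * \<bar>f x\<bar>"])
      show "AE x in \<pi>. (\<lambda>i. \<bar>f x - s i x\<bar>) \<longlonglongrightarrow> 0"
      proof (rule AE_I2)
        fix x assume "x \<in> space \<pi>"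
        then have "(\<lambda>i. \<bar>f x - s i x\<bar>) \<longlonglongrightarrow> \<bar>f x - f x\<bar>" using lim by (intro tendsto_intros)
        then show "(\<lambda>i. \<bar>f x - s i x\<bar>) \<longlonglongrightarrow> 0" by simp
      qed
      show "AE x in \<pi>. norm \<bar>f x - s i x\<bar> \<le> 3 * \<bar>f x\<bar>" for i
      proof (rule AE_I2)
        fix x assume "x \<in> space \<pi>"
        then have "norm (s i x) \<le> 2 * norm (f x)" using lim by blast
        then show "norm \<bar>f x - s i x\<bar> \<le> 3 * \<bar>f x\<bar>" by simp
      qed
    qed (use lim in \<open>auto intro!: borel_measurable_integrable\<close>)
    then have "eventually (\<lambda>i. (LINT x|\<pi>. \<bar>f x - s i x\<bar>) < e) sequentially"
      using order_tendstoD(2) e by fastforce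
    then obtain i where "(LINT x|\<pi>. \<bar>f x - s i x\<bar>) < e" using eventually_happens by force
    then show "\<exists>g. integrable \<pi> g \<and> (AE x in \<pi>. x \<in> UNIV \<longrightarrow> has_ball_density_limit \<pi> g x) \<and> (LINT x|\<pi>. \<bar>f x - g x\<bar>) \<le> e"
      using lim by (intro exI[of _ "s i"]) auto
  qed
  then show ?case by simp
qed

section \<open>Smooth functions and weak gradients\<close>

text \<open>\<open>smooth_fun\<close> asks for a set of functions closed under partial derivatives;
  the algebra over suitable generators is meant to be that set.\<close>

inductive_set fun_alg :: "('a \<Rightarrow> real) set \<Rightarrow> ('a \<Rightarrow> real) set" for B where
  base: "f \<in> B \<Longrightarrow> f \<in> fun_alg B"
| const: "(\<lambda>x. c) \<in> fun_alg B"
| add: "f \<in> fun_alg B \<Longrightarrow> g \<in> fun_alg B \<Longrightarrow> (\<lambda>x. f x + g x) \<in> fun_alg B"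
| mult: "f \<in> fun_alg B \<Longrightarrow> g \<in> fun_alg B \<Longrightarrow> (\<lambda>x. f x * g x) \<in> fun_alg B"

lemma fun_alg_prod: "finite I \<Longrightarrow> (\<And>i. i \<in> I \<Longrightarrow> f i \<in> fun_alg B) \<Longrightarrow> (\<lambda>x. \<Prod>i\<in>I. f i x) \<in> fun_alg B"
  by (induction I rule: finite_induct) (auto intro: fun_alg.intros)

definition has_partials :: "(real^'d \<Rightarrow> real) \<Rightarrow> ('d \<Rightarrow> real^'d \<Rightarrow> real) \<Rightarrow> bool" where
  "has_partials f D \<longleftrightarrow> (\<forall>x. (f has_derivative (\<lambda>h. \<Sum>i\<in>UNIV. h $ i * D i x)) (at x))"

text \<open>The sum and product rules carry closure under partial derivatives from the generators to
  the whole algebra, which is then the witness in \<open>smooth_fun\<close>.\<close>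

lemma smooth_fun_algebra:
  assumes B: "\<And>g. g \<in> B \<Longrightarrow> \<exists>D. has_partials g D \<and> (\<forall>i. D i \<in> fun_alg B)" and f: "f \<in> fun_alg B"
  shows "smooth_fun f"
proof -
  have "\<exists>D. has_partials g D \<and> (\<forall>i. D i \<in> fun_alg B)" if "g \<in> fun_alg B" for g
    using that
  proof induction
    case (base f) then show ?case by (rule B)
  next
    case (const c)
    have "has_partials (\<lambda>x. c) (\<lambda>i x. 0)" unfolding has_partials_def by simp
    then show ?case by (intro exI[of _ "\<lambda>i x. 0"]) (auto intro: fun_alg.const)
  next
    case (add f g)
    then obtain D E where D: "has_partials f D" "\<And>i. D i \<in> fun_alg B" and E: "has_partials g E" "\<And>i. E i \<in> fun_alg B" by blast
    have "has_partials (\<lambda>x. f x + g x) (\<lambda>i x. D i x + E i x)" unfolding has_partials_def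
    proof
      fix x
      have "((\<lambda>x. f x + g x) has_derivative (\<lambda>h. (\<Sum>i\<in>UNIV. h $ i * D i x) + (\<Sum>i\<in>UNIV. h $ i * E i x))) (at x)"
        using D(1) E(1) unfolding has_partials_def by (intro has_derivative_add) auto
      then show "((\<lambda>x. f x + g x) has_derivative (\<lambda>h. \<Sum>i\<in>UNIV. h $ i * (D i x + E i x))) (at x)"
        by (simp add: sum.distrib distrib_left)
    qed
    then show ?case using D(2) E(2) by (intro exI[of _ "\<lambda>i x. D i x + E i x"]) (auto intro: fun_alg.intros)
  next
    case (mult f g)
    then obtain D E where D: "has_partials f D" "\<And>i. D i \<in> fun_alg B" and E: "has_partials g E" "\<And>i. E i \<in> fun_alg B" by blast
    have "has_partials (\<lambda>x. f x * g x) (\<lambda>i x. f x * E i x + D i x * g x)" unfolding has_partials_def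
    proof
      fix x
      have "((\<lambda>x. f x * g x) has_derivative (\<lambda>h. f x * (\<Sum>i\<in>UNIV. h $ i * E i x) + (\<Sum>i\<in>UNIV. h $ i * D i x) * g x)) (at x)"
        using D(1) E(1) unfolding has_partials_def by (intro has_derivative_mult) auto
      then show "((\<lambda>x. f x * g x) has_derivative (\<lambda>h. \<Sum>i\<in>UNIV. h $ i * (f x * E i x + D i x * g x))) (at x)"
        by (simp add: sum.distrib distrib_left sum_distrib_left sum_distrib_right mult_ac)
    qed
    moreover have "(\<lambda>x. f x * E i x + D i x * g x) \<in> fun_alg B" for i
      by (intro fun_alg.add fun_alg.mult D(2) E(2) mult.hyps)
    ultimately show ?case by (intro exI[of _ "\<lambda>i x. f x * E i x + D i x * g x"]) blast
  qed
  with f show ?thesis unfolding smooth_fun_def has_partials_def by (intro exI[of _ "fun_alg B"]) blast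
qed

lemma smooth_fun_mult:
  assumes "smooth_fun f" "smooth_fun g"
  shows "smooth_fun (\<lambda>x. f x * g x)"
proof -
  obtain S where S: "f \<in> S" "\<And>g. g \<in> S \<Longrightarrow> \<exists>D. has_partials g D \<and> (\<forall>i. D i \<in> S)"
    using assms(1) unfolding smooth_fun_def has_partials_def by blast
  obtain T where T: "g \<in> T" "\<And>g. g \<in> T \<Longrightarrow> \<exists>D. has_partials g D \<and> (\<forall>i. D i \<in> T)"
    using assms(2) unfolding smooth_fun_def has_partials_def by blast
  show ?thesis
  proof (rule smooth_fun_algebra)
    fix h assume "h \<in> S \<union> T"
    then have "\<exists>D. has_partials h D \<and> (\<forall>i. D i \<in> S \<union> T)" using S(2) T(2) by blast
    then show "\<exists>D. has_partials h D \<and> (\<forall>i. D i \<in> fun_alg (S \<union> T))" using fun_alg.base by blast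
  next
    show "(\<lambda>x. f x * g x) \<in> fun_alg (S \<union> T)"
      using S(1) T(1) by (intro fun_alg.mult fun_alg.base) auto
  qed
qed

lemma smooth_fun_translate:
  assumes "smooth_fun f"
  shows "smooth_fun (\<lambda>x. f (x - c))"
proof -
  obtain S where S: "f \<in> S" "\<And>g. g \<in> S \<Longrightarrow> \<exists>D. has_partials g D \<and> (\<forall>i. D i \<in> S)"
    using assms(1) unfolding smooth_fun_def has_partials_def by blast
  define T where "T = (\<lambda>g x. g (x - c)) ` S"
  have "\<exists>D. has_partials h D \<and> (\<forall>i. D i \<in> T)" if "h \<in> T" for h
  proof -
    from that obtain g where g: "g \<in> S" "h = (\<lambda>x. g (x - c))" unfolding T_def by blast
    then obtain D where D: "has_partials g D" "\<And>i. D i \<in> S" using S(2) by blast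
    have "has_partials h (\<lambda>i x. D i (x - c))" unfolding has_partials_def
    proof
      fix x
      have "((\<lambda>x. x - c) has_derivative (\<lambda>h. h)) (at x)" by (auto intro!: derivative_eq_intros)
      moreover have "(g has_derivative (\<lambda>h. \<Sum>i\<in>UNIV. h $ i * D i (x - c))) (at (x - c))"
        using D(1) has_partials_def by blast
      ultimately show "(h has_derivative (\<lambda>h. \<Sum>i\<in>UNIV. h $ i * D i (x - c))) (at x)"
        unfolding g(2) by (rule has_derivative_compose)
    qed
    then show ?thesis using D(2) unfolding T_def by blast
  qed
  moreover have "(\<lambda>x. f (x - c)) \<in> T" using S(1) T_def by blast
  ultimately show ?thesis unfolding smooth_fun_def has_partials_def by (intro exI[of _ T]) blast
qed

text \<open>Each partial derivative belongs to the same closed family, hence is differentiable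
  itself and in particular continuous.\<close>

lemma smooth_fun_gradient:
  assumes "smooth_fun f"
  shows "\<exists>D. (\<forall>x. (f has_derivative (\<lambda>h. inner (D x) h)) (at x)) \<and> continuous_on UNIV D"
proof -
  obtain S where S: "f \<in> S" "\<And>g. g \<in> S \<Longrightarrow> \<exists>D. has_partials g D \<and> (\<forall>i. D i \<in> S)"
    using assms(1) unfolding smooth_fun_def has_partials_def by blast
  then obtain D where D: "has_partials f D" "\<And>i. D i \<in> S" by blast
  have "continuous_on UNIV (D i)" for i
    using S(2)[OF D(2)[of i]] unfolding has_partials_def
    by (meson continuous_at_imp_continuous_on has_derivative_continuous)
  then have "continuous_on UNIV (\<lambda>x. \<chi> i. D i x)" by (intro continuous_on_vec_lambda)
  moreover have "(f has_derivative (\<lambda>h. inner (\<chi> i. D i x) h)) (at x)" for x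
    using D(1) unfolding has_partials_def by (simp add: inner_vec_def mult.commute)
  ultimately show ?thesis by (intro exI[of _ "\<lambda>x. \<chi> i. D i x"]) auto
qed

lemma smooth_fun_continuous: "smooth_fun f \<Longrightarrow> continuous_on UNIV f"
  using smooth_fun_gradient[of f] by (auto intro!: continuous_at_imp_continuous_on dest: has_derivative_continuous)

section \<open>Smooth bump functions on boxes\<close>

text \<open>The powers of \<open>inverse t\<close> make the family closed under differentiation at
  fixed \<open>c\<close>. For \<open>k = 0\<close> and \<open>c\<close> decreasing to 0 it increases
  to the indicator of the positive half-line.\<close>

definition flat_exp :: "real \<Rightarrow> nat \<Rightarrow> real \<Rightarrow> real" where
  "flat_exp c k t = (if t > 0 then inverse t ^ k * exp (- c / t) else 0)"

lemma flat_exp_tendsto_0: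
  assumes "c > 0" shows "(flat_exp c k \<longlongrightarrow> 0) (at 0)"
proof -
  have "((\<lambda>t. inverse t ^ k * exp (- c / t)) \<longlongrightarrow> 0) (at_right 0)" using assms by real_asymp
  then have "(flat_exp c k \<longlongrightarrow> 0) (at_right 0)"
    by (rule Lim_transform_eventually) (auto simp: flat_exp_def eventually_at_filter)
  moreover have "(flat_exp c k \<longlongrightarrow> 0) (at_left 0)"
    by (rule tendsto_eventually) (auto simp: flat_exp_def eventually_at_filter)
  ultimately show ?thesis by (simp add: filterlim_split_at)
qed

lemma flat_exp_deriv:
  assumes c: "c > 0"
  shows "(flat_exp c k has_real_derivative (c * flat_exp c (k + 2) t - real k * flat_exp c (k + 1) t)) (at t)"
proof -
  consider "t > 0" | "t < 0" | "t = 0" by linarith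
  then show ?thesis
  proof cases
    case 1
    have "((\<lambda>t. inverse t ^ k * exp (- c / t)) has_real_derivative (c * flat_exp c (k + 2) t - real k * flat_exp c (k + 1) t)) (at t)"
    proof (cases k)
      case 0
      then show ?thesis using 1 by (auto intro!: derivative_eq_intros simp: flat_exp_def field_simps power2_eq_square)
    next
      case (Suc m)
      have p: "((\<lambda>t. inverse t ^ Suc m) has_real_derivative (1 + real m) * (- (inverse t * inverse t) * inverse t ^ m)) (at t)"
        by (rule DERIV_power_Suc) (use 1 in \<open>auto intro!: derivative_eq_intros\<close>)
      have e: "((\<lambda>t. exp (- c / t)) has_real_derivative (c * (inverse t * inverse t)) * exp (- c / t)) (at t)"
        using 1 by (auto intro!: derivative_eq_intros simp: field_simps)
      show ?thesis
        using DERIV_mult[OF p e] 1 unfolding Suc by (simp add: flat_exp_def algebra_simps)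
    qed
    then show ?thesis
      by (rule has_field_derivative_transform_within_open[of _ _ _ "{0<..}"]) (use 1 in \<open>auto simp: flat_exp_def\<close>)
  next
    case 2
    have "((\<lambda>t. 0) has_real_derivative 0) (at t)" by simp
    then have "(flat_exp c k has_real_derivative 0) (at t)"
      by (rule has_field_derivative_transform_within_open[of _ _ _ "{..<0}"]) (use 2 in \<open>auto simp: flat_exp_def\<close>)
    then show ?thesis using 2 by (simp add: flat_exp_def)
  next
    case 3
    \<comment> \<open>At 0 the difference quotient of order \<open>k\<close> is the member of order
      \<open>k + 1\<close>, which tends to 0.\<close>
    have "((\<lambda>y. flat_exp c k y / y) \<longlongrightarrow> 0) (at 0)"
      by (rule Lim_transform_eventually[OF flat_exp_tendsto_0[OF c, of "Suc k"]])
        (auto simp: flat_exp_def eventually_at_filter field_simps)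
    then show ?thesis using 3 by (simp add: has_field_derivative_iff flat_exp_def)
  qed
qed

lemma flat_exp_range: "c > 0 \<Longrightarrow> 0 \<le> flat_exp c 0 t \<and> flat_exp c 0 t \<le> 1"
  by (simp add: flat_exp_def)

lemma flat_exp_pos_iff: "flat_exp c 0 t \<noteq> 0 \<longleftrightarrow> t > 0" by (simp add: flat_exp_def)

lemma flat_exp_limit: "(\<lambda>n. flat_exp (inverse (real (Suc n))) 0 t) \<longlonglongrightarrow> (if t > 0 then 1 else 0)"
proof (cases "t > 0")
  case True
  have "(\<lambda>n. exp (- inverse (real (Suc n)) / t)) \<longlonglongrightarrow> exp (- 0 / t)"
    by (intro tendsto_intros LIMSEQ_inverse_real_of_nat) (use True in auto)
  then show ?thesis using True by (simp add: flat_exp_def)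
qed (simp add: flat_exp_def)

text \<open>Two factors per coordinate, one for each face. Letting \<open>c\<close> tend to 0 turns
  the bump into the indicator of the open box, which replaces mollification in the fundamental
  lemma.\<close>

definition box_bump :: "real \<Rightarrow> real^'d \<Rightarrow> real^'d \<Rightarrow> real^'d \<Rightarrow> real" where
  "box_bump c a b x = (\<Prod>i\<in>UNIV. flat_exp c 0 (x $ i - a $ i) * flat_exp c 0 (b $ i - x $ i))"

lemma has_partials_coordinate:
  fixes i :: "'d::finite"
  assumes "\<And>t. (f has_real_derivative f' t) (at t)" "\<bar>s\<bar> = 1"
  shows "has_partials (\<lambda>x :: real^'d. f (s * x $ i + b)) (\<lambda>j x. if j = i then s * f' (s * x $ i + b) else 0)"
  unfolding has_partials_def
proof
  fix x :: "real^'d"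
  have l: "((\<lambda>x. s * x $ i + b) has_derivative (\<lambda>h. s * h $ i)) (at x)"
    by (auto intro!: derivative_eq_intros bounded_linear.has_derivative[OF bounded_linear_vec_nth])
  have "(f has_derivative (\<lambda>h. h * f' (s * x $ i + b))) (at (s * x $ i + b))"
    using assms(1)[of "s * x $ i + b"] by (simp add: has_field_derivative_def mult_commute_abs)
  from has_derivative_compose[OF l this]
  have "((\<lambda>x. f (s * x $ i + b)) has_derivative (\<lambda>h. s * h $ i * f' (s * x $ i + b))) (at x)" .
  moreover have "(\<lambda>h. s * h $ i * f' (s * x $ i + b)) = (\<lambda>h. \<Sum>j\<in>UNIV. h $ j * (if j = i then s * f' (s * x $ i + b) else 0))"
    by (rule ext) (simp add: if_distrib cong: if_cong)
  ultimately show "((\<lambda>x. f (s * x $ i + b)) has_derivative (\<lambda>h. \<Sum>j\<in>UNIV. h $ j * (if j = i then s * f' (s * x $ i + b) else 0))) (at x)"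
    by simp
qed

lemma smooth_box_bump:
  assumes c: "c > 0" shows "smooth_fun (box_bump c a b :: real^'d \<Rightarrow> real)"
proof (rule smooth_fun_algebra)
  \<comment> \<open>All orders \<open>k\<close> occur, because differentiation raises the order; the
    sign \<open>s\<close> tells lower faces from upper ones.\<close>
  define B :: "(real^'d \<Rightarrow> real) set" where "B = {(\<lambda>x. flat_exp c k (s * x $ i + t)) | k s i t. \<bar>s\<bar> = 1}"
  show "box_bump c a b \<in> fun_alg B"
  proof -
    have "(\<lambda>x. flat_exp c 0 (x $ i - a $ i)) \<in> fun_alg B" for i
      unfolding B_def by (rule fun_alg.base, rule CollectI, rule exI[of _ 0], rule exI[of _ 1], rule exI[of _ i], rule exI[of _ "- a $ i"]) simp
    moreover have "(\<lambda>x. flat_exp c 0 (b $ i - x $ i)) \<in> fun_alg B" for i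
      unfolding B_def by (rule fun_alg.base, rule CollectI, rule exI[of _ 0], rule exI[of _ "-1"], rule exI[of _ i], rule exI[of _ "b $ i"]) simp
    ultimately show ?thesis unfolding box_bump_def[abs_def] by (intro fun_alg_prod fun_alg.mult) auto
  qed
  fix g assume "g \<in> B"
  then obtain k s i t where g: "g = (\<lambda>x. flat_exp c k (s * x $ i + t))" and s: "\<bar>s\<bar> = 1" unfolding B_def by blast
  have in_B: "(\<lambda>x. flat_exp c m (s * x $ i + t)) \<in> fun_alg B" for m
    using s by (intro fun_alg.base) (auto simp: B_def)
  have "has_partials g (\<lambda>j x. if j = i then s * (c * flat_exp c (k + 2) (s * x $ i + t) - real k * flat_exp c (k + 1) (s * x $ i + t)) else 0)"
    unfolding g by (rule has_partials_coordinate[OF flat_exp_deriv[OF c] s])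
  moreover have "(\<lambda>x. if j = i then s * (c * flat_exp c (k + 2) (s * x $ i + t) - real k * flat_exp c (k + 1) (s * x $ i + t)) else 0) \<in> fun_alg B" for j
  proof (cases "j = i")
    case True
    have "(\<lambda>x. s * (c * flat_exp c (k + 2) (s * x $ i + t) + (- real k) * flat_exp c (k + 1) (s * x $ i + t))) \<in> fun_alg B"
      by (intro fun_alg.mult fun_alg.add fun_alg.const in_B)
    then show ?thesis using True by simp
  qed (auto intro: fun_alg.const)
  ultimately show "\<exists>D. has_partials g D \<and> (\<forall>i. D i \<in> fun_alg B)"
    by (intro exI[of _ "\<lambda>j x. if j = i then s * (c * flat_exp c (k + 2) (s * x $ i + t) - real k * flat_exp c (k + 1) (s * x $ i + t)) else 0"]) blast
qed

lemma box_bump_nonzero_iff: "box_bump c a b x \<noteq> 0 \<longleftrightarrow> x \<in> box a b"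
  by (simp add: box_bump_def flat_exp_pos_iff mem_box_cart)

lemma box_bump_range: "c > 0 \<Longrightarrow> 0 \<le> box_bump c a b x \<and> box_bump c a b x \<le> 1"
  unfolding box_bump_def by (intro conjI prod_nonneg prod_le_1 ballI mult_nonneg_nonneg mult_le_one) (simp_all add: flat_exp_range)

lemma box_bump_limit: "(\<lambda>n. box_bump (inverse (real (Suc n))) a b x) \<longlonglongrightarrow> indicator (box a b) x"
proof -
  have "(\<lambda>n. box_bump (inverse (real (Suc n))) a b x) \<longlonglongrightarrow>
      (\<Prod>i\<in>UNIV. (if x $ i - a $ i > 0 then 1 else 0) * (if b $ i - x $ i > 0 then 1 else 0))"
    unfolding box_bump_def by (intro tendsto_prod tendsto_mult flat_exp_limit)
  also have "(\<Prod>i\<in>UNIV. (if x $ i - a $ i > 0 then 1 else 0) * (if b $ i - x $ i > 0 then 1 else 0)) = (indicator (box a b) x :: real)"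
    by (auto simp: indicator_def mem_box_cart)
  finally show ?thesis .
qed

lemma test_fun_box_bump:
  assumes "c > 0" "cbox a b \<subseteq> A" shows "test_fun A (box_bump c a b)"
proof -
  have "{x. box_bump c a b x \<noteq> 0} = box a b" using box_bump_nonzero_iff by blast
  moreover have "closure (box a b) \<subseteq> cbox a b" by (rule closure_minimal[OF box_subset_cbox closed_cbox])
  ultimately show ?thesis using smooth_box_bump assms unfolding test_fun_def by (auto simp: compact_closure)
qed

lemma test_fun_mult:
  assumes "smooth_fun \<theta>" "test_fun A \<phi>" shows "test_fun A (\<lambda>x. \<theta> x * \<phi> x)"
proof -
  have sub: "closure {x. \<theta> x * \<phi> x \<noteq> 0} \<subseteq> closure {x. \<phi> x \<noteq> 0}" by (rule closure_mono) auto
  moreover from this have "compact (closure {x. \<theta> x * \<phi> x \<noteq> 0})"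
    using assms(2) compact_Int_closed[OF _ closed_closure, of "closure {x. \<phi> x \<noteq> 0}" "{x. \<theta> x * \<phi> x \<noteq> 0}"]
    unfolding test_fun_def by (simp add: inf.absorb2)
  ultimately show ?thesis using assms smooth_fun_mult unfolding test_fun_def by blast
qed

lemma test_fun_translate:
  assumes "test_fun A \<phi>" "(\<lambda>x. x + c) ` A \<subseteq> B" shows "test_fun B (\<lambda>x. \<phi> (x - c))"
proof -
  have "{x. \<phi> (x - c) \<noteq> 0} = (\<lambda>x. c + x) ` {x. \<phi> x \<noteq> 0}"
    by (force intro: image_eqI[of _ _ "_ - c"])
  then have cl: "closure {x. \<phi> (x - c) \<noteq> 0} = (\<lambda>x. c + x) ` closure {x. \<phi> x \<noteq> 0}" by (simp only: closure_translation)
  have "compact (closure {x. \<phi> (x - c) \<noteq> 0})"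
    unfolding cl using assms(1) unfolding test_fun_def by (intro compact_translation) blast
  moreover have "closure {x. \<phi> (x - c) \<noteq> 0} \<subseteq> B"
    unfolding cl using assms unfolding test_fun_def by (force simp: add.commute)
  ultimately show ?thesis using assms(1) smooth_fun_translate unfolding test_fun_def by blast
qed

lemma test_fun_bounded:
  assumes "test_fun A \<phi>" shows "\<exists>M. \<forall>x. \<bar>\<phi> x\<bar> \<le> M"
proof -
  have "compact (\<phi> ` closure {x. \<phi> x \<noteq> 0})"
    using assms smooth_fun_continuous unfolding test_fun_def by (intro compact_continuous_image) (auto intro: continuous_on_subset)
  then obtain M where M: "\<And>x. x \<in> closure {x. \<phi> x \<noteq> 0} \<Longrightarrow> \<bar>\<phi> x\<bar> \<le> M"
    by (fastforce dest!: compact_imp_bounded simp: bounded_iff)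
  have "\<bar>\<phi> x\<bar> \<le> max M 0" for x
    using M[of x] closure_subset[of "{x. \<phi> x \<noteq> 0}"] by (cases "\<phi> x = 0") auto
  then show ?thesis by blast
qed

lemma test_fun_gradient:
  assumes "test_fun A \<phi>"
  shows "\<exists>D. (\<forall>x. (\<phi> has_derivative (\<lambda>h. inner (D x) h)) (at x)) \<and> continuous_on UNIV D \<and>
     (\<forall>x. x \<notin> closure {x. \<phi> x \<noteq> 0} \<longrightarrow> D x = 0) \<and> (\<exists>M. \<forall>x. norm (D x) \<le> M)"
proof -
  let ?K = "closure {x. \<phi> x \<noteq> 0}"
  obtain D where D: "\<And>x. (\<phi> has_derivative (\<lambda>h. inner (D x) h)) (at x)" "continuous_on UNIV D"
    using assms smooth_fun_gradient unfolding test_fun_def by blast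
  have z: "D x = 0" if "x \<notin> ?K" for x
  proof -
    have "((\<lambda>x. 0) has_derivative (\<lambda>h. inner (D x) h)) (at x)"
      by (rule has_derivative_transform_within_open[OF D(1)[of x], of "- ?K"])
        (use that closure_subset[of "{x. \<phi> x \<noteq> 0}"] in auto)
    then have "(\<lambda>h. inner (D x) h) = (\<lambda>h. 0)" using has_derivative_unique[OF _ has_derivative_const] by blast
    from fun_cong[OF this, of "D x"] show ?thesis by simp
  qed
  have "compact (D ` ?K)"
    using assms D(2) unfolding test_fun_def by (intro compact_continuous_image) (auto intro: continuous_on_subset)
  then obtain M where M: "\<And>x. x \<in> ?K \<Longrightarrow> norm (D x) \<le> M"
    by (fastforce dest!: compact_imp_bounded simp: bounded_iff)
  have "norm (D x) \<le> max M 0" for x using M[of x] z[of x] by (cases "x \<in> ?K") auto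
  then show ?thesis using D z by blast
qed

section \<open>Borel representatives, the fundamental lemma and the product rule\<close>

lemma integrable_mult_bounded:
  fixes f \<psi> :: "'a \<Rightarrow> real"
  assumes "integrable N f" "\<psi> \<in> borel_measurable N" "\<And>x. \<bar>\<psi> x\<bar> \<le> M"
  shows "integrable N (\<lambda>x. f x * \<psi> x)"
proof (rule Bochner_Integration.integrable_bound[where f="\<lambda>x. M * f x"])
  show "AE x in N. norm (f x * \<psi> x) \<le> norm (M * f x)"
  proof (rule AE_I2)
    fix x
    have "\<bar>\<psi> x\<bar> \<le> \<bar>M\<bar>" using assms(3)[of x] by linarith
    then show "norm (f x * \<psi> x) \<le> norm (M * f x)" by (simp add: abs_mult mult.commute mult_right_mono)
  qed
qed (use assms in auto)

lemma AE_lebesgue_on_iff: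
  "\<Omega> \<in> sets borel \<Longrightarrow> (AE x in lebesgue_on \<Omega>. P x) \<longleftrightarrow> (AE x in lborel. x \<in> \<Omega> \<longrightarrow> P x)"
  by (subst AE_restrict_space_iff) (simp_all add: AE_completion_iff)

text \<open>Weak gradients are defined with a completed measure, whereas Fubini and translations are
  used for \<open>lborel\<close>. Functions that vanish outside the domain pass between the
  two.\<close>

lemma lebesgue_on_eq_lborel:
  fixes f :: "'a::euclidean_space \<Rightarrow> real"
  assumes f: "f \<in> borel_measurable borel" and \<Omega>: "\<Omega> \<in> sets borel" and z: "\<And>x. x \<notin> \<Omega> \<Longrightarrow> f x = 0"
  shows "integrable (lebesgue_on \<Omega>) f \<longleftrightarrow> integrable lborel f"
    and "(LINT x|lebesgue_on \<Omega>. f x) = (LINT x|lborel. f x)"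
proof -
  have e: "(\<lambda>x. indicator \<Omega> x * f x) = f" using z by (auto simp: indicator_def fun_eq_iff)
  show "integrable (lebesgue_on \<Omega>) f \<longleftrightarrow> integrable lborel f"
    using f \<Omega> by (simp add: integrable_restrict_space e integrable_completion)
  show "(LINT x|lebesgue_on \<Omega>. f x) = (LINT x|lborel. f x)"
    using f \<Omega> by (simp add: integral_restrict_space e integral_completion)
qed

lemma borel_version:
  fixes f :: "'a::euclidean_space \<Rightarrow> real"
  assumes f: "f \<in> borel_measurable (lebesgue_on \<Omega>)" and \<Omega>: "\<Omega> \<in> sets borel"
  shows "\<exists>g \<in> borel_measurable borel. (\<forall>x. x \<notin> \<Omega> \<longrightarrow> g x = 0) \<and> (AE x in lebesgue_on \<Omega>. f x = g x)"
proof -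
  have "(\<lambda>x. if x \<in> \<Omega> then f x else 0) \<in> borel_measurable lebesgue"
    using borel_measurable_if_I[OF f] \<Omega> by simp
  from completion_ex_borel_measurable_real[OF this]
  obtain h where h: "h \<in> borel_measurable lborel" "AE x in lborel. (if x \<in> \<Omega> then f x else 0) = h x" by blast
  define g where "g x = indicator \<Omega> x * h x" for x
  have "g \<in> borel_measurable borel" using h(1) \<Omega> unfolding g_def by simp
  moreover have "AE x in lebesgue_on \<Omega>. f x = g x"
    unfolding AE_lebesgue_on_iff[OF \<Omega>] using h(2) by eventually_elim (auto simp: g_def)
  ultimately show ?thesis by (intro bexI[of _ g]) (auto simp: g_def)
qed

text \<open>Dynkin's argument: open boxes form an intersection-stable generator of the Borel sets,
  and a function whose integral vanishes over every Borel set is zero almost everywhere.\<close>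

lemma AE_zero_if_box_integrals_zero:
  fixes f :: "'a::euclidean_space \<Rightarrow> real"
  assumes f: "integrable lborel f" and z: "\<And>x. x \<notin> box a b \<Longrightarrow> f x = 0"
    and box: "\<And>c d. (LINT x:box c d|lborel. f x) = 0"
  shows "AE x in lborel. f x = 0"
proof (rule sigma_finite_measure.density_zero[OF lborel.sigma_finite_measure_axioms f])
  fix A :: "'a set" assume "A \<in> sets lborel"
  then have "A \<in> sigma_sets UNIV (range (\<lambda>(a, b). box a b))" by (simp add: borel_eq_box)
  moreover have stable: "Int_stable (range (\<lambda>(a, b). box a b::'a set))" by (auto simp: Int_stable_def box_Int_box)
  have si: "set_integrable lborel B f" if "B \<in> sets borel" for B
    using f that unfolding set_integrable_def by (intro integrable_mult_indicator) auto
  \<comment> \<open>Complements require the integral over the whole space; as \<open>f\<close> lives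
    in one box, it is a box integral too.\<close>
  have tot: "(LINT x|lborel. f x) = 0"
  proof -
    have "(LINT x|lborel. f x) = (LINT x:box a b|lborel. f x)" unfolding set_lebesgue_integral_def
      using z by (intro Bochner_Integration.integral_cong) (auto simp: indicator_def)
    then show ?thesis using box by simp
  qed
  have sb: "X \<in> sets borel" if "X \<in> sigma_sets UNIV (range (\<lambda>(a, b). box a b::'a set))" for X
    using that by (simp add: borel_eq_box)
  show "set_lebesgue_integral lborel A f = 0"
    using stable _ calculation
  proof (rule sigma_sets_induct_disjoint)
    show "set_lebesgue_integral lborel B f = 0" if "B \<in> range (\<lambda>(a, b). box a b)" for B
      using that box by auto
    show "set_lebesgue_integral lborel (UNIV - B) f = 0"
      if "B \<in> sigma_sets UNIV (range (\<lambda>(a, b). box a b))" "set_lebesgue_integral lborel B f = 0" for B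
    proof -
      have B: "B \<in> sets borel" using sb that(1) by blast
      have "set_lebesgue_integral lborel (B \<union> (UNIV - B)) f = set_lebesgue_integral lborel B f + set_lebesgue_integral lborel (UNIV - B) f"
        by (rule set_integral_Un) (use B in \<open>auto intro!: si\<close>)
      then show ?thesis using that(2) tot by (simp add: set_lebesgue_integral_def)
    qed
    show "set_lebesgue_integral lborel (\<Union>i. B i) f = 0"
      if "disjoint_family B" "range B \<subseteq> sigma_sets UNIV (range (\<lambda>(a, b). box a b))"
        "\<And>i. set_lebesgue_integral lborel (B i) f = 0" for B :: "nat \<Rightarrow> 'a set"
    proof -
      have B: "B i \<in> sets borel" for i using sb that(2) by blast
      have "set_lebesgue_integral lborel (\<Union>i. B i) f = (\<Sum>i. set_lebesgue_integral lborel (B i) f)"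
        by (rule lebesgue_integral_countable_add)
          (use B that(1) in \<open>auto intro!: si simp: disjoint_family_on_def\<close>)
      then show ?thesis using that(3) by simp
    qed
  qed (auto simp: set_lebesgue_integral_def)
qed

lemma test_fun_continuous: "test_fun A \<phi> \<Longrightarrow> continuous_on UNIV \<phi>"
  using smooth_fun_continuous unfolding test_fun_def by blast

lemma test_fun_borel [measurable_dest]: "test_fun A \<phi> \<Longrightarrow> \<phi> \<in> borel_measurable borel"
  using test_fun_continuous borel_measurable_continuous_onI by blast

text \<open>A bump on a box inside the domain turns \<open>g\<close> into an integrable function.
  Multiplying by further bumps that tend to the indicator of an arbitrary box shows that all its box
  integrals vanish; countably many boxes exhaust the domain.\<close>

lemma fundamental_lemma_borel:
  fixes g :: "real^'d \<Rightarrow> real"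
  assumes op: "open \<Omega>" and g: "g \<in> borel_measurable borel"
    and test: "\<And>\<phi>. test_fun \<Omega> \<phi> \<Longrightarrow> integrable lborel (\<lambda>x. g x * \<phi> x) \<and> (LINT x|lborel. g x * \<phi> x) = 0"
  shows "AE x in lborel. x \<in> \<Omega> \<longrightarrow> g x = 0"
proof -
  have box: "AE x in lborel. x \<in> box a b \<longrightarrow> g x = 0" if ab: "cbox a b \<subseteq> \<Omega>" for a b
  proof -
    define \<phi> where "\<phi> = box_bump 1 a b"
    have \<phi>: "test_fun \<Omega> \<phi>" unfolding \<phi>_def by (rule test_fun_box_bump[OF _ ab]) simp
    define f where "f x = g x * \<phi> x" for x
    have f: "integrable lborel f" unfolding f_def using test[OF \<phi>] by simp
    have "AE x in lborel. f x = 0"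
    proof (rule AE_zero_if_box_integrals_zero[OF f])
      show "f x = 0" if "x \<notin> box a b" for x using that box_bump_nonzero_iff unfolding f_def \<phi>_def by fastforce
      fix c d :: "real^'d"
      define \<psi> where "\<psi> n = box_bump (inverse (real (Suc n))) c d" for n
      have "(\<lambda>n. LINT x|lborel. f x * \<psi> n x) \<longlonglongrightarrow> (LINT x|lborel. f x * indicator (box c d) x)"
      proof (rule integral_dominated_convergence[where w="\<lambda>x. norm (f x)"])
        show "(\<lambda>x. f x * \<psi> n x) \<in> borel_measurable lborel" for n
          unfolding \<psi>_def
          by (intro borel_measurable_times borel_measurable_integrable[OF f])
            (simp add: borel_measurable_continuous_onI smooth_fun_continuous smooth_box_bump)
        show "AE x in lborel. (\<lambda>n. f x * \<psi> n x) \<longlonglongrightarrow> f x * indicator (box c d) x"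
          unfolding \<psi>_def by (intro AE_I2 tendsto_mult tendsto_const box_bump_limit)
        show "AE x in lborel. norm (f x * \<psi> n x) \<le> norm (f x)" for n
        proof (rule AE_I2)
          fix x
          have "\<bar>\<psi> n x\<bar> \<le> 1" using box_bump_range[of "inverse (real (Suc n))" c d x] unfolding \<psi>_def by simp
          then show "norm (f x * \<psi> n x) \<le> norm (f x)" by (simp add: abs_mult mult_left_le)
        qed
      qed (use f in auto)
      moreover have "(LINT x|lborel. f x * \<psi> n x) = 0" for n
      proof -
        have "test_fun \<Omega> (\<lambda>x. \<psi> n x * \<phi> x)"
          unfolding \<psi>_def by (rule test_fun_mult[OF smooth_box_bump \<phi>]) simp
        from test[OF this] show ?thesis by (simp add: f_def mult_ac)
      qed
      ultimately have "(LINT x|lborel. f x * indicator (box c d) x) = 0" by (simp add: LIMSEQ_const_iff)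
      then show "(LINT x:box c d|lborel. f x) = 0" by (simp add: set_lebesgue_integral_def mult.commute)
    qed
    then show ?thesis
      by eventually_elim (use box_bump_nonzero_iff in \<open>force simp: f_def \<phi>_def\<close>)
  qed
  obtain D where D: "countable D" "D \<subseteq> Pow \<Omega>" "\<And>X. X \<in> D \<Longrightarrow> \<exists>a b. X = cbox a b" "\<Union>D = \<Omega>"
    using open_countable_Union_open_cbox[OF op] by metis
  have "AE x in lborel. x \<in> X \<longrightarrow> g x = 0" if XD: "X \<in> D" for X
  proof -
    obtain a b where X: "X = cbox a b" using D(3)[OF XD] by auto
    \<comment> \<open>The exhausting boxes are closed while the bumps vanish on the faces; the faces
      form a null set.\<close>
    have "AE x in lborel. x \<notin> cbox a b - box a b"
      using negligible_frontier_interval[of a b] unfolding negligible_iff_null_sets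
      by (metis AE_completion_iff AE_not_in)
    moreover have "AE x in lborel. x \<in> box a b \<longrightarrow> g x = 0" by (rule box) (use D(2) that X in blast)
    ultimately show ?thesis unfolding X by eventually_elim blast
  qed
  then have "AE x in lborel. \<forall>X\<in>D. x \<in> X \<longrightarrow> g x = 0" 
    unfolding AE_ball_countable[OF D(1)] by blast
  then show ?thesis by eventually_elim (use D(4) in blast)
qed

lemma fundamental_lemma:
  fixes g :: "real^'d \<Rightarrow> real"
  assumes op: "open \<Omega>" and g: "g \<in> borel_measurable (lebesgue_on \<Omega>)"
    and test: "\<And>\<phi>. test_fun \<Omega> \<phi> \<Longrightarrow> integrable (lebesgue_on \<Omega>) (\<lambda>x. g x * \<phi> x) \<and> (LINT x|lebesgue_on \<Omega>. g x * \<phi> x) = 0"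
  shows "AE x in lebesgue_on \<Omega>. g x = 0"
proof -
  have \<Omega>: "\<Omega> \<in> sets borel" using op by simp
  obtain h where h: "h \<in> borel_measurable borel" "\<And>x. x \<notin> \<Omega> \<Longrightarrow> h x = 0" "AE x in lebesgue_on \<Omega>. g x = h x"
    using borel_version[OF g \<Omega>] by blast
  have "AE x in lborel. x \<in> \<Omega> \<longrightarrow> h x = 0"
  proof (rule fundamental_lemma_borel[OF op h(1)])
    fix \<phi> assume \<phi>: "test_fun \<Omega> \<phi>"
    have m: "(\<lambda>x. h x * \<phi> x) \<in> borel_measurable borel" using h(1) test_fun_borel[OF \<phi>] by simp
    have ae: "AE x in lebesgue_on \<Omega>. g x * \<phi> x = h x * \<phi> x" using h(3) by eventually_elim simp
    have ml: "(\<lambda>x. h x * \<phi> x) \<in> borel_measurable (lebesgue_on \<Omega>)"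
      using m by (simp add: measurable_restrict_space1 measurable_completion)
    have mg: "(\<lambda>x. g x * \<phi> x) \<in> borel_measurable (lebesgue_on \<Omega>)"
      using test[OF \<phi>] borel_measurable_integrable by blast
    have "integrable (lebesgue_on \<Omega>) (\<lambda>x. h x * \<phi> x)" "(LINT x|lebesgue_on \<Omega>. h x * \<phi> x) = 0"
      using test[OF \<phi>] integrable_cong_AE[OF mg ml ae] integral_cong_AE[OF mg ml ae] by simp_all
    then show "integrable lborel (\<lambda>x. h x * \<phi> x) \<and> (LINT x|lborel. h x * \<phi> x) = 0"
      using lebesgue_on_eq_lborel[OF m \<Omega>] h(2) by simp
  qed
  with h(3) show ?thesis unfolding AE_lebesgue_on_iff[OF \<Omega>] by (auto elim: eventually_elim2)
qed

lemma weak_gradD: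
  assumes "weak_grad \<Omega> v G" "test_fun \<Omega> \<phi>" "\<And>x. (\<phi> has_derivative (\<lambda>h. inner (D\<phi> x) h)) (at x)"
  shows "integrable (lebesgue_on \<Omega>) (\<lambda>x. v x $ i * D\<phi> x $ j)"
    and "integrable (lebesgue_on \<Omega>) (\<lambda>x. G x $ i $ j * \<phi> x)"
    and "(LINT x|lebesgue_on \<Omega>. v x $ i * D\<phi> x $ j) = - (LINT x|lebesgue_on \<Omega>. G x $ i $ j * \<phi> x)"
  using assms(1)[unfolded weak_grad_def, THEN conjunct2, THEN conjunct2, rule_format, of \<phi> D\<phi> i j] assms(2,3) by simp_all

text \<open>\<open>wgrad\<close> is an arbitrary choice among the weak gradients; uniqueness makes
  integrals over the domain independent of that choice.\<close>

lemma weak_grad_unique: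
  fixes G G' :: "real^'d \<Rightarrow> real^'d^'m"
  assumes op: "open \<Omega>" and G: "weak_grad \<Omega> v G" and G': "weak_grad \<Omega> v G'"
  shows "AE x in lebesgue_on \<Omega>. G x = G' x"
proof -
  have "AE x in lebesgue_on \<Omega>. G x $ i $ j - G' x $ i $ j = 0" for i j
  proof (rule fundamental_lemma[OF op])
    have c: "continuous_on UNIV (\<lambda>A::real^'d^'m. A $ i $ j)" by (intro continuous_intros)
    have "(\<lambda>x. H x $ i $ j) \<in> borel_measurable (lebesgue_on \<Omega>)" if "H \<in> borel_measurable (lebesgue_on \<Omega>)"
      for H :: "real^'d \<Rightarrow> real^'d^'m"
      using borel_measurable_continuous_on[OF c that] .
    then show "(\<lambda>x. G x $ i $ j - G' x $ i $ j) \<in> borel_measurable (lebesgue_on \<Omega>)"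
      using G G' unfolding weak_grad_def by (intro borel_measurable_diff) blast+
    fix \<phi> assume \<phi>: "test_fun \<Omega> \<phi>"
    obtain D where D: "\<And>x. (\<phi> has_derivative (\<lambda>h. inner (D x) h)) (at x)" using test_fun_gradient[OF \<phi>] by blast
    have "integrable (lebesgue_on \<Omega>) (\<lambda>x. G x $ i $ j * \<phi> x)" "integrable (lebesgue_on \<Omega>) (\<lambda>x. G' x $ i $ j * \<phi> x)"
      "(LINT x|lebesgue_on \<Omega>. G x $ i $ j * \<phi> x) = (LINT x|lebesgue_on \<Omega>. G' x $ i $ j * \<phi> x)"
      using weak_gradD[OF G \<phi> D, of i j] weak_gradD[OF G' \<phi> D, of i j] by simp_all
    then show "integrable (lebesgue_on \<Omega>) (\<lambda>x. (G x $ i $ j - G' x $ i $ j) * \<phi> x) \<and>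
        (LINT x|lebesgue_on \<Omega>. (G x $ i $ j - G' x $ i $ j) * \<phi> x) = 0"
      by (simp add: left_diff_distrib)
  qed
  then have "AE x in lebesgue_on \<Omega>. \<forall>i j. G x $ i $ j - G' x $ i $ j = 0"
    by (intro eventually_all_finite)
  then show ?thesis by eventually_elim (simp add: vec_eq_iff)
qed

lemma weak_grad_wgrad: "weak_grad \<Omega> v G \<Longrightarrow> weak_grad \<Omega> v (wgrad \<Omega> v)"
  unfolding wgrad_def by (rule someI[of "weak_grad \<Omega> v"])

lemma wgrad_AE_eq: "open \<Omega> \<Longrightarrow> weak_grad \<Omega> v G \<Longrightarrow> AE x in lebesgue_on \<Omega>. wgrad \<Omega> v x = G x"
  by (rule weak_grad_unique[OF _ weak_grad_wgrad])

text \<open>The product rule, obtained by testing the weak gradient of \<open>v\<close> with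
  \<open>\<theta> * \<phi>\<close>, which is again a test function.\<close>

lemma weak_grad_cutoff:
  fixes v :: "real^'d \<Rightarrow> real^'m" and G :: "real^'d \<Rightarrow> real^'d^'m"
  assumes op: "open \<Omega>" and G: "weak_grad \<Omega> v G" and \<theta>: "smooth_fun \<theta>" "\<And>x. \<bar>\<theta> x\<bar> \<le> M"
    and D: "\<And>x. (\<theta> has_derivative (\<lambda>h. inner (D x) h)) (at x)" "continuous_on UNIV D"
  shows "weak_grad \<Omega> (\<lambda>x. \<theta> x *\<^sub>R v x) (\<lambda>x. \<theta> x *\<^sub>R G x + (\<chi> i. v x $ i *\<^sub>R D x))"
proof -
  let ?M = "lebesgue_on \<Omega>"
  have vm: "v \<in> borel_measurable ?M" and Gm: "G \<in> borel_measurable ?M" using G unfolding weak_grad_def by auto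
  have lb: "f \<in> borel_measurable ?M" if "continuous_on UNIV f" for f :: "real^'d \<Rightarrow> 'b::topological_space"
    using borel_measurable_continuous_onI[OF that] by (simp add: measurable_restrict_space1 measurable_completion)
  have \<theta>m: "\<theta> \<in> borel_measurable ?M" by (rule lb[OF smooth_fun_continuous[OF \<theta>(1)]])
  have Dm: "D \<in> borel_measurable ?M" by (rule lb[OF D(2)])
  have tensor: "(\<lambda>x. \<chi> i. v x $ i *\<^sub>R D x) \<in> borel_measurable ?M"
    by (rule borel_measurable_continuous_Pair[OF vm Dm]) (intro continuous_intros continuous_on_vec_lambda)
  show ?thesis unfolding weak_grad_def
  proof (intro conjI allI impI)
    show "(\<lambda>x. \<theta> x *\<^sub>R v x) \<in> borel_measurable ?M" using \<theta>m vm by (rule borel_measurable_scaleR)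
    show "(\<lambda>x. \<theta> x *\<^sub>R G x + (\<chi> i. v x $ i *\<^sub>R D x)) \<in> borel_measurable ?M"
      using \<theta>m Gm tensor by (intro borel_measurable_add borel_measurable_scaleR)
    fix \<phi> D\<phi> i j
    assume "test_fun \<Omega> \<phi> \<and> (\<forall>x. (\<phi> has_derivative (\<lambda>h. inner (D\<phi> x) h)) (at x))"
    then have \<phi>: "test_fun \<Omega> \<phi>" and D\<phi>: "\<And>x. (\<phi> has_derivative (\<lambda>h. inner (D\<phi> x) h)) (at x)" by auto
    have prod: "test_fun \<Omega> (\<lambda>x. \<theta> x * \<phi> x)" by (rule test_fun_mult[OF \<theta>(1) \<phi>])
    have Dprod: "((\<lambda>x. \<theta> x * \<phi> x) has_derivative (\<lambda>h. inner (\<theta> x *\<^sub>R D\<phi> x + \<phi> x *\<^sub>R D x) h)) (at x)" for x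
      using has_derivative_mult[OF D(1) D\<phi>, of x] by (simp add: inner_add_left mult.commute)
    have 1: "integrable ?M (\<lambda>x. v x $ i * D\<phi> x $ j)"
      by (rule weak_gradD(1)[OF G \<phi> D\<phi>])
    have 2: "integrable ?M (\<lambda>x. v x $ i * (\<theta> x *\<^sub>R D\<phi> x + \<phi> x *\<^sub>R D x) $ j)"
        "integrable ?M (\<lambda>x. G x $ i $ j * (\<theta> x * \<phi> x))"
        "(LINT x|?M. v x $ i * (\<theta> x *\<^sub>R D\<phi> x + \<phi> x *\<^sub>R D x) $ j) = - (LINT x|?M. G x $ i $ j * (\<theta> x * \<phi> x))"
      by (rule weak_gradD[OF G prod Dprod])+
    have 3: "integrable ?M (\<lambda>x. \<theta> x * (v x $ i * D\<phi> x $ j))"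
      using integrable_mult_bounded[OF 1 \<theta>m \<theta>(2)] by (simp add: mult.commute)
    \<comment> \<open>\<open>weak_grad\<close> grants integrability of \<open>v\<close> only against
      full gradients of test functions. Here these are the gradients of \<open>\<phi>\<close> and of
      \<open>\<theta> * \<phi>\<close>, and the mixed term is a difference of the two resulting
      functions.\<close>
    have 4: "integrable ?M (\<lambda>x. v x $ i * D x $ j * \<phi> x)"
      using Bochner_Integration.integrable_diff[OF 2(1) 3] by (simp add: algebra_simps)
    show "integrable ?M (\<lambda>x. (\<theta> x *\<^sub>R v x) $ i * D\<phi> x $ j)" using 3 by (simp add: mult.assoc)
    have split: "(\<theta> x *\<^sub>R G x + (\<chi> i. v x $ i *\<^sub>R D x)) $ i $ j * \<phi> x = G x $ i $ j * (\<theta> x * \<phi> x) + v x $ i * D x $ j * \<phi> x" for x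
      by (simp add: algebra_simps)
    show "integrable ?M (\<lambda>x. (\<theta> x *\<^sub>R G x + (\<chi> i. v x $ i *\<^sub>R D x)) $ i $ j * \<phi> x)"
      unfolding split using 2(2) 4 by (rule Bochner_Integration.integrable_add)
    have "(LINT x|?M. v x $ i * (\<theta> x *\<^sub>R D\<phi> x + \<phi> x *\<^sub>R D x) $ j) = (LINT x|?M. \<theta> x * (v x $ i * D\<phi> x $ j) + v x $ i * D x $ j * \<phi> x)"
      by (intro Bochner_Integration.integral_cong) (auto simp: algebra_simps)
    also have "\<dots> = (LINT x|?M. \<theta> x * (v x $ i * D\<phi> x $ j)) + (LINT x|?M. v x $ i * D x $ j * \<phi> x)"
      using 3 4 by (rule Bochner_Integration.integral_add)
    finally have "(LINT x|?M. \<theta> x * (v x $ i * D\<phi> x $ j)) = - ((LINT x|?M. G x $ i $ j * (\<theta> x * \<phi> x)) + (LINT x|?M. v x $ i * D x $ j * \<phi> x))"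
      using 2(3) by simp
    also have "\<dots> = - (LINT x|?M. G x $ i $ j * (\<theta> x * \<phi> x) + v x $ i * D x $ j * \<phi> x)"
      using 2(2) 4 by simp
    finally show "(LINT x|?M. (\<theta> x *\<^sub>R v x) $ i * D\<phi> x $ j) = - (LINT x|?M. (\<theta> x *\<^sub>R G x + (\<chi> i. v x $ i *\<^sub>R D x)) $ i $ j * \<phi> x)"
      unfolding split by (simp add: mult.assoc)
  qed
qed

section \<open>Geometry of \<open>C\<^sup>1\<close> domains\<close>

text \<open>A boundary point inside the chart satisfies the graph equation: the height is
  nonnegative as a limit from the domain and nonpositive because the point is outside. So the piece
  lies in the image of a hyperplane under a differentiable map.\<close>

lemma frontier_graph_null:
  fixes \<Omega> :: "(real^'d) set"
  assumes op: "open \<Omega>" and e: "norm e = 1" and \<gamma>: "\<And>x. (\<gamma> has_derivative (\<lambda>h. inner (\<gamma>' x) h)) (at x)"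
    and chart: "\<Omega> \<inter> ball p r = {x \<in> ball p r. inner x e > \<gamma> (x - inner x e *\<^sub>R e)}"
  shows "negligible (frontier \<Omega> \<inter> ball p r)"
proof -
  define \<Phi> where "\<Phi> y = y + \<gamma> y *\<^sub>R e" for y
  have cont: "continuous_on UNIV \<gamma>"
    by (intro continuous_at_imp_continuous_on ballI has_derivative_continuous[OF \<gamma>])
  have "frontier \<Omega> \<inter> ball p r \<subseteq> \<Phi> ` {y. inner e y = 0}"
  proof
    fix x assume x: "x \<in> frontier \<Omega> \<inter> ball p r"
    let ?f = "\<lambda>x. inner x e - \<gamma> (x - inner x e *\<^sub>R e)"
    have fc: "continuous_on UNIV ?f"
      by (intro continuous_intros continuous_on_compose2[OF cont]) auto
    have "x \<notin> \<Omega>" using x op by (simp add: frontier_def interior_open)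
    then have "?f x \<le> 0" using chart x by force
    moreover have "?f x \<ge> 0"
    proof -
      have "x \<in> closure (\<Omega> \<inter> ball p r)"
        using x open_Int_closure_subset[OF open_ball, of p r \<Omega>] by (auto simp: frontier_def Int_commute)
      moreover have "closed {x. 0 \<le> ?f x}" using fc by (intro closed_Collect_le continuous_on_const)
      moreover have "\<Omega> \<inter> ball p r \<subseteq> {x. 0 \<le> ?f x}" unfolding chart by auto
      ultimately show ?thesis using closure_minimal by blast
    qed
    ultimately have "inner x e = \<gamma> (x - inner x e *\<^sub>R e)" by simp
    then have "x = \<Phi> (x - inner x e *\<^sub>R e)" unfolding \<Phi>_def by simp
    moreover have "inner e (x - inner x e *\<^sub>R e) = 0"
      using e by (simp add: inner_diff_right power2_norm_eq_inner[symmetric] inner_commute norm_eq_1)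
    ultimately show "x \<in> \<Phi> ` {y. inner e y = 0}" by blast
  qed
  moreover have "negligible (\<Phi> ` {y. inner e y = 0})"
  proof (rule negligible_differentiable_image_negligible)
    show "negligible {y. inner e y = 0}" by (rule negligible_hyperplane) (use e in auto)
    show "\<Phi> differentiable_on {y. inner e y = 0}"
      unfolding \<Phi>_def differentiable_on_def
    proof (intro ballI differentiable_add differentiable_scaleR differentiable_const differentiable_ident)
      show "\<gamma> differentiable (at y within {y. inner e y = 0})" for y
        using \<gamma> differentiableI has_derivative_at_withinI by blast
    qed
  qed simp
  ultimately show ?thesis by (rule negligible_subset[rotated])
qed

lemma C1_domain_frontier_null:
  assumes "C1_domain \<Omega>" shows "negligible (frontier \<Omega>)"
proof -
  have op: "open \<Omega>" and b: "bounded \<Omega>" using assms by (auto simp: C1_domain_def)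
  have "\<exists>r>0. negligible (frontier \<Omega> \<inter> ball p r)" if p: "p \<in> frontier \<Omega>" for p
  proof -
    obtain r e \<gamma> \<gamma>' where "r > 0" "norm e = 1" "\<And>x. (\<gamma> has_derivative (\<lambda>h. inner (\<gamma>' x) h)) (at x)"
      "\<Omega> \<inter> ball p r = {x \<in> ball p r. inner x e > \<gamma> (x - inner x e *\<^sub>R e)}"
      using assms p unfolding C1_domain_def by blast
    then show ?thesis using frontier_graph_null[OF op, of e \<gamma> \<gamma>' p r] by blast
  qed
  then obtain r where r: "\<And>p. p \<in> frontier \<Omega> \<Longrightarrow> r p > 0 \<and> negligible (frontier \<Omega> \<inter> ball p (r p))" by metis
  have "compact (frontier \<Omega>)" using b by (simp add: compact_frontier_bounded)
  then obtain D where D: "D \<subseteq> frontier \<Omega>" "finite D" "frontier \<Omega> \<subseteq> (\<Union>p\<in>D. ball p (r p))"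
    by (rule compactE_image[of _ "frontier \<Omega>" "\<lambda>p. ball p (r p)"]) (use r in force)+
  then have "frontier \<Omega> = (\<Union>p\<in>D. frontier \<Omega> \<inter> ball p (r p))" by blast
  moreover have "negligible (\<Union>p\<in>D. frontier \<Omega> \<inter> ball p (r p))"
    using D r by (intro negligible_Union) auto
  ultimately show ?thesis by simp
qed

text \<open>\<open>f\<close> measures the height above the graph. Along directions close to
  \<open>e\<close> it is nondecreasing, as \<open>\<gamma>'\<close> is bounded on a compact set, so
  a segment that starts above the graph stays above it.\<close>

lemma cone_condition_chart:
  fixes \<Omega> :: "(real^'d) set"
  assumes r: "r > 0" and e: "norm e = 1" and \<gamma>: "\<And>x. (\<gamma> has_derivative (\<lambda>h. inner (\<gamma>' x) h)) (at x)"
    and \<gamma>': "continuous_on UNIV \<gamma>'"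
    and chart: "\<Omega> \<inter> ball p r = {x \<in> ball p r. inner x e > \<gamma> (x - inner x e *\<^sub>R e)}"
  shows "\<exists>\<kappa>>0. \<exists>T>0. \<forall>x\<in>\<Omega> \<inter> ball p (r/2). \<forall>w\<in>ball e \<kappa>. \<forall>t\<in>{0..T}. x + t *\<^sub>R w \<in> \<Omega>"
proof -
  define P where "P x = x - inner x e *\<^sub>R e" for x
  define f where "f x = inner x e - \<gamma> (P x)" for x
  have Pl: "bounded_linear P" unfolding P_def
    by (intro bounded_linear_sub bounded_linear_ident bounded_linear_scaleR_const bounded_linear_inner_left)
  have Pn: "norm (P z) \<le> 2 * norm z" for z
  proof -
    have "norm (P z) \<le> norm z + norm (inner z e *\<^sub>R e)" unfolding P_def by (rule norm_triangle_ineq4)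
    also have "norm (inner z e *\<^sub>R e) \<le> norm z" using Cauchy_Schwarz_ineq2[of z e] e by simp
    finally show ?thesis by simp
  qed
  have Pe: "P e = 0" unfolding P_def using e by (simp add: norm_eq_1)
  have fd: "(f has_derivative (\<lambda>h. inner h e - inner (\<gamma>' (P x)) (P h))) (at x)" for x
  proof -
    have "(P has_derivative P) (at x)" using Pl by (rule bounded_linear_imp_has_derivative)
    from has_derivative_compose[OF this \<gamma>[of "P x"]]
    have "((\<lambda>x. \<gamma> (P x)) has_derivative (\<lambda>h. inner (\<gamma>' (P x)) (P h))) (at x)" .
    then show ?thesis unfolding f_def
      by (intro has_derivative_diff bounded_linear_imp_has_derivative bounded_linear_inner_left)
  qed
  have "compact ((\<lambda>x. \<gamma>' (P x)) ` cball p r)"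
    by (intro compact_continuous_image compact_cball continuous_on_compose2[OF \<gamma>'] linear_continuous_on Pl) auto
  then obtain \<Lambda> where \<Lambda>0: "\<And>x. x \<in> cball p r \<Longrightarrow> norm (\<gamma>' (P x)) \<le> \<Lambda>"
    by (fastforce dest!: compact_imp_bounded simp: bounded_iff)
  have \<Lambda>: "\<Lambda> \<ge> 0" using \<Lambda>0[of p] r by (meson centre_in_cball less_imp_le norm_ge_zero order_trans)
  \<comment> \<open>Solves \<open>\<kappa> + 2 * \<Lambda> * \<kappa> = 1\<close>: the slope of
    \<open>f\<close> along \<open>w\<close> is at least
    \<open>1 - \<kappa> - 2 * \<Lambda> * \<kappa>\<close>, the 2 being the crude bound for the
    projection \<open>P\<close>.\<close>
  define \<kappa> where "\<kappa> = 1 / (1 + 2 * \<Lambda>)"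
  \<comment> \<open>As \<open>\<kappa> \<le> 1\<close>, directions have norm below 2, so a segment
    started in the half ball moves by at most \<open>r / 2\<close> and stays in the chart.\<close>
  define T where "T = r / 4"
  have \<kappa>: "0 < \<kappa>" "\<kappa> \<le> 1" using \<Lambda> by (auto simp: \<kappa>_def)
  have "x + t *\<^sub>R w \<in> \<Omega>" if x: "x \<in> \<Omega> \<inter> ball p (r/2)" and w: "w \<in> ball e \<kappa>" and t: "t \<in> {0..T}" for x w t
  proof -
    have nw: "norm w < 2" using w \<kappa> e norm_triangle_ineq2[of w e] by (simp add: dist_norm norm_minus_commute)
    have seg: "x + s *\<^sub>R w \<in> ball p r" if s: "s \<in> {0..t}" for s
    proof -
      have "norm (s *\<^sub>R w) \<le> T * 2" using s t nw by (simp add: abs_of_nonneg mult_mono)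
      then have "dist p (x + s *\<^sub>R w) \<le> dist p x + r / 2"
        using norm_triangle_ineq4[of "p - x" "s *\<^sub>R w"] by (simp add: dist_norm T_def algebra_simps)
      then show ?thesis using x by simp
    qed
    have pos: "0 \<le> inner w e - inner (\<gamma>' (P (x + s *\<^sub>R w))) (P w)" if s: "s \<in> {0..t}" for s
    proof -
      have wz: "w = e + (w - e)" by simp
      have nz: "norm (w - e) \<le> \<kappa>" using w by (simp add: dist_norm norm_minus_commute)
      have "inner w e = 1 + inner (w - e) e" using e by (simp add: inner_diff_left norm_eq_1)
      moreover have "\<bar>inner (w - e) e\<bar> \<le> \<kappa>" using Cauchy_Schwarz_ineq2[of "w - e" e] e nz by simp
      moreover have "P w = P (w - e)" using Pe Pl by (simp add: linear_diff bounded_linear.linear)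
      moreover have "\<bar>inner (\<gamma>' (P (x + s *\<^sub>R w))) (P (w - e))\<bar> \<le> \<Lambda> * (2 * \<kappa>)"
      proof -
        have "\<bar>inner (\<gamma>' (P (x + s *\<^sub>R w))) (P (w - e))\<bar> \<le> norm (\<gamma>' (P (x + s *\<^sub>R w))) * norm (P (w - e))"
          by (rule Cauchy_Schwarz_ineq2)
        also have "\<dots> \<le> \<Lambda> * (2 * \<kappa>)"
        proof (rule mult_mono)
          show "norm (\<gamma>' (P (x + s *\<^sub>R w))) \<le> \<Lambda>" using \<Lambda>0 seg[OF s] by simp
          show "norm (P (w - e)) \<le> 2 * \<kappa>" using Pn[of "w - e"] nz by linarith
        qed (use \<Lambda> in auto)
        finally show ?thesis .
      qed
      moreover have "\<kappa> + \<Lambda> * (2 * \<kappa>) = 1" using \<Lambda> by (simp add: \<kappa>_def field_simps)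
      ultimately show ?thesis unfolding \<open>P w = P (w - e)\<close> by linarith
    qed
    have "f (x + 0 *\<^sub>R w) \<le> f (x + t *\<^sub>R w)"
    proof (rule DERIV_nonneg_imp_nondecreasing[of 0 t "\<lambda>s. f (x + s *\<^sub>R w)"])
      show "0 \<le> t" using t by simp
      fix s assume s: "0 \<le> s" "s \<le> t"
      have "((\<lambda>s. x + s *\<^sub>R w) has_derivative (\<lambda>h. h *\<^sub>R w)) (at s)" by (auto intro!: derivative_eq_intros)
      from has_derivative_compose[OF this fd]
      have "((\<lambda>s. f (x + s *\<^sub>R w)) has_derivative (\<lambda>h. inner (h *\<^sub>R w) e - inner (\<gamma>' (P (x + s *\<^sub>R w))) (P (h *\<^sub>R w)))) (at s)" .
      moreover have "(\<lambda>h. inner (h *\<^sub>R w) e - inner (\<gamma>' (P (x + s *\<^sub>R w))) (P (h *\<^sub>R w)))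
          = (*) (inner w e - inner (\<gamma>' (P (x + s *\<^sub>R w))) (P w))"
        using Pl by (simp add: fun_eq_iff linear_cmul bounded_linear.linear algebra_simps)
      ultimately have "((\<lambda>s. f (x + s *\<^sub>R w)) has_real_derivative (inner w e - inner (\<gamma>' (P (x + s *\<^sub>R w))) (P w))) (at s)"
        by (simp add: has_field_derivative_def)
      then show "\<exists>y. ((\<lambda>s. f (x + s *\<^sub>R w)) has_real_derivative y) (at s) \<and> y \<ge> 0" using pos s by auto
    qed
    moreover have "f x > 0"
    proof -
      have "x \<in> \<Omega> \<inter> ball p r" using x r by auto
      then show ?thesis unfolding chart f_def P_def by simp
    qed
    ultimately have "f (x + t *\<^sub>R w) > 0" by simp
    then have "x + t *\<^sub>R w \<in> {x \<in> ball p r. inner x e > \<gamma> (x - inner x e *\<^sub>R e)}"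
      using seg[of t] t by (simp add: f_def P_def)
    then show ?thesis using chart by blast
  qed
  moreover have "T > 0" using r by (simp add: T_def)
  ultimately show ?thesis using \<kappa>(1) by blast
qed

text \<open>A uniform inner cone near \<open>p\<close>. At an interior point all directions are
  admissible, which is encoded by \<open>e = 0\<close> and \<open>\<kappa> = 1\<close>; at a
  boundary point the chart provides the cone.\<close>

lemma C1_domain_cone_condition:
  assumes "C1_domain \<Omega>" "p \<in> closure \<Omega>"
  shows "\<exists>\<rho>>0. \<exists>e. \<exists>\<kappa>>0. \<exists>T>0. \<forall>x\<in>\<Omega> \<inter> ball p \<rho>. \<forall>w\<in>ball e \<kappa>. \<forall>t\<in>{0..T}. x + t *\<^sub>R w \<in> \<Omega>"
proof (cases "p \<in> \<Omega>")
  case True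
  have "open \<Omega>" using assms by (simp add: C1_domain_def)
  then obtain r where r: "r > 0" "ball p r \<subseteq> \<Omega>" using True open_contains_ball by blast
  have "x + t *\<^sub>R w \<in> \<Omega>" if "x \<in> \<Omega> \<inter> ball p (r/2)" "w \<in> ball 0 1" "t \<in> {0..r/2}" for x w t
  proof -
    have "norm (t *\<^sub>R w) \<le> r/2 * 1" using that by (simp only: norm_scaleR, intro mult_mono) auto
    then have "dist p (x + t *\<^sub>R w) \<le> dist p x + r / 2"
      using norm_triangle_ineq4[of "p - x" "t *\<^sub>R w"] by (simp add: dist_norm algebra_simps)
    then show ?thesis using that r(2) by auto
  qed
  then show ?thesis using r(1) by (intro exI[of _ "r/2"] conjI exI[of _ "0"] exI[of _ 1]) auto
next
  case False
  have "open \<Omega>" using assms by (simp add: C1_domain_def)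
  then have "p \<in> frontier \<Omega>" using False assms(2) by (simp add: frontier_def interior_open)
  then obtain r e \<gamma> \<gamma>' where c: "r > 0" "norm e = 1" "\<And>x. (\<gamma> has_derivative (\<lambda>h. inner (\<gamma>' x) h)) (at x)"
    "continuous_on UNIV \<gamma>'" "\<Omega> \<inter> ball p r = {x \<in> ball p r. inner x e > \<gamma> (x - inner x e *\<^sub>R e)}"
    using assms(1) unfolding C1_domain_def by blast
  have "r / 2 > 0" using c(1) by simp
  then show ?thesis using cone_condition_chart[OF c] by blast
qed

section \<open>Strong convergence in \<open>L\<^sup>2\<close>\<close>

lemma lborel_translate:
  fixes f :: "'a::euclidean_space \<Rightarrow> real"
  assumes f: "f \<in> borel_measurable borel"
  shows "integrable lborel (\<lambda>x. f (x + c)) \<longleftrightarrow> integrable lborel f"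
    and "(LINT x|lborel. f (x + c)) = (LINT x|lborel. f x)"
proof -
  have m: "(+) c \<in> measurable lborel borel" by simp
  show "integrable lborel (\<lambda>x. f (x + c)) \<longleftrightarrow> integrable lborel f"
    using integrable_distr_eq[OF m f] by (simp add: lborel_distr_plus add.commute)
  show "(LINT x|lborel. f (x + c)) = (LINT x|lborel. f x)"
    using integral_distr[OF m f] by (simp add: lborel_distr_plus add.commute)
qed

text \<open>By translation invariance the inner integral of \<open>\<bar>a\<bar>\<close> does not
  depend on \<open>s\<close>, so Tonelli reduces to the integrability of \<open>k\<close>. The shift
  \<open>c\<close> will be \<open>s *\<^sub>R w\<close>, the identity or 0.\<close>

lemma shear_integrable:
  fixes a :: "'a::euclidean_space \<Rightarrow> real" and k :: "'b::euclidean_space \<Rightarrow> real"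
  assumes a: "a \<in> borel_measurable borel" "integrable lborel a" and k: "integrable lborel k"
    and c[measurable]: "c \<in> borel_measurable borel"
    and b[measurable]: "b \<in> borel_measurable (borel :: ('b \<times> 'a) measure)" and M: "\<And>p. \<bar>b p\<bar> \<le> M"
  shows "integrable (lborel \<Otimes>\<^sub>M lborel) (\<lambda>(s, y). k s * a (y + c s) * b (s, y))"
proof -
  have [measurable]: "a \<in> borel_measurable borel" "k \<in> borel_measurable borel" using a k by auto
  have b'[measurable]: "b \<in> borel_measurable (lborel \<Otimes>\<^sub>M lborel)" by (simp add: lborel_prod)
  have 1: "integrable (lborel \<Otimes>\<^sub>M lborel) (\<lambda>(s, y). k s * a (y + c s))"
  proof (rule lborel_pair.Fubini_integrable)
    show "(\<lambda>(s, y). k s * a (y + c s)) \<in> borel_measurable (lborel \<Otimes>\<^sub>M lborel)" by measurable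
    have "(LINT y|lborel. norm (k s * a (y + c s))) = \<bar>k s\<bar> * (LINT y|lborel. \<bar>a y\<bar>)" for s
      using lborel_translate(2)[of "\<lambda>y. \<bar>a y\<bar>" "c s"] by (simp add: abs_mult)
    then show "integrable lborel (\<lambda>s. LINT y|lborel. norm (case (s, y) of (s, y) \<Rightarrow> k s * a (y + c s)))"
      using k by simp
    show "AE s in lborel. integrable lborel (\<lambda>y. case (s, y) of (s, y) \<Rightarrow> k s * a (y + c s))"
      using a lborel_translate(1)[OF a(1)] by simp
  qed
  show ?thesis using integrable_mult_bounded[OF 1 b' M] by (simp add: case_prod_beta')
qed

text \<open>Cauchy-Schwarz against the constant 1, from expanding the integral of the nonnegative
  function \<open>(V * k x - I)\<^sup>2\<close> over \<open>S\<close>.\<close>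

lemma set_integral_square_le:
  fixes k :: "'a \<Rightarrow> real"
  assumes S: "S \<in> sets M" "emeasure M S < \<infinity>" and k: "k \<in> borel_measurable M" and k2: "set_integrable M S (\<lambda>x. (k x)\<^sup>2)"
  shows "set_integrable M S k" and "(LINT x:S|M. k x)\<^sup>2 \<le> measure M S * (LINT x:S|M. (k x)\<^sup>2)"
proof -
  have S1: "set_integrable M S (\<lambda>x. 1 :: real)" using S unfolding set_integrable_def by simp
  have "set_integrable M S (\<lambda>x. 1 + (k x)\<^sup>2)" using S1 k2 by (rule set_integral_add)
  then show ki: "set_integrable M S k"
  proof (rule set_integrable_bound)
    show "set_borel_measurable M S k" using S k unfolding set_borel_measurable_def by simp
    show "AE x in M. x \<in> S \<longrightarrow> norm (k x) \<le> norm (1 + (k x)\<^sup>2)"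
    proof (intro AE_I2 impI)
      fix x
      have "0 \<le> (\<bar>k x\<bar> - 1)\<^sup>2" by simp
      then have "2 * \<bar>k x\<bar> \<le> 1 + (k x)\<^sup>2" by (simp add: power2_diff)
      then show "norm (k x) \<le> norm (1 + (k x)\<^sup>2)" by simp
    qed
  qed
  define I where "I = (LINT x:S|M. k x)"
  define V where "V = measure M S"
  have V1: "(LINT x:S|M. 1) = V" using S by (simp add: set_lebesgue_integral_def V_def)
  show "(LINT x:S|M. k x)\<^sup>2 \<le> measure M S * (LINT x:S|M. (k x)\<^sup>2)"
  proof (cases "V = 0")
    case True
    then have "S \<in> null_sets M" using S by (simp add: V_def null_sets_def emeasure_eq_ennreal_measure less_top)
    then have "AE x in M. x \<notin> S" by (rule AE_not_in)
    then have "AE x in M. indicator S x *\<^sub>R k x = 0" by eventually_elim simp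
    then have "I = 0" unfolding I_def set_lebesgue_integral_def by (rule integral_eq_zero_AE)
    then show ?thesis using True by (simp add: I_def V_def)
  next
    case False
    then have V: "V > 0" by (simp add: V_def zero_less_measure_iff)
    have A: "set_integrable M S (\<lambda>x. V\<^sup>2 * (k x)\<^sup>2)" using k2 by simp
    have B: "set_integrable M S (\<lambda>x. (2 * V * I) * k x)" using ki by simp
    have C: "set_integrable M S (\<lambda>x. I\<^sup>2 * (1::real))" by (rule set_integrable_mult_right) (rule S1)
    have e: "(V * k x - I)\<^sup>2 = V\<^sup>2 * (k x)\<^sup>2 - (2 * V * I) * k x + I\<^sup>2 * 1" for x by (simp add: power2_eq_square algebra_simps)
    have "0 \<le> (LINT x:S|M. (V * k x - I)\<^sup>2)"
      unfolding set_lebesgue_integral_def by (rule integral_nonneg_AE) simp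
    also have "\<dots> = V\<^sup>2 * (LINT x:S|M. (k x)\<^sup>2) - (2 * V * I) * I + I\<^sup>2 * V"
      unfolding e set_integral_add(2)[OF set_integral_diff(1)[OF A B] C] set_integral_diff(2)[OF A B]
        set_integral_mult_right V1 I_def[symmetric] ..
    finally have "V * I\<^sup>2 \<le> V * (V * (LINT x:S|M. (k x)\<^sup>2))" by (simp add: power2_eq_square algebra_simps)
    then show ?thesis using V by (simp add: I_def V_def)
  qed
qed

text \<open>A scalar Sobolev function with its gradient, as Borel functions on the whole space
  extended by zero, so that translates make sense. The jump at the boundary is harmless because test
  functions are supported inside. A vector \<open>h\<close> instead of coordinates suits derivatives
  along segments.\<close>

definition sobolev_pair :: "(real^'d) set \<Rightarrow> (real^'d \<Rightarrow> real) \<Rightarrow> (real^'d \<Rightarrow> real^'d) \<Rightarrow> bool" where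
  "sobolev_pair \<Omega> u g \<longleftrightarrow> u \<in> borel_measurable borel \<and> g \<in> borel_measurable borel \<and>
     (\<forall>x. x \<notin> \<Omega> \<longrightarrow> u x = 0 \<and> g x = 0) \<and>
     integrable lborel (\<lambda>x. (u x)\<^sup>2) \<and> integrable lborel (\<lambda>x. (norm (g x))\<^sup>2) \<and>
     (\<forall>\<phi> D h. test_fun \<Omega> \<phi> \<and> (\<forall>x. (\<phi> has_derivative (\<lambda>h. inner (D x) h)) (at x)) \<longrightarrow>
        (LINT x|lborel. u x * inner (D x) h) = - (LINT x|lborel. inner (g x) h * \<phi> x))"

lemma sobolev_pairD:
  assumes "sobolev_pair \<Omega> u g" "test_fun \<Omega> \<phi>" "\<And>x. (\<phi> has_derivative (\<lambda>h. inner (D x) h)) (at x)"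
  shows "(LINT x|lborel. u x * inner (D x) h) = - (LINT x|lborel. inner (g x) h * \<phi> x)"
  using assms(1)[unfolded sobolev_pair_def, THEN conjunct2, THEN conjunct2, THEN conjunct2, THEN conjunct2,
      THEN conjunct2, rule_format, of \<phi> D h] assms(2,3) by simp

lemma integrable_of_square_integrable:
  fixes f :: "'a::euclidean_space \<Rightarrow> real"
  assumes f: "f \<in> borel_measurable borel" and \<Omega>: "bounded \<Omega>" "\<Omega> \<in> sets borel" and z: "\<And>x. x \<notin> \<Omega> \<Longrightarrow> f x = 0"
    and f2: "integrable lborel (\<lambda>x. (f x)\<^sup>2)"
  shows "integrable lborel f"
proof -
  have fin: "emeasure lborel \<Omega> < \<infinity>" using emeasure_bounded_finite[OF \<Omega>(1)] .
  have "set_integrable lborel \<Omega> f"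
    by (rule set_integral_square_le(1))
      (use \<Omega> fin f integrable_mult_indicator[OF _ f2, of \<Omega>] in \<open>auto simp: set_integrable_def\<close>)
  moreover have "(\<lambda>x. indicator \<Omega> x *\<^sub>R f x) = f" using z by (auto simp: indicator_def fun_eq_iff)
  ultimately show ?thesis by (simp add: set_integrable_def)
qed

lemma sobolev_pair_integrable:
  assumes "sobolev_pair \<Omega> u g" "bounded \<Omega>" "open \<Omega>"
  shows "integrable lborel u" "integrable lborel (\<lambda>x. inner (g x) h)"
proof -
  show "integrable lborel u"
    by (rule integrable_of_square_integrable[of _ \<Omega>]) (use assms in \<open>auto simp: sobolev_pair_def\<close>)
  have "integrable lborel (\<lambda>x. norm (g x))"
    by (rule integrable_of_square_integrable[of _ \<Omega>]) (use assms in \<open>auto simp: sobolev_pair_def\<close>)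
  then have "integrable lborel g" using assms(1) by (auto simp: sobolev_pair_def intro: integrable_norm_cancel)
  then show "integrable lborel (\<lambda>x. inner (g x) h)" by simp
qed

text \<open>Moving the difference quotient onto the test function, \<open>u(x + w) - u(x)\<close> is seen to be the
  integral of the weak derivative along the segment from \<open>x\<close> to \<open>x + w\<close>.\<close>

lemma weak_difference_AE:
  fixes u :: "real^'d \<Rightarrow> real"
  assumes pair: "sobolev_pair \<Omega> u g" and \<Omega>: "bounded \<Omega>" "open \<Omega>" and P: "open P"
    and seg: "\<And>x s. x \<in> P \<Longrightarrow> s \<in> {0..1} \<Longrightarrow> x + s *\<^sub>R w \<in> \<Omega>"
  shows "AE x in lborel. x \<in> P \<longrightarrow> u (x + w) - u x = (LINT s|lborel. indicator {0..1} s * inner (g (x + s *\<^sub>R w)) w)"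
proof -
  have um[measurable]: "u \<in> borel_measurable borel" and gm[measurable]: "g \<in> borel_measurable borel"
    using pair by (auto simp: sobolev_pair_def)
  have ui: "integrable lborel u" and gi: "integrable lborel (\<lambda>x. inner (g x) w)"
    using sobolev_pair_integrable[OF pair \<Omega>] by auto
  define H where "H x = (LINT s|lborel. indicator {0..1} s * inner (g (x + s *\<^sub>R w)) w)" for x
  have Hm[measurable]: "H \<in> borel_measurable borel"
    unfolding H_def by measurable
  have ind: "integrable lborel (indicator {0..1::real} :: real \<Rightarrow> real)" by simp
  have "AE x in lborel. x \<in> P \<longrightarrow> u (x + w) - u x - H x = 0"
  proof (rule fundamental_lemma_borel[OF P])
    show "(\<lambda>x. u (x + w) - u x - H x) \<in> borel_measurable borel" by measurable
    fix \<phi> assume \<phi>: "test_fun P \<phi>"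
    have \<phi>m[measurable]: "\<phi> \<in> borel_measurable borel" using test_fun_borel[OF \<phi>] .
    obtain M where M: "\<And>x. \<bar>\<phi> x\<bar> \<le> M" using test_fun_bounded[OF \<phi>] by blast
    obtain D N where D: "\<And>x. (\<phi> has_derivative (\<lambda>h. inner (D x) h)) (at x)" "continuous_on UNIV D"
      and N: "\<And>x. norm (D x) \<le> N" using test_fun_gradient[OF \<phi>] by blast
    have Dm[measurable]: "D \<in> borel_measurable borel" using D(2) by (rule borel_measurable_continuous_onI)
    have swi: "integrable lborel (\<lambda>x. u (x + w))" using lborel_translate(1)[OF um] ui by simp
    have i1: "integrable lborel (\<lambda>x. u (x + w) * \<phi> x)" by (rule integrable_mult_bounded[OF swi _ M]) (use \<phi>m in simp)
    have i2: "integrable lborel (\<lambda>x. u x * \<phi> x)" by (rule integrable_mult_bounded[OF ui _ M]) (use \<phi>m in simp)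
    have i2': "integrable lborel (\<lambda>y. u y * \<phi> (y - w))" by (rule integrable_mult_bounded[OF ui _ M]) measurable
    have fub1: "integrable (lborel \<Otimes>\<^sub>M lborel) (\<lambda>(s::real, x). indicator {0..1} s * inner (g (x + s *\<^sub>R w)) w * \<phi> x)"
    proof -
      have "(\<lambda>p :: real \<times> (real^'d). \<phi> (snd p)) \<in> borel_measurable borel"
        unfolding borel_prod[symmetric] by measurable
      then show ?thesis
        using shear_integrable[OF _ gi ind, of "\<lambda>s. s *\<^sub>R w" "\<lambda>p. \<phi> (snd p)" M] M by simp
    qed
    have fub2: "integrable (lborel \<Otimes>\<^sub>M lborel) (\<lambda>(s::real, y). indicator {0..1} s * u y * - inner (D (y - s *\<^sub>R w)) w)"
    proof -
      have "\<bar>- inner (D z) w\<bar> \<le> N * norm w" for z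
        using Cauchy_Schwarz_ineq2[of "D z" w] N[of z] by (simp add: mult_right_mono order_trans)
      moreover have "(\<lambda>p :: real \<times> (real^'d). - inner (D (snd p - fst p *\<^sub>R w)) w) \<in> borel_measurable borel"
        unfolding borel_prod[symmetric] by measurable
      ultimately show ?thesis
        using shear_integrable[OF um ui ind, of "\<lambda>s. 0" "\<lambda>p. - inner (D (snd p - fst p *\<^sub>R w)) w" "N * norm w"]
        by simp
    qed
    have \<phi>H: "integrable lborel (\<lambda>x. H x * \<phi> x)"
      using lborel_pair.integrable_snd[OF fub1] by (simp add: H_def)
    \<comment> \<open>The fundamental theorem of calculus is applied to the smooth test function,
      along the segment from \<open>y\<close> to \<open>y - w\<close>.\<close>
    have line: "(LINT s|lborel. indicator {0..1} s * - inner (D (y - s *\<^sub>R w)) w) = \<phi> (y - w) - \<phi> y" for y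
    proof -
      have "(LINT s|lborel. - inner (D (y - s *\<^sub>R w)) w * indicator {0..1} s) = \<phi> (y - 1 *\<^sub>R w) - \<phi> (y - 0 *\<^sub>R w)"
      proof (rule integral_FTC_Icc_real)
        fix s :: real
        have "((\<lambda>s. y - s *\<^sub>R w) has_derivative (\<lambda>h. - (h *\<^sub>R w))) (at s)" by (auto intro!: derivative_eq_intros)
        from has_derivative_compose[OF this D(1)]
        have "((\<lambda>s. \<phi> (y - s *\<^sub>R w)) has_derivative (\<lambda>h. inner (D (y - s *\<^sub>R w)) (- (h *\<^sub>R w)))) (at s)" .
        then show "((\<lambda>s. \<phi> (y - s *\<^sub>R w)) has_real_derivative - inner (D (y - s *\<^sub>R w)) w) (at s)"
          unfolding has_field_derivative_def by (rule has_derivative_eq_rhs) (simp add: fun_eq_iff)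
        have "continuous_on UNIV (\<lambda>s. - inner (D (y - s *\<^sub>R w)) w)"
          by (intro continuous_intros continuous_on_compose2[OF D(2)]) auto
        then show "isCont (\<lambda>s. - inner (D (y - s *\<^sub>R w)) w) s" by (simp add: continuous_on_eq_continuous_at)
      qed simp
      then show ?thesis by (simp add: mult.commute)
    qed
    have "(LINT x|lborel. u (x + w) * \<phi> x) = (LINT y|lborel. u y * \<phi> (y - w))"
      using lborel_translate(2)[of "\<lambda>y. u y * \<phi> (y - w)" w] by simp
    then have "(LINT x|lborel. u (x + w) * \<phi> x) - (LINT x|lborel. u x * \<phi> x) = (LINT y|lborel. u y * (\<phi> (y - w) - \<phi> y))"
      using i2 i2' by (simp add: right_diff_distrib)
    also have "\<dots> = (LINT y|lborel. (LINT s|lborel. indicator {0..1} s * u y * - inner (D (y - s *\<^sub>R w)) w))"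
    proof (rule Bochner_Integration.integral_cong[OF refl])
      fix y
      show "u y * (\<phi> (y - w) - \<phi> y) = (LINT s|lborel. indicator {0..1} s * u y * - inner (D (y - s *\<^sub>R w)) w)"
        unfolding line[symmetric] Bochner_Integration.integral_mult_right_zero[symmetric]
        by (rule Bochner_Integration.integral_cong) auto
    qed
    also have "\<dots> = (LINT s|lborel. (LINT y|lborel. indicator {0..1} s * u y * - inner (D (y - s *\<^sub>R w)) w))"
      by (rule lborel_pair.Fubini_integral[OF fub2])
    also have "\<dots> = (LINT s|lborel. (LINT x|lborel. indicator {0..1} s * inner (g (x + s *\<^sub>R w)) w * \<phi> x))"
    proof (rule Bochner_Integration.integral_cong[OF refl])
      fix s :: real
      show "(LINT y|lborel. indicator {0..1} s * u y * - inner (D (y - s *\<^sub>R w)) w)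
          = (LINT x|lborel. indicator {0..1} s * inner (g (x + s *\<^sub>R w)) w * \<phi> x)"
      proof (cases "s \<in> {0..1}")
        case True
        \<comment> \<open>The support of the translate lies in \<open>P\<close> shifted by
          \<open>s *\<^sub>R w\<close>, hence in the domain by \<open>seg\<close>; only therefore
          may the weak gradient be tested with it.\<close>
        have "test_fun \<Omega> (\<lambda>x. \<phi> (x - s *\<^sub>R w))"
          by (rule test_fun_translate[OF \<phi>]) (use seg True in auto)
        moreover have "((\<lambda>x. \<phi> (x - s *\<^sub>R w)) has_derivative (\<lambda>h. inner (D (x - s *\<^sub>R w)) h)) (at x)" for x
        proof -
          have "((\<lambda>x. x - s *\<^sub>R w) has_derivative (\<lambda>h. h)) (at x)" by (auto intro!: derivative_eq_intros)
          from has_derivative_compose[OF this D(1)] show ?thesis .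
        qed
        ultimately have "(LINT y|lborel. u y * inner (D (y - s *\<^sub>R w)) w) = - (LINT y|lborel. inner (g y) w * \<phi> (y - s *\<^sub>R w))"
          by (rule sobolev_pairD[OF pair])
        also have "(LINT y|lborel. inner (g y) w * \<phi> (y - s *\<^sub>R w)) = (LINT x|lborel. inner (g (x + s *\<^sub>R w)) w * \<phi> x)"
          using lborel_translate(2)[of "\<lambda>y. inner (g y) w * \<phi> (y - s *\<^sub>R w)" "s *\<^sub>R w"] by simp
        finally show ?thesis using True by simp
      qed simp
    qed
    also have "\<dots> = (LINT x|lborel. (LINT s|lborel. indicator {0..1} s * inner (g (x + s *\<^sub>R w)) w * \<phi> x))"
      by (rule lborel_pair.Fubini_integral[OF fub1, symmetric])
    also have "\<dots> = (LINT x|lborel. H x * \<phi> x)" by (simp add: H_def)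
    finally have "(LINT x|lborel. u (x + w) * \<phi> x) - (LINT x|lborel. u x * \<phi> x) - (LINT x|lborel. H x * \<phi> x) = 0" by simp
    then show "integrable lborel (\<lambda>x. (u (x + w) - u x - H x) * \<phi> x) \<and> (LINT x|lborel. (u (x + w) - u x - H x) * \<phi> x) = 0"
      using i1 i2 \<phi>H by (simp add: left_diff_distrib)
  qed
  then show ?thesis unfolding H_def by (auto elim: eventually_mono)
qed

text \<open>Cauchy-Schwarz on the unit segment, then Fubini: every translate of \<open>g\<close> has
  the same norm in L2 over the whole space, which is where the extension by zero pays off.\<close>

lemma translation_estimate:
  fixes u :: "real^'d \<Rightarrow> real"
  assumes pair: "sobolev_pair \<Omega> u g" and \<Omega>: "bounded \<Omega>" "open \<Omega>" and P: "open P"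
    and seg: "\<And>x s. x \<in> P \<Longrightarrow> s \<in> {0..1} \<Longrightarrow> x + s *\<^sub>R w \<in> \<Omega>"
  shows "(LINT x:P|lborel. (u (x + w) - u x)\<^sup>2) \<le> (norm w)\<^sup>2 * (LINT x|lborel. (norm (g x))\<^sup>2)"
proof -
  have um[measurable]: "u \<in> borel_measurable borel" and gm[measurable]: "g \<in> borel_measurable borel"
    and g2: "integrable lborel (\<lambda>x. (norm (g x))\<^sup>2)" using pair by (auto simp: sobolev_pair_def)
  have ind: "integrable lborel (indicator {0..1::real} :: real \<Rightarrow> real)" by simp
  have fub: "integrable (lborel \<Otimes>\<^sub>M lborel) (\<lambda>(s::real, x). indicator {0..1} s * (norm (g (x + s *\<^sub>R w)))\<^sup>2)"
    using shear_integrable[OF _ g2 ind, of "\<lambda>s. s *\<^sub>R w" "\<lambda>_. 1" 1] by simp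
  let ?Q = "\<lambda>x. (LINT s|lborel. indicator {0..1} s * (norm (g (x + s *\<^sub>R w)))\<^sup>2)"
  have "(LINT x:P|lborel. (u (x + w) - u x)\<^sup>2) \<le> (LINT x|lborel. (norm w)\<^sup>2 * ?Q x)"
    unfolding set_lebesgue_integral_def
  proof (rule integral_mono_AE')
    show "integrable lborel (\<lambda>x. (norm w)\<^sup>2 * ?Q x)"
      using lborel_pair.integrable_snd[OF fub] by simp
    show "AE x in lborel. 0 \<le> (norm w)\<^sup>2 * ?Q x" by (intro AE_I2 mult_nonneg_nonneg integral_nonneg_AE) auto
    have "AE x in lborel. x \<in> P \<longrightarrow> u (x + w) - u x = (LINT s|lborel. indicator {0..1} s * inner (g (x + s *\<^sub>R w)) w)"
      by (rule weak_difference_AE[OF pair \<Omega> P]) (rule seg)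
    then show "AE x in lborel. indicator P x *\<^sub>R (u (x + w) - u x)\<^sup>2 \<le> (norm w)\<^sup>2 * ?Q x"
      using lborel_pair.AE_integrable_snd[OF fub]
    proof eventually_elim
      case (elim x)
      have Q0: "?Q x \<ge> 0" by (rule integral_nonneg_AE) simp
      show ?case
      proof (cases "x \<in> P")
        case True
        let ?k = "\<lambda>s. inner (g (x + s *\<^sub>R w)) w"
        have km: "?k \<in> borel_measurable lborel" by measurable
        have kb: "(?k s)\<^sup>2 \<le> (norm w)\<^sup>2 * (norm (g (x + s *\<^sub>R w)))\<^sup>2" for s
          using Cauchy_Schwarz_ineq[of "g (x + s *\<^sub>R w)" w] by (simp add: power2_norm_eq_inner mult.commute)
        have bi: "set_integrable lborel {0..1} (\<lambda>s. (norm w)\<^sup>2 * (norm (g (x + s *\<^sub>R w)))\<^sup>2)"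
          by (rule set_integrable_mult_right) (use elim(2) in \<open>simp add: set_integrable_def\<close>)
        have k2: "set_integrable lborel {0..1} (\<lambda>s. (?k s)\<^sup>2)"
          by (rule set_integrable_bound[OF bi]) (use kb in \<open>auto simp: set_borel_measurable_def\<close>)
        have "(u (x + w) - u x)\<^sup>2 = (LINT s:{0..1}|lborel. ?k s)\<^sup>2"
          using elim(1) True by (simp add: set_lebesgue_integral_def)
        also have "\<dots> \<le> measure lborel {0..1::real} * (LINT s:{0..1}|lborel. (?k s)\<^sup>2)"
          by (rule set_integral_square_le(2)[OF _ _ km k2]) auto
        also have "\<dots> = (LINT s:{0..1}|lborel. (?k s)\<^sup>2)" by simp
        also have "\<dots> \<le> (LINT s:{0..1}|lborel. (norm w)\<^sup>2 * (norm (g (x + s *\<^sub>R w)))\<^sup>2)"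
          by (rule set_integral_mono[OF k2 bi]) (rule kb)
        also have "\<dots> = (norm w)\<^sup>2 * ?Q x" by (simp add: set_lebesgue_integral_def mult.left_commute)
        finally show ?thesis using True by simp
      qed (use Q0 in simp)
    qed
  qed
  also have "\<dots> = (norm w)\<^sup>2 * (LINT x|lborel. ?Q x)" by simp
  also have "(LINT x|lborel. ?Q x) = (LINT s|lborel. LINT x|lborel. indicator {0..1::real} s * (norm (g (x + s *\<^sub>R w)))\<^sup>2)"
    by (rule lborel_pair.Fubini_integral[OF fub])
  also have "\<dots> = (LINT s|lborel. indicator {0..1::real} s * (LINT x|lborel. (norm (g x))\<^sup>2))"
    using lborel_translate(2)[of "\<lambda>x. (norm (g x))\<^sup>2"] by simp
  also have "\<dots> = (LINT x|lborel. (norm (g x))\<^sup>2)" by simp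
  finally show ?thesis .
qed

lemma square_sum_le: "(a + b)\<^sup>2 \<le> 2 * a\<^sup>2 + 2 * (b::real)\<^sup>2"
  using sum_squares_bound[of a b] by (simp add: power2_sum)

lemma square_diff_le: "(a - b)\<^sup>2 \<le> 2 * a\<^sup>2 + 2 * (b::real)\<^sup>2"
  using square_sum_le[of a "- b"] by simp

text \<open>\<open>A x - u x\<close> is the mean of \<open>u (x + z) - u x\<close> over
  \<open>E\<close>, its square is at most the mean square, and the translation estimate controls
  that for each \<open>z\<close>. \<open>E\<close> will be a piece of a cone, so the averages stay
  inside the domain up to the boundary. The last claim is the bound for dominated
  convergence.\<close>

lemma averaging_estimate:
  fixes u :: "real^'d \<Rightarrow> real"
  assumes pair: "sobolev_pair \<Omega> u g" and \<Omega>: "bounded \<Omega>" "open \<Omega>" and P: "open P" "bounded P"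
    and E: "E \<in> sets borel" "0 < measure lborel E" "emeasure lborel E < \<infinity>" "\<And>z. z \<in> E \<Longrightarrow> norm z \<le> \<delta>"
    and seg: "\<And>x z s. x \<in> P \<Longrightarrow> z \<in> E \<Longrightarrow> s \<in> {0..1} \<Longrightarrow> x + s *\<^sub>R z \<in> \<Omega>"
  defines "A \<equiv> \<lambda>x. (LINT z:E|lborel. u (x + z)) / measure lborel E"
  shows "(LINT x:P|lborel. (u x)\<^sup>2) \<le> 2 * \<delta>\<^sup>2 * (LINT x|lborel. (norm (g x))\<^sup>2) + 2 * (LINT x:P|lborel. (A x)\<^sup>2)"
    and "A \<in> borel_measurable borel" and "(A x)\<^sup>2 \<le> (LINT x|lborel. (u x)\<^sup>2) / measure lborel E"
proof -
  define V where "V = measure lborel E"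
  have V: "V > 0" using E(2) by (simp add: V_def)
  have um[measurable]: "u \<in> borel_measurable borel" and u2: "integrable lborel (\<lambda>x. (u x)\<^sup>2)"
    and g2: "integrable lborel (\<lambda>x. (norm (g x))\<^sup>2)" using pair by (auto simp: sobolev_pair_def)
  note [measurable] = E(1)
  have [measurable]: "P \<in> sets borel" using P by simp
  have indE: "integrable lborel (indicator E :: real^'d \<Rightarrow> real)" using E(1,3) by simp
  have sq_trans: "integrable lborel (\<lambda>z. (u (x + z))\<^sup>2)" for x
    using lborel_translate(1)[of "\<lambda>z. (u z)\<^sup>2" x] u2 by (simp add: add.commute)
  have siE: "set_integrable lborel E f" if "integrable lborel f" for f :: "real^'d \<Rightarrow> real"
    using integrable_mult_indicator[OF _ that, of E] E(1) by (simp add: set_integrable_def)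
  have cE: "set_integrable lborel E (\<lambda>z. c)" for c :: real
    using indE by (simp add: set_integrable_def)
  show Am: "A \<in> borel_measurable borel"
    unfolding A_def set_lebesgue_integral_def by measurable
  show Ab: "(A x)\<^sup>2 \<le> (LINT x|lborel. (u x)\<^sup>2) / measure lborel E" for x
  proof -
    have "(LINT z:E|lborel. u (x + z))\<^sup>2 \<le> V * (LINT z:E|lborel. (u (x + z))\<^sup>2)"
      unfolding V_def by (rule set_integral_square_le(2)) (use E(1,3) siE[OF sq_trans] in auto)
    also have "\<dots> \<le> V * (LINT z|lborel. (u (x + z))\<^sup>2)"
      unfolding set_lebesgue_integral_def using V
      by (intro mult_left_mono integral_mono_AE'[OF sq_trans]) (auto simp: indicator_def)
    also have "(LINT z|lborel. (u (x + z))\<^sup>2) = (LINT z|lborel. (u z)\<^sup>2)"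
      using lborel_translate(2)[of "\<lambda>z. (u z)\<^sup>2" x] by (simp add: add.commute)
    finally show ?thesis using V unfolding A_def V_def[symmetric]
      by (simp add: power_divide power2_eq_square divide_simps) (simp add: mult_ac)
  qed
  define F where "F = (\<lambda>(z, x). indicator E z * (indicator P x * (u (x + z) - u x)\<^sup>2))"
  have F: "integrable (lborel \<Otimes>\<^sub>M lborel) F"
  proof (rule Bochner_Integration.integrable_bound)
    have 1: "integrable (lborel \<Otimes>\<^sub>M lborel) (\<lambda>(z, x). indicator E z * (u (x + z))\<^sup>2)"
      using shear_integrable[OF _ u2 indE, of "\<lambda>z. z" "\<lambda>_. 1" 1] by simp
    have 2: "integrable (lborel \<Otimes>\<^sub>M lborel) (\<lambda>(z, x). indicator E z * (u x)\<^sup>2)"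
      using shear_integrable[OF _ u2 indE, of "\<lambda>z. 0" "\<lambda>_. 1" 1] by simp
    show "integrable (lborel \<Otimes>\<^sub>M lborel) (\<lambda>p. 2 * (case p of (z, x) \<Rightarrow> indicator E z * (u (x + z))\<^sup>2)
        + 2 * (case p of (z, x) \<Rightarrow> indicator E z * (u x)\<^sup>2))"
      using 1 2 by (intro Bochner_Integration.integrable_add integrable_mult_right)
    show "F \<in> borel_measurable (lborel \<Otimes>\<^sub>M lborel)" unfolding F_def by measurable
    show "AE p in lborel \<Otimes>\<^sub>M lborel. norm (F p) \<le> norm (2 * (case p of (z, x) \<Rightarrow> indicator E z * (u (x + z))\<^sup>2)
        + 2 * (case p of (z, x) \<Rightarrow> indicator E z * (u x)\<^sup>2))"
    proof (rule AE_I2, clarify)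
      fix z x
      show "norm (F (z, x)) \<le> norm (2 * (indicator E z * (u (x + z))\<^sup>2) + 2 * (indicator E z * (u x)\<^sup>2))"
        using square_diff_le[of "u (x + z)" "u x"] by (auto simp: F_def indicator_def)
    qed
  qed
  \<comment> \<open>For \<open>x\<close> in \<open>P\<close>, \<open>W x / V\<close> is the mean
    square of the differences at \<open>x\<close>.\<close>
  define W where "W x = (LINT z|lborel. F (z, x))" for x
  have Wi: "integrable lborel W"
    unfolding W_def using lborel_pair.integrable_snd[of "\<lambda>z x. F (z, x)"] F by simp
  have "(LINT x|lborel. W x) = (LINT z|lborel. LINT x|lborel. F (z, x))"
    unfolding W_def using lborel_pair.Fubini_integral[of "\<lambda>z x. F (z, x)"] F by simp
  also have "\<dots> \<le> (LINT z|lborel. indicator E z * (\<delta>\<^sup>2 * (LINT x|lborel. (norm (g x))\<^sup>2)))"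
  proof (rule integral_mono_AE')
    have G0: "0 \<le> \<delta>\<^sup>2 * (LINT x|lborel. (norm (g x))\<^sup>2)"
      by (intro mult_nonneg_nonneg integral_nonneg_AE) auto
    then show "AE z in lborel. 0 \<le> indicator E z * (\<delta>\<^sup>2 * (LINT x|lborel. (norm (g x))\<^sup>2))" by simp
    show "AE z in lborel. (LINT x|lborel. F (z, x)) \<le> indicator E z * (\<delta>\<^sup>2 * (LINT x|lborel. (norm (g x))\<^sup>2))"
    proof (rule AE_I2)
      fix z
      show "(LINT x|lborel. F (z, x)) \<le> indicator E z * (\<delta>\<^sup>2 * (LINT x|lborel. (norm (g x))\<^sup>2))"
      proof (cases "z \<in> E")
        case True
        have "(LINT x|lborel. F (z, x)) = (LINT x:P|lborel. (u (x + z) - u x)\<^sup>2)"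
          using True by (simp add: F_def set_lebesgue_integral_def)
        also have "\<dots> \<le> (norm z)\<^sup>2 * (LINT x|lborel. (norm (g x))\<^sup>2)"
          by (rule translation_estimate[OF pair \<Omega> P(1)]) (rule seg[OF _ True])
        also have "\<dots> \<le> \<delta>\<^sup>2 * (LINT x|lborel. (norm (g x))\<^sup>2)"
          by (intro mult_right_mono power_mono E(4)[OF True] integral_nonneg_AE) auto
        finally show ?thesis using True by simp
      qed (simp add: F_def)
    qed
  qed (use indE in simp)
  also have "\<dots> = V * (\<delta>\<^sup>2 * (LINT x|lborel. (norm (g x))\<^sup>2))" using E(1) by (simp add: V_def)
  finally have WV: "(LINT x|lborel. W x) \<le> V * (\<delta>\<^sup>2 * (LINT x|lborel. (norm (g x))\<^sup>2))" .
  have AP: "integrable lborel (\<lambda>x. indicator P x * (A x)\<^sup>2)"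
  proof (rule Bochner_Integration.integrable_bound[where f="\<lambda>x. indicator P x * ((LINT x|lborel. (u x)\<^sup>2) / V)"])
    show "integrable lborel (\<lambda>x. indicator P x * ((LINT x|lborel. (u x)\<^sup>2) / V))"
      using P emeasure_bounded_finite[OF P(2)] by simp
    show "AE x in lborel. norm (indicator P x * (A x)\<^sup>2) \<le> norm (indicator P x * ((LINT x|lborel. (u x)\<^sup>2) / V))"
      using Ab by (intro AE_I2) (auto simp: V_def indicator_def intro: order_trans)
  qed (use Am in measurable)
  have "(LINT x:P|lborel. (u x)\<^sup>2) \<le> (LINT x|lborel. 2 / V * W x + 2 * (indicator P x * (A x)\<^sup>2))"
    unfolding set_lebesgue_integral_def
  proof (rule integral_mono_AE')
    have W0: "W x \<ge> 0" for x unfolding W_def F_def by (intro integral_nonneg_AE) auto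
    show "integrable lborel (\<lambda>x. 2 / V * W x + 2 * (indicator P x * (A x)\<^sup>2))"
      using Wi AP by (intro Bochner_Integration.integrable_add integrable_mult_right)
    show "AE x in lborel. 0 \<le> 2 / V * W x + 2 * (indicator P x * (A x)\<^sup>2)"
      using W0 V by (intro AE_I2 add_nonneg_nonneg mult_nonneg_nonneg) auto
    show "AE x in lborel. indicator P x *\<^sub>R (u x)\<^sup>2 \<le> 2 / V * W x + 2 * (indicator P x * (A x)\<^sup>2)"
    proof (rule AE_I2)
      fix x
      show "indicator P x *\<^sub>R (u x)\<^sup>2 \<le> 2 / V * W x + 2 * (indicator P x * (A x)\<^sup>2)"
      proof (cases "x \<in> P")
        case True
        have m1: "(\<lambda>z. u (x + z)) \<in> borel_measurable lborel" by measurable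
        have m2: "(\<lambda>z. u (x + z) - u x) \<in> borel_measurable lborel" by measurable
        have i1: "set_integrable lborel E (\<lambda>z. u (x + z))"
          by (rule set_integral_square_le(1)[OF _ E(3) m1]) (use E(1) siE[OF sq_trans] in auto)
        have i2: "set_integrable lborel E (\<lambda>z. (u (x + z) - u x)\<^sup>2)"
        proof (rule set_integrable_bound)
          show "set_integrable lborel E (\<lambda>z. 2 * (u (x + z))\<^sup>2 + 2 * (u x)\<^sup>2)"
            by (intro set_integral_add(1) cE set_integrable_mult_right siE[OF sq_trans])
          show "set_borel_measurable lborel E (\<lambda>z. (u (x + z) - u x)\<^sup>2)" unfolding set_borel_measurable_def by measurable
          show "AE z in lborel. z \<in> E \<longrightarrow> norm ((u (x + z) - u x)\<^sup>2) \<le> norm (2 * (u (x + z))\<^sup>2 + 2 * (u x)\<^sup>2)"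
            using square_diff_le by (intro AE_I2) (auto intro: order_trans)
        qed
        have "V * (A x - u x) = (LINT z:E|lborel. u (x + z) - u x)"
        proof -
          have "(LINT z:E|lborel. u x) = V * u x" using E(1) by (simp add: set_lebesgue_integral_def V_def)
          then show ?thesis
            using V unfolding set_integral_diff(2)[OF i1 cE] A_def V_def[symmetric] by (simp add: right_diff_distrib)
        qed
        then have "(V * (A x - u x))\<^sup>2 = (LINT z:E|lborel. u (x + z) - u x)\<^sup>2" by simp
        also have "\<dots> \<le> V * (LINT z:E|lborel. (u (x + z) - u x)\<^sup>2)"
          unfolding V_def by (rule set_integral_square_le(2)[OF _ E(3) m2 i2]) (use E(1) in simp)
        also have "(LINT z:E|lborel. (u (x + z) - u x)\<^sup>2) = W x"
          using True by (simp add: W_def F_def set_lebesgue_integral_def)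
        finally have "V * (V * (A x - u x)\<^sup>2) \<le> V * W x" by (simp add: power2_eq_square mult_ac)
        then have "(A x - u x)\<^sup>2 \<le> W x / V" using V by (simp add: pos_le_divide_eq mult.commute)
        moreover have "(u x)\<^sup>2 \<le> 2 * (A x - u x)\<^sup>2 + 2 * (A x)\<^sup>2"
          using square_diff_le[of "A x" "A x - u x"] by simp
        ultimately have "(u x)\<^sup>2 \<le> 2 * (W x / V) + 2 * (A x)\<^sup>2" by linarith
        then show ?thesis using True by simp
      qed (use W0 V in simp)
    qed
  qed
  also have "\<dots> = 2 / V * (LINT x|lborel. W x) + 2 * (LINT x:P|lborel. (A x)\<^sup>2)"
    using Wi AP by (simp add: set_lebesgue_integral_def)
  also have "2 / V * (LINT x|lborel. W x) \<le> 2 / V * (V * (\<delta>\<^sup>2 * (LINT x|lborel. (norm (g x))\<^sup>2)))"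
    by (rule mult_left_mono[OF WV]) (use V in simp)
  also have "\<dots> = 2 * \<delta>\<^sup>2 * (LINT x|lborel. (norm (g x))\<^sup>2)" using V by simp
  finally show "(LINT x:P|lborel. (u x)\<^sup>2) \<le> 2 * \<delta>\<^sup>2 * (LINT x|lborel. (norm (g x))\<^sup>2) + 2 * (LINT x:P|lborel. (A x)\<^sup>2)"
    by simp
qed

text \<open>Two scales: \<open>t\<close> is fixed so small that the gradient term is below
  \<open>\<epsilon> / 2\<close> for all \<open>n\<close>; then \<open>n\<close> grows, and the
  averages over the fixed set \<open>E\<close> tend to zero pointwise and boundedly.\<close>

lemma rellich_local:
  fixes u :: "nat \<Rightarrow> real^'d \<Rightarrow> real"
  assumes pair: "\<And>n. sobolev_pair \<Omega> (u n) (g n)" and \<Omega>: "bounded \<Omega>" "open \<Omega>"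
    and Cu: "\<And>n. (LINT x|lborel. (u n x)\<^sup>2) \<le> C" and Cg: "\<And>n. (LINT x|lborel. (norm (g n x))\<^sup>2) \<le> C"
    and wk: "\<And>c r. (\<lambda>n. LINT x:ball c r|lborel. u n x) \<longlonglongrightarrow> 0"
    and cone: "\<rho> > 0" "\<kappa> > 0" "T > 0" "\<And>x w t. x \<in> \<Omega> \<inter> ball p \<rho> \<Longrightarrow> w \<in> ball e \<kappa> \<Longrightarrow> t \<in> {0..T} \<Longrightarrow> x + t *\<^sub>R w \<in> \<Omega>"
  shows "(\<lambda>n. LINT x:\<Omega> \<inter> ball p \<rho>|lborel. (u n x)\<^sup>2) \<longlonglongrightarrow> 0"
proof (rule LIMSEQ_I)
  fix \<epsilon> :: real assume \<epsilon>: "\<epsilon> > 0"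
  let ?P = "\<Omega> \<inter> ball p \<rho>"
  have P: "open ?P" "bounded ?P" using \<Omega> by (auto intro: bounded_subset)
  have C: "C \<ge> 0" by (rule order_trans[OF _ Cu[of 0]]) simp
  \<comment> \<open>Bounds the length of all directions in the cone, so that points of
    \<open>E\<close> have norm at most \<open>t * b\<close>.\<close>
  define b where "b = norm e + \<kappa>"
  have b: "b > 0" using cone(2) by (simp add: b_def add_nonneg_pos)
  have "((\<lambda>t. 2 * (t * b)\<^sup>2 * C) \<longlongrightarrow> 2 * (0 * b)\<^sup>2 * C) (at_right 0)" by (intro tendsto_intros)
  then have "eventually (\<lambda>t. 2 * (t * b)\<^sup>2 * C < \<epsilon> / 2) (at_right 0)"
    by (rule order_tendstoD(2)) (use \<epsilon> in simp)
  moreover have "eventually (\<lambda>t. t < T \<and> t > 0) (at_right 0)"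
    using cone(3) by (auto simp: eventually_at_right_field)
  ultimately have "eventually (\<lambda>t. 2 * (t * b)\<^sup>2 * C < \<epsilon> / 2 \<and> t < T \<and> t > 0) (at_right 0)"
    by (rule eventually_conj)
  then obtain t where t: "2 * (t * b)\<^sup>2 * C < \<epsilon> / 2" "t < T" "t > 0"
    using eventually_happens'[OF trivial_limit_at_right_real] by blast
  \<comment> \<open>The ball of directions scaled by \<open>t\<close>. The cone condition keeps
    segments from \<open>x\<close> to \<open>x + z\<close> in the domain, and translates of
    \<open>E\<close> are balls, as \<open>wk\<close> requires.\<close>
  define E where "E = ball (t *\<^sub>R e) (t * \<kappa>)"
  define V where "V = measure lborel E"
  have tk: "t * \<kappa> > 0" using t cone by simp
  have E: "E \<in> sets borel" "emeasure lborel E < \<infinity>" 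
    using emeasure_lborel_ball_finite[of "t *\<^sub>R e" "t * \<kappa>"] unfolding E_def by simp_all
  have V: "V > 0" unfolding V_def E_def using tk by (simp add: content_ball_pos)
  have Ew: "(1 / t) *\<^sub>R z \<in> ball e \<kappa>" if "z \<in> E" for z
  proof -
    have "dist e ((1/t) *\<^sub>R z) = norm ((1/t) *\<^sub>R (t *\<^sub>R e - z))" using t(3) by (simp add: dist_norm scaleR_diff_right)
    also have "\<dots> = dist (t *\<^sub>R e) z / t" using t(3) by (simp add: dist_norm)
    also have "\<dots> < \<kappa>" using that t(3) by (simp add: E_def pos_divide_less_eq mult.commute)
    finally show ?thesis by simp
  qed
  have Ez: "norm z \<le> t * b" if "z \<in> E" for z
  proof -
    have "norm z \<le> norm (t *\<^sub>R e) + norm (z - t *\<^sub>R e)" by (metis norm_triangle_sub add.commute)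
    also have "norm (z - t *\<^sub>R e) \<le> t * \<kappa>" using that by (simp add: E_def dist_norm norm_minus_commute)
    finally show ?thesis using t(3) by (simp add: b_def distrib_left)
  qed
  have seg: "x + s *\<^sub>R z \<in> \<Omega>" if "x \<in> ?P" "z \<in> E" "s \<in> {0..1}" for x z s
  proof -
    have "s * t \<in> {0..T}" using that(3) t by (auto intro: order_trans[of _ "1 * t"] mult_right_mono)
    from cone(4)[OF that(1) Ew[OF that(2)] this] show ?thesis using t(3) by simp
  qed
  define A where "A n x = (LINT z:E|lborel. u n (x + z)) / measure lborel E" for n x
  have EV: "0 < measure lborel E" using V V_def by simp
  note avg = averaging_estimate[OF pair \<Omega> P E(1) EV E(2) Ez seg, folded A_def, folded V_def]
  have Alim: "(\<lambda>n. A n x) \<longlonglongrightarrow> 0" for x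
  proof -
    have "(LINT z:E|lborel. u n (x + z)) = (LINT y:ball (x + t *\<^sub>R e) (t * \<kappa>)|lborel. u n y)" for n
    proof -
      have um: "u n \<in> borel_measurable borel" using pair[of n] by (simp add: sobolev_pair_def)
      have "indicator E z = (indicator (ball (x + t *\<^sub>R e) (t * \<kappa>)) (z + x) :: real)" for z
        by (simp add: E_def indicator_def dist_norm algebra_simps)
      moreover have "(\<lambda>y. indicator (ball (x + t *\<^sub>R e) (t * \<kappa>)) y * u n y) \<in> borel_measurable borel"
        by (intro borel_measurable_times borel_measurable_indicator um) simp
      ultimately show ?thesis unfolding set_lebesgue_integral_def
        using lborel_translate(2)[of "\<lambda>y. indicator (ball (x + t *\<^sub>R e) (t * \<kappa>)) y * u n y" x]
        by (simp add: add.commute)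
    qed
    then have "(\<lambda>n. (LINT z:E|lborel. u n (x + z)) / V) \<longlonglongrightarrow> 0 / V"
      using wk by (intro tendsto_divide tendsto_const) (use V in auto)
    then show ?thesis by (simp add: A_def V_def)
  qed
  have "(\<lambda>n. LINT x|lborel. indicator ?P x *\<^sub>R (A n x)\<^sup>2) \<longlonglongrightarrow> (LINT x::real^'d|lborel. 0 :: real)"
  proof (rule integral_dominated_convergence[where w="\<lambda>x. indicator ?P x * (C / V)"])
    show "integrable lborel (\<lambda>x. indicator ?P x * (C / V))"
      using P emeasure_bounded_finite[OF P(2)] by simp
    show "AE x in lborel. (\<lambda>n. indicator ?P x *\<^sub>R (A n x)\<^sup>2) \<longlonglongrightarrow> 0"
    proof (rule AE_I2)
      fix x
      have "(\<lambda>n. indicator ?P x *\<^sub>R (A n x)\<^sup>2) \<longlonglongrightarrow> indicator ?P x *\<^sub>R 0\<^sup>2" by (intro tendsto_intros Alim)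
      then show "(\<lambda>n. indicator ?P x *\<^sub>R (A n x)\<^sup>2) \<longlonglongrightarrow> 0" by simp
    qed
    show "AE x in lborel. norm (indicator ?P x *\<^sub>R (A n x)\<^sup>2) \<le> indicator ?P x * (C / V)" for n
    proof (rule AE_I2)
      fix x
      have "(A n x)\<^sup>2 \<le> C / V" using avg(3)[of n x] divide_right_mono[OF Cu[of n], of V] V by linarith
      then show "norm (indicator ?P x *\<^sub>R (A n x)\<^sup>2) \<le> indicator ?P x * (C / V)" by (simp add: indicator_def)
    qed
    show "(\<lambda>x. indicator ?P x *\<^sub>R (A n x)\<^sup>2) \<in> borel_measurable lborel" for n
      using avg(2)[of n] P(1) by (intro borel_measurable_scaleR borel_measurable_indicator borel_measurable_power) auto
  qed simp
  \<comment> \<open>A quarter, since \<open>averaging_estimate\<close> puts a factor 2 in front of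
    this integral.\<close>
  then have "eventually (\<lambda>n. (LINT x:?P|lborel. (A n x)\<^sup>2) < \<epsilon> / 4) sequentially"
    unfolding set_lebesgue_integral_def by (rule order_tendstoD(2)) (use \<epsilon> in simp)
  then obtain N where N: "\<And>n. n \<ge> N \<Longrightarrow> (LINT x:?P|lborel. (A n x)\<^sup>2) < \<epsilon> / 4"
    by (auto simp: eventually_sequentially)
  have "norm ((LINT x:?P|lborel. (u n x)\<^sup>2) - 0) < \<epsilon>" if "n \<ge> N" for n
  proof -
    have "2 * (t * b)\<^sup>2 * (LINT x|lborel. (norm (g n x))\<^sup>2) \<le> 2 * (t * b)\<^sup>2 * C"
      by (rule mult_left_mono[OF Cg]) simp
    moreover have "0 \<le> (LINT x:?P|lborel. (u n x)\<^sup>2)"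
      unfolding set_lebesgue_integral_def by (rule integral_nonneg_AE) simp
    ultimately show ?thesis using avg(1)[of n] N[OF that] t(1) by simp
  qed
  then show "\<exists>N. \<forall>n\<ge>N. norm ((LINT x:?P|lborel. (u n x)\<^sup>2) - 0) < \<epsilon>" by blast
qed

lemma rellich:
  fixes u :: "nat \<Rightarrow> real^'d \<Rightarrow> real"
  assumes pair: "\<And>n. sobolev_pair \<Omega> (u n) (g n)" and dom: "C1_domain \<Omega>"
    and Cu: "\<And>n. (LINT x|lborel. (u n x)\<^sup>2) \<le> C" and Cg: "\<And>n. (LINT x|lborel. (norm (g n x))\<^sup>2) \<le> C"
    and wk: "\<And>c r. (\<lambda>n. LINT x:ball c r|lborel. u n x) \<longlonglongrightarrow> 0"
  shows "(\<lambda>n. LINT x|lborel. (u n x)\<^sup>2) \<longlonglongrightarrow> 0"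
proof -
  have \<Omega>: "bounded \<Omega>" "open \<Omega>" using dom by (auto simp: C1_domain_def)
  have "\<exists>\<rho>>0. (\<lambda>n. LINT x:\<Omega> \<inter> ball p \<rho>|lborel. (u n x)\<^sup>2) \<longlonglongrightarrow> 0" if p: "p \<in> closure \<Omega>" for p
  proof -
    obtain \<rho> e \<kappa> T where c: "\<rho> > 0" "\<kappa> > 0" "T > 0"
      "\<forall>x\<in>\<Omega> \<inter> ball p \<rho>. \<forall>w\<in>ball e \<kappa>. \<forall>t\<in>{0..T}. x + t *\<^sub>R w \<in> \<Omega>"
      using C1_domain_cone_condition[OF dom p] by blast
    have "(\<lambda>n. LINT x:\<Omega> \<inter> ball p \<rho>|lborel. (u n x)\<^sup>2) \<longlonglongrightarrow> 0"
      by (rule rellich_local[OF pair \<Omega> Cu Cg wk c(1-3)]) (use c(4) in blast)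
    then show ?thesis using c(1) by blast
  qed
  then have "\<forall>p. \<exists>\<rho>. p \<in> closure \<Omega> \<longrightarrow> \<rho> > 0 \<and> (\<lambda>n. LINT x:\<Omega> \<inter> ball p \<rho>|lborel. (u n x)\<^sup>2) \<longlonglongrightarrow> 0" by blast
  from choice[OF this] obtain \<rho> where \<rho>: "\<And>p. p \<in> closure \<Omega> \<Longrightarrow> \<rho> p > 0"
      "\<And>p. p \<in> closure \<Omega> \<Longrightarrow> (\<lambda>n. LINT x:\<Omega> \<inter> ball p (\<rho> p)|lborel. (u n x)\<^sup>2) \<longlonglongrightarrow> 0" by blast
  have "compact (closure \<Omega>)" using \<Omega> by (simp add: compact_closure)
  then obtain D where D: "D \<subseteq> closure \<Omega>" "finite D" "closure \<Omega> \<subseteq> (\<Union>p\<in>D. ball p (\<rho> p))"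
    by (rule compactE_image[of _ "closure \<Omega>" "\<lambda>p. ball p (\<rho> p)"]) (use \<rho>(1) in force)+
  have "(\<lambda>n. \<Sum>p\<in>D. LINT x:\<Omega> \<inter> ball p (\<rho> p)|lborel. (u n x)\<^sup>2) \<longlonglongrightarrow> (\<Sum>p\<in>D. 0)"
    by (rule tendsto_sum) (use \<rho>(2) D(1) in blast)
  then have lim: "(\<lambda>n. \<Sum>p\<in>D. LINT x:\<Omega> \<inter> ball p (\<rho> p)|lborel. (u n x)\<^sup>2) \<longlonglongrightarrow> 0" by simp
  show ?thesis
  proof (rule tendsto_sandwich[OF _ _ tendsto_const lim])
    show "eventually (\<lambda>n. 0 \<le> (LINT x|lborel. (u n x)\<^sup>2)) sequentially" by simp
    show "eventually (\<lambda>n. (LINT x|lborel. (u n x)\<^sup>2) \<le> (\<Sum>p\<in>D. LINT x:\<Omega> \<inter> ball p (\<rho> p)|lborel. (u n x)\<^sup>2)) sequentially"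
    proof (rule always_eventually, rule allI)
      fix n
      have u2: "integrable lborel (\<lambda>x. (u n x)\<^sup>2)" and z: "\<And>x. x \<notin> \<Omega> \<Longrightarrow> u n x = 0"
        using pair[of n] by (auto simp: sobolev_pair_def)
      have i: "integrable lborel (\<lambda>x. indicator (\<Omega> \<inter> ball p (\<rho> p)) x *\<^sub>R (u n x)\<^sup>2)" for p
        using \<Omega>(2) u2 by (intro integrable_mult_indicator) auto
      have "(LINT x|lborel. (u n x)\<^sup>2) \<le> (LINT x|lborel. (\<Sum>p\<in>D. indicator (\<Omega> \<inter> ball p (\<rho> p)) x *\<^sub>R (u n x)\<^sup>2))"
      proof (rule integral_mono[OF u2])
        show "integrable lborel (\<lambda>x. \<Sum>p\<in>D. indicator (\<Omega> \<inter> ball p (\<rho> p)) x *\<^sub>R (u n x)\<^sup>2)"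
          by (rule Bochner_Integration.integrable_sum) (rule i)
        fix x
        show "(u n x)\<^sup>2 \<le> (\<Sum>p\<in>D. indicator (\<Omega> \<inter> ball p (\<rho> p)) x *\<^sub>R (u n x)\<^sup>2)"
        proof (cases "x \<in> \<Omega>")
          case True
          then obtain p where p: "p \<in> D" "x \<in> ball p (\<rho> p)" using D(3) closure_subset[of \<Omega>] by blast
          have "(u n x)\<^sup>2 = indicator (\<Omega> \<inter> ball p (\<rho> p)) x *\<^sub>R (u n x)\<^sup>2" using p True by simp
          also have "\<dots> \<le> (\<Sum>p\<in>D. indicator (\<Omega> \<inter> ball p (\<rho> p)) x *\<^sub>R (u n x)\<^sup>2)"
            by (rule member_le_sum[OF p(1)]) (use D(2) in auto)
          finally show ?thesis .
        qed (use z in \<open>auto intro: sum_nonneg\<close>)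
      qed
      also have "\<dots> = (\<Sum>p\<in>D. LINT x:\<Omega> \<inter> ball p (\<rho> p)|lborel. (u n x)\<^sup>2)"
        unfolding set_lebesgue_integral_def by (rule Bochner_Integration.integral_sum) (rule i)
      finally show "(LINT x|lborel. (u n x)\<^sup>2) \<le> (\<Sum>p\<in>D. LINT x:\<Omega> \<inter> ball p (\<rho> p)|lborel. (u n x)\<^sup>2)" .
    qed
  qed
qed

section \<open>Weakly null functionals and strong convergence of the sequence\<close>

text \<open>Indices are added one at a time: all late indices have small entries against the
  finitely many chosen so far, and the infinite set \<open>S\<close> contains such an index.\<close>

lemma almost_orthogonal_finite_subset:
  fixes B :: "nat \<Rightarrow> nat \<Rightarrow> real"
  assumes sym: "\<And>i j. B i j = B j i" and lim: "\<And>m. (\<lambda>n. B n m) \<longlonglongrightarrow> 0" and S: "infinite S" and d: "d > 0"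
  shows "\<exists>J\<subseteq>S. finite J \<and> card J = N \<and> (\<forall>i\<in>J. \<forall>j\<in>J. i \<noteq> j \<longrightarrow> \<bar>B i j\<bar> \<le> d)"
proof (induction N)
  case 0 show ?case by (intro exI[of _ "{}"]) auto
next
  case (Suc N)
  then obtain J where J: "J \<subseteq> S" "finite J" "card J = N" "\<And>i j. i \<in> J \<Longrightarrow> j \<in> J \<Longrightarrow> i \<noteq> j \<Longrightarrow> \<bar>B i j\<bar> \<le> d" by blast
  have "eventually (\<lambda>n. \<bar>B n m\<bar> < d) sequentially" for m
    using tendstoD[OF lim[of m] d] by (simp add: dist_real_def)
  then have "eventually (\<lambda>n. \<forall>m\<in>J. \<bar>B n m\<bar> < d) sequentially"
    using J(2) by (simp add: eventually_ball_finite)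
  then obtain n0 where n0: "\<And>n. n \<ge> n0 \<Longrightarrow> \<forall>m\<in>J. \<bar>B n m\<bar> < d" by (auto simp: eventually_sequentially)
  obtain n where n: "n \<in> S" "n \<ge> n0" "n \<notin> J"
  proof -
    have "infinite (S - J - {..<n0})" using S J(2) by simp
    then have "S - J - {..<n0} \<noteq> {}" by (metis finite.emptyI)
    then obtain n where "n \<in> S - J - {..<n0}" by blast
    then show thesis using that by auto
  qed
  have "\<bar>B i j\<bar> \<le> d" if "i \<in> insert n J" "j \<in> insert n J" "i \<noteq> j" for i j
    using that J(4) n0[OF n(2)] sym by (auto intro: less_imp_le)
  then show ?case using J n by (intro exI[of _ "insert n J"]) auto
qed

text \<open>The Banach--Saks argument: along any subsequence some finite average is small in the
  norm induced by the Gram matrix \<open>B\<close>, and \<open>a\<close> plays the role of a bounded linear functional.\<close>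

lemma weakly_null_functional:
  fixes B :: "nat \<Rightarrow> nat \<Rightarrow> real" and a :: "nat \<Rightarrow> real"
  assumes sym: "\<And>i j. B i j = B j i" and lim: "\<And>m. (\<lambda>n. B n m) \<longlonglongrightarrow> 0" and C: "\<And>n. B n n \<le> C"
    and K: "K \<ge> 0" "\<And>J. finite J \<Longrightarrow> (\<Sum>j\<in>J. a j)\<^sup>2 \<le> K * (\<Sum>i\<in>J. \<Sum>j\<in>J. B i j)"
  shows "a \<longlonglongrightarrow> 0"
proof (rule ccontr)
  assume "\<not> a \<longlonglongrightarrow> 0"
  then obtain \<eta> where \<eta>: "\<eta> > 0" "\<And>N. \<exists>n\<ge>N. \<bar>a n\<bar> \<ge> \<eta>"
    unfolding LIMSEQ_iff by (force simp: not_less)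
  then have "infinite {n. \<bar>a n\<bar> \<ge> \<eta>}" unfolding infinite_nat_iff_unbounded_le by auto
  moreover have "{n. \<bar>a n\<bar> \<ge> \<eta>} = {n. a n \<ge> \<eta>} \<union> {n. - a n \<ge> \<eta>}" using \<eta>(1) by auto
  ultimately have "infinite {n. a n \<ge> \<eta>} \<or> infinite {n. - a n \<ge> \<eta>}" by simp
  \<comment> \<open>Keeping one sign prevents cancellation in the sums over
    \<open>J\<close>.\<close>
  then obtain S and \<sigma> :: real where S: "infinite S" "\<sigma> = 1 \<or> \<sigma> = -1" "\<And>n. n \<in> S \<Longrightarrow> \<sigma> * a n \<ge> \<eta>"
    by (metis (no_types, lifting) mem_Collect_eq mult_1 mult_minus1)
  \<comment> \<open>For \<open>N\<close> indices the hypothesis yields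
    \<open>N * \<eta>\<^sup>2 \<le> K * \<bar>C\<bar> + N * K * d\<close>. This \<open>d\<close>
    makes the last term at most half of the left side (\<open>K + 1\<close> admits
    \<open>K = 0\<close>); \<open>N\<close> then makes the other term less than the remaining
    half.\<close>
  define d where "d = \<eta>\<^sup>2 / (2 * (K + 1))"
  have d: "d > 0" using \<eta> K by (simp add: d_def)
  obtain N :: nat where N: "real N > K * \<bar>C\<bar> * 2 / \<eta>\<^sup>2" using reals_Archimedean2 by blast
  have N0: "real N > 0" using N K by (smt (verit) divide_nonneg_nonneg mult_nonneg_nonneg abs_ge_zero zero_le_power2)
  obtain J where J: "J \<subseteq> S" "finite J" "card J = N" "\<And>i j. i \<in> J \<Longrightarrow> j \<in> J \<Longrightarrow> i \<noteq> j \<Longrightarrow> \<bar>B i j\<bar> \<le> d"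
    using almost_orthogonal_finite_subset[OF sym lim S(1) d, of N] by blast
  have "(\<Sum>i\<in>J. \<Sum>j\<in>J. B i j) \<le> (\<Sum>i\<in>J. \<bar>C\<bar> + real N * d)"
  proof (rule sum_mono)
    fix i assume i: "i \<in> J"
    have "(\<Sum>j\<in>J. B i j) = B i i + (\<Sum>j\<in>J - {i}. B i j)" using J(2) i by (rule sum.remove)
    also have "(\<Sum>j\<in>J - {i}. B i j) \<le> (\<Sum>j\<in>J - {i}. d)"
      by (rule sum_mono) (use J(4)[OF i] in fastforce)
    also have "(\<Sum>j\<in>J - {i}. d) \<le> (\<Sum>j\<in>J. d)" by (rule sum_mono2) (use J(2) d in auto)
    finally show "(\<Sum>j\<in>J. B i j) \<le> \<bar>C\<bar> + real N * d" using C[of i] J(3) by simp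
  qed
  then have up: "K * (\<Sum>i\<in>J. \<Sum>j\<in>J. B i j) \<le> K * (real N * (\<bar>C\<bar> + real N * d))"
    using K(1) J(3) by (simp add: mult_left_mono)
  have "real N * \<eta> \<le> \<sigma> * (\<Sum>j\<in>J. a j)"
    using sum_mono[of J "\<lambda>_. \<eta>" "\<lambda>j. \<sigma> * a j"] S(3) J(1,3) by (auto simp: sum_distrib_left)
  then have "(real N * \<eta>)\<^sup>2 \<le> (\<sigma> * (\<Sum>j\<in>J. a j))\<^sup>2" using \<eta>(1) by (intro power_mono) auto
  also have "\<dots> = (\<Sum>j\<in>J. a j)\<^sup>2" using S(2) by (auto simp: power_mult_distrib)
  finally have "(real N * \<eta>)\<^sup>2 \<le> K * (real N * (\<bar>C\<bar> + real N * d))" using K(2)[OF J(2)] up by linarith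
  then have "real N * (real N * \<eta>\<^sup>2) \<le> real N * (K * \<bar>C\<bar> + real N * (K * d))"
    by (simp add: power2_eq_square algebra_simps)
  then have "real N * \<eta>\<^sup>2 \<le> K * \<bar>C\<bar> + real N * (K * d)" using N0 by simp
  moreover have "K * d \<le> \<eta>\<^sup>2 / 2" using K(1) \<eta>(1) by (simp add: d_def field_simps)
  then have "real N * (K * d) \<le> real N * (\<eta>\<^sup>2 / 2)" by (rule mult_left_mono) simp
  moreover have "K * \<bar>C\<bar> < real N * \<eta>\<^sup>2 / 2" using N \<eta>(1) by (simp add: field_simps)
  ultimately show False by simp
qed

lemma borel_version_euclidean:
  fixes f :: "'a::euclidean_space \<Rightarrow> 'b::euclidean_space"
  assumes f: "f \<in> borel_measurable (lebesgue_on \<Omega>)" and \<Omega>: "\<Omega> \<in> sets borel"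
  shows "\<exists>g \<in> borel_measurable borel. (\<forall>x. x \<notin> \<Omega> \<longrightarrow> g x = 0) \<and> (AE x in lebesgue_on \<Omega>. f x = g x)"
proof -
  have "\<forall>b. \<exists>g. g \<in> borel_measurable borel \<and> (\<forall>x. x \<notin> \<Omega> \<longrightarrow> g x = (0::real)) \<and> (AE x in lebesgue_on \<Omega>. inner (f x) b = g x)"
  proof
    fix b
    have "(\<lambda>x. inner (f x) b) \<in> borel_measurable (lebesgue_on \<Omega>)" using f by simp
    from borel_version[OF this \<Omega>]
    show "\<exists>g. g \<in> borel_measurable borel \<and> (\<forall>x. x \<notin> \<Omega> \<longrightarrow> g x = (0::real)) \<and> (AE x in lebesgue_on \<Omega>. inner (f x) b = g x)"
      by blast
  qed
  from choice[OF this] obtain g where g: "\<And>b. g b \<in> borel_measurable borel" "\<And>b x. x \<notin> \<Omega> \<Longrightarrow> g b x = 0"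
    "\<And>b. AE x in lebesgue_on \<Omega>. inner (f x) b = g b x" by blast
  define h where "h x = (\<Sum>b\<in>Basis. g b x *\<^sub>R b)" for x
  have "h \<in> borel_measurable borel" unfolding h_def using g(1) by measurable
  moreover have "AE x in lebesgue_on \<Omega>. \<forall>b\<in>Basis. inner (f x) b = g b x"
    using g(3) by (simp add: AE_finite_all)
  then have "AE x in lebesgue_on \<Omega>. f x = h x"
  proof eventually_elim
    case (elim x)
    have "f x = (\<Sum>b\<in>Basis. inner (f x) b *\<^sub>R b)" by (simp add: euclidean_representation)
    then show ?case using elim by (simp add: h_def)
  qed
  ultimately show ?thesis using g(2) by (intro bexI[of _ h]) (auto simp: h_def)
qed

lemma lebesgue_on_transfer:
  fixes f :: "'a::euclidean_space \<Rightarrow> real"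
  assumes f: "f \<in> borel_measurable (lebesgue_on \<Omega>)" and \<Omega>: "\<Omega> \<in> sets borel"
    and g: "g \<in> borel_measurable borel" "\<And>x. x \<notin> \<Omega> \<Longrightarrow> g x = 0" and ae: "AE x in lebesgue_on \<Omega>. f x = g x"
  shows "integrable (lebesgue_on \<Omega>) f \<longleftrightarrow> integrable lborel g"
    and "(LINT x|lebesgue_on \<Omega>. f x) = (LINT x|lborel. g x)"
proof -
  have gm: "g \<in> borel_measurable (lebesgue_on \<Omega>)"
    using g(1) by (simp add: measurable_restrict_space1 measurable_completion)
  show "integrable (lebesgue_on \<Omega>) f \<longleftrightarrow> integrable lborel g"
    using integrable_cong_AE[OF f gm ae] lebesgue_on_eq_lborel(1)[OF g(1) \<Omega> g(2)] by simp
  show "(LINT x|lebesgue_on \<Omega>. f x) = (LINT x|lborel. g x)"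
    using integral_cong_AE[OF f gm ae] lebesgue_on_eq_lborel(2)[OF g(1) \<Omega> g(2)] by simp
qed

lemma integrable_inner_of_squares:
  fixes f g :: "'a \<Rightarrow> 'b::euclidean_space"
  assumes "f \<in> borel_measurable M" "g \<in> borel_measurable M"
    and "integrable M (\<lambda>x. (norm (f x))\<^sup>2)" "integrable M (\<lambda>x. (norm (g x))\<^sup>2)"
  shows "integrable M (\<lambda>x. inner (f x) (g x))"
proof (rule Bochner_Integration.integrable_bound)
  show "integrable M (\<lambda>x. (norm (f x))\<^sup>2 + (norm (g x))\<^sup>2)" using assms by simp
  show "AE x in M. norm (inner (f x) (g x)) \<le> norm ((norm (f x))\<^sup>2 + (norm (g x))\<^sup>2)"
  proof (rule AE_I2)
    fix x
    have "\<bar>inner (f x) (g x)\<bar> \<le> norm (f x) * norm (g x)" by (rule Cauchy_Schwarz_ineq2)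
    moreover have "2 * (norm (f x) * norm (g x)) \<le> (norm (f x))\<^sup>2 + (norm (g x))\<^sup>2"
      using sum_squares_bound[of "norm (f x)" "norm (g x)"] by simp
    moreover have "0 \<le> norm (f x) * norm (g x)" by simp
    ultimately show "norm (inner (f x) (g x)) \<le> norm ((norm (f x))\<^sup>2 + (norm (g x))\<^sup>2)" by simp
  qed
qed (use assms in simp)

lemma gram_expansion:
  fixes F :: "nat \<Rightarrow> 'a \<Rightarrow> 'b::euclidean_space"
  assumes F: "\<And>n. F n \<in> borel_measurable M" "\<And>n. integrable M (\<lambda>x. (norm (F n x))\<^sup>2)"
  shows "integrable M (\<lambda>x. (norm (\<Sum>j\<in>J. c j *\<^sub>R F j x))\<^sup>2)"
    and "(LINT x|M. (norm (\<Sum>j\<in>J. c j *\<^sub>R F j x))\<^sup>2) = (\<Sum>i\<in>J. \<Sum>j\<in>J. c i * c j * (LINT x|M. inner (F i x) (F j x)))"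
proof -
  have e: "(norm (\<Sum>j\<in>J. c j *\<^sub>R F j x))\<^sup>2 = (\<Sum>i\<in>J. \<Sum>j\<in>J. c i * c j * inner (F i x) (F j x))" for x
    by (simp only: power2_norm_eq_inner inner_sum_left) (simp only: inner_sum_right inner_scaleR_left inner_scaleR_right mult.assoc mult.left_commute)
  have i: "integrable M (\<lambda>x. c i * c j * inner (F i x) (F j x))" for i j
    using integrable_inner_of_squares[OF F(1) F(1) F(2) F(2)] by simp
  show "integrable M (\<lambda>x. (norm (\<Sum>j\<in>J. c j *\<^sub>R F j x))\<^sup>2)"
    unfolding e by (intro Bochner_Integration.integrable_sum i)
  show "(LINT x|M. (norm (\<Sum>j\<in>J. c j *\<^sub>R F j x))\<^sup>2) = (\<Sum>i\<in>J. \<Sum>j\<in>J. c i * c j * (LINT x|M. inner (F i x) (F j x)))"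
    unfolding e Bochner_Integration.integral_sum[OF Bochner_Integration.integrable_sum[OF i]]
      Bochner_Integration.integral_sum[OF i] by simp
qed

lemma sobolev_pair_scale:
  assumes "sobolev_pair \<Omega> u g" shows "sobolev_pair \<Omega> (\<lambda>x. c * u x) (\<lambda>x. c *\<^sub>R g x)"
  by (insert assms, unfold sobolev_pair_def, elim conjE, intro conjI) (simp_all add: power_mult_distrib mult.assoc)

text \<open>Row \<open>i\<close> of a weak gradient, with Borel representatives: the coordinate
  identities of \<open>weak_grad\<close> are summed with the components of \<open>h\<close> as
  weights.\<close>

lemma sobolev_pair_component:
  fixes v :: "real^'d \<Rightarrow> real^'m"
  assumes op: "open \<Omega>" and G: "weak_grad \<Omega> v G"
    and V: "V \<in> borel_measurable borel" "\<And>x. x \<notin> \<Omega> \<Longrightarrow> V x = 0" "AE x in lebesgue_on \<Omega>. v x = V x"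
    and W: "W \<in> borel_measurable borel" "\<And>x. x \<notin> \<Omega> \<Longrightarrow> W x = 0" "AE x in lebesgue_on \<Omega>. G x = W x"
    and V2: "integrable lborel (\<lambda>x. (norm (V x))\<^sup>2)" and W2: "integrable lborel (\<lambda>x. (norm (W x))\<^sup>2)" and bd: "bounded \<Omega>"
  shows "sobolev_pair \<Omega> (\<lambda>x. V x $ i) (\<lambda>x. W x $ i)"
proof -
  have \<Omega>: "\<Omega> \<in> sets borel" using op by simp
  have c: "continuous_on UNIV (\<lambda>A :: 'z::real_normed_vector ^'m. A $ i)" by (intro continuous_intros)
  have Vi: "(\<lambda>x. V x $ i) \<in> borel_measurable borel" using borel_measurable_continuous_on[OF c V(1)] .
  have Wi: "(\<lambda>x. W x $ i) \<in> borel_measurable borel" using borel_measurable_continuous_on[OF c W(1)] .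
  have Vi2: "integrable lborel (\<lambda>x. (V x $ i)\<^sup>2)"
  proof (rule Bochner_Integration.integrable_bound[OF V2])
    show "AE x in lborel. norm ((V x $ i)\<^sup>2) \<le> norm ((norm (V x))\<^sup>2)"
    proof (rule AE_I2)
      fix x
      have "\<bar>V x $ i\<bar> \<le> norm (V x)" by (rule component_le_norm_cart)
      from power_mono[OF this, of 2] show "norm ((V x $ i)\<^sup>2) \<le> norm ((norm (V x))\<^sup>2)" by simp
    qed
  qed (use Vi in simp)
  have Wi2: "integrable lborel (\<lambda>x. (norm (W x $ i))\<^sup>2)"
  proof (rule Bochner_Integration.integrable_bound[OF W2])
    show "AE x in lborel. norm ((norm (W x $ i))\<^sup>2) \<le> norm ((norm (W x))\<^sup>2)"
    proof (rule AE_I2)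
      fix x
      have "norm (W x $ i) \<le> norm (W x)" by (rule Finite_Cartesian_Product.norm_nth_le)
      from power_mono[OF this, of 2] show "norm ((norm (W x $ i))\<^sup>2) \<le> norm ((norm (W x))\<^sup>2)" by simp
    qed
  qed (use Wi in simp)
  have Wint: "integrable lborel (\<lambda>x. W x $ i)"
  proof -
    have "integrable lborel (\<lambda>x. norm (W x $ i))"
      by (rule integrable_of_square_integrable[OF _ bd \<Omega>]) (use Wi Wi2 W(2) in auto)
    then show ?thesis by (rule integrable_norm_cancel) (use Wi in simp)
  qed
  have Vint: "integrable lborel (\<lambda>x. V x $ i)"
    by (rule integrable_of_square_integrable[OF _ bd \<Omega>]) (use Vi Vi2 V(2) in auto)
  have "(LINT x|lborel. V x $ i * inner (D x) h) = - (LINT x|lborel. inner (W x $ i) h * \<phi> x)"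
    if \<phi>: "test_fun \<Omega> \<phi>" and D: "\<And>x. (\<phi> has_derivative (\<lambda>h. inner (D x) h)) (at x)" for \<phi> D h
  proof -
    obtain D' N where D': "\<And>x. (\<phi> has_derivative (\<lambda>h. inner (D' x) h)) (at x)" "continuous_on UNIV D'"
      "\<And>x. norm (D' x) \<le> N" using test_fun_gradient[OF \<phi>] by blast
    \<comment> \<open>\<open>sobolev_pair\<close> quantifies over any derivative \<open>D\<close>;
      uniqueness identifies it with the continuous bounded one.\<close>
    have "D x = D' x" for x
    proof -
      have "(\<lambda>h. inner (D x) h) = (\<lambda>h. inner (D' x) h)" by (rule has_derivative_unique[OF D D'(1)])
      from fun_cong[OF this, of "D x - D' x"] have "inner (D x - D' x) (D x - D' x) = 0"
        by (simp add: inner_diff_left)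
      then show ?thesis by simp
    qed
    then have D_eq: "D = D'" by auto
    obtain M where M: "\<And>x. \<bar>\<phi> x\<bar> \<le> M" using test_fun_bounded[OF \<phi>] by blast
    have \<phi>m: "\<phi> \<in> borel_measurable borel" using test_fun_borel[OF \<phi>] .
    have Dm: "D \<in> borel_measurable borel" unfolding D_eq using D'(2) by (rule borel_measurable_continuous_onI)
    have D_j: "(\<lambda>x. D x $ j) \<in> borel_measurable borel" for j
      by (rule borel_measurable_continuous_on[OF _ Dm]) (intro continuous_intros)
    have part: "(LINT x|lborel. V x $ i * D x $ j) = - (LINT x|lborel. W x $ i $ j * \<phi> x)" for j
    proof -
      note w = weak_gradD[OF G \<phi> D, of i j]
      have "(LINT x|lebesgue_on \<Omega>. v x $ i * D x $ j) = (LINT x|lborel. V x $ i * D x $ j)"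
        by (rule lebesgue_on_transfer(2)[OF borel_measurable_integrable[OF w(1)] \<Omega>])
          (use V(2,3) Vi D_j in \<open>auto elim: eventually_mono\<close>)
      moreover have "(\<lambda>x. W x $ i $ j) \<in> borel_measurable borel"
        by (rule borel_measurable_continuous_on[OF _ Wi]) (intro continuous_intros)
      then have "(LINT x|lebesgue_on \<Omega>. G x $ i $ j * \<phi> x) = (LINT x|lborel. W x $ i $ j * \<phi> x)"
        by (intro lebesgue_on_transfer(2)[OF borel_measurable_integrable[OF w(2)] \<Omega>])
          (use W(2,3) \<phi>m in \<open>auto elim: eventually_mono\<close>)
      ultimately show ?thesis using w(3) by simp
    qed
    have i1: "integrable lborel (\<lambda>x. V x $ i * D x $ j)" for j
    proof (rule integrable_mult_bounded[OF Vint])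
      show "(\<lambda>x. D x $ j) \<in> borel_measurable lborel" using D_j by simp
      show "\<bar>D x $ j\<bar> \<le> N" for x unfolding D_eq by (rule order_trans[OF component_le_norm_cart D'(3)])
    qed
    have i2: "integrable lborel (\<lambda>x. W x $ i $ j * \<phi> x)" for j
      by (rule integrable_mult_bounded[OF integrable_bounded_linear[OF bounded_linear_vec_nth Wint] _ M])
        (use \<phi>m in simp)
    have "(LINT x|lborel. V x $ i * inner (D x) h) = (LINT x|lborel. (\<Sum>j\<in>UNIV. h $ j * (V x $ i * D x $ j)))"
      by (simp add: inner_vec_def sum_distrib_left mult_ac)
    also have "\<dots> = (\<Sum>j\<in>UNIV. h $ j * (LINT x|lborel. V x $ i * D x $ j))"
      using i1 by (simp add: Bochner_Integration.integral_sum)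
    also have "\<dots> = - (\<Sum>j\<in>UNIV. h $ j * (LINT x|lborel. W x $ i $ j * \<phi> x))"
      by (simp add: part sum_negf)
    also have "(\<Sum>j\<in>UNIV. h $ j * (LINT x|lborel. W x $ i $ j * \<phi> x)) = (LINT x|lborel. (\<Sum>j\<in>UNIV. h $ j * (W x $ i $ j * \<phi> x)))"
      using i2 by (simp add: Bochner_Integration.integral_sum)
    also have "\<dots> = (LINT x|lborel. inner (W x $ i) h * \<phi> x)"
      by (simp add: inner_vec_def sum_distrib_left sum_distrib_right mult_ac)
    finally show ?thesis .
  qed
  then show ?thesis unfolding sobolev_pair_def using Vi Wi Vi2 Wi2 V(2) W(2) by auto
qed

lemma sobolev12_wgrad:
  assumes op: "open \<Omega>" and s: "sobolev12 \<Omega> v"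
  shows "weak_grad \<Omega> v (wgrad \<Omega> v)" "integrable (lebesgue_on \<Omega>) (\<lambda>x. (norm (v x))\<^sup>2)"
    "integrable (lebesgue_on \<Omega>) (\<lambda>x. (norm (wgrad \<Omega> v x))\<^sup>2)"
proof -
  obtain G where G: "weak_grad \<Omega> v G" "integrable (lebesgue_on \<Omega>) (\<lambda>x. (norm (v x))\<^sup>2)"
      "integrable (lebesgue_on \<Omega>) (\<lambda>x. (norm (G x))\<^sup>2)" using s unfolding sobolev12_def by blast
  show w: "weak_grad \<Omega> v (wgrad \<Omega> v)" by (rule weak_grad_wgrad[OF G(1)])
  show "integrable (lebesgue_on \<Omega>) (\<lambda>x. (norm (v x))\<^sup>2)" by (rule G(2))
  have "AE x in lebesgue_on \<Omega>. (norm (wgrad \<Omega> v x))\<^sup>2 = (norm (G x))\<^sup>2"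
    using wgrad_AE_eq[OF op G(1)] by eventually_elim simp
  then show "integrable (lebesgue_on \<Omega>) (\<lambda>x. (norm (wgrad \<Omega> v x))\<^sup>2)"
    using G(1,3) w unfolding weak_grad_def by (subst integrable_cong_AE) auto
qed

text \<open>\<open>rellich\<close> is applied to each component of the normalised sequence. Its two
  inputs are the assumed gradient bound and the vanishing of ball averages, the latter from the Gram
  matrix \<open>B\<close> in the inner product of the Sobolev space.\<close>

lemma weak_conv_zero_strong_L2:
  fixes v :: "nat \<Rightarrow> real^'d \<Rightarrow> real^'m"
  assumes dom: "C1_domain \<Omega>" and weak: "weak_conv_zero_W12 \<Omega> v"
    and C: "\<And>n. (LINT x|lebesgue_on \<Omega>. (norm (wgrad \<Omega> (v n) x))\<^sup>2) \<le> C"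
  shows "(\<lambda>n. LINT x|lebesgue_on \<Omega>. (norm (v n x))\<^sup>2) \<longlonglongrightarrow> 0"
proof -
  have op: "open \<Omega>" and bd: "bounded \<Omega>" using dom by (auto simp: C1_domain_def)
  have \<Omega>: "\<Omega> \<in> sets borel" using op by simp
  have s12: "sobolev12 \<Omega> (v n)" for n using weak by (simp add: weak_conv_zero_W12_def)
  note sw = sobolev12_wgrad[OF op s12]
  have vm: "v n \<in> borel_measurable (lebesgue_on \<Omega>)" and Gm: "wgrad \<Omega> (v n) \<in> borel_measurable (lebesgue_on \<Omega>)" for n
    using sw(1)[of n] by (auto simp: weak_grad_def)
  have "\<forall>n. \<exists>g. g \<in> borel_measurable borel \<and> (\<forall>x. x \<notin> \<Omega> \<longrightarrow> g x = 0) \<and> (AE x in lebesgue_on \<Omega>. v n x = g x)"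
    using borel_version_euclidean[OF vm \<Omega>] by blast
  from choice[OF this] obtain V where V: "\<And>n. V n \<in> borel_measurable borel" "\<And>n x. x \<notin> \<Omega> \<Longrightarrow> V n x = 0"
    "\<And>n. AE x in lebesgue_on \<Omega>. v n x = V n x" by blast
  have "\<forall>n. \<exists>g. g \<in> borel_measurable borel \<and> (\<forall>x. x \<notin> \<Omega> \<longrightarrow> g x = 0) \<and> (AE x in lebesgue_on \<Omega>. wgrad \<Omega> (v n) x = g x)"
    using borel_version_euclidean[OF Gm \<Omega>] by blast
  from choice[OF this] obtain W where W: "\<And>n. W n \<in> borel_measurable borel" "\<And>n x. x \<notin> \<Omega> \<Longrightarrow> W n x = 0"
    "\<And>n. AE x in lebesgue_on \<Omega>. wgrad \<Omega> (v n) x = W n x" by blast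
  have tV: "(LINT x|lebesgue_on \<Omega>. inner (v n x) (v k x)) = (LINT x|lborel. inner (V n x) (V k x))" for n k
  proof (rule lebesgue_on_transfer(2)[OF _ \<Omega>])
    show "AE x in lebesgue_on \<Omega>. inner (v n x) (v k x) = inner (V n x) (V k x)"
      using V(3)[of n] V(3)[of k] by eventually_elim simp
  qed (use vm V in auto)
  have tW: "(LINT x|lebesgue_on \<Omega>. inner (wgrad \<Omega> (v n) x) (wgrad \<Omega> (v k) x)) = (LINT x|lborel. inner (W n x) (W k x))" for n k
  proof (rule lebesgue_on_transfer(2)[OF _ \<Omega>])
    show "AE x in lebesgue_on \<Omega>. inner (wgrad \<Omega> (v n) x) (wgrad \<Omega> (v k) x) = inner (W n x) (W k x)"
      using W(3)[of n] W(3)[of k] by eventually_elim simp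
  qed (use Gm W in auto)
  have tV2: "(LINT x|lebesgue_on \<Omega>. (norm (v n x))\<^sup>2) = (LINT x|lborel. (norm (V n x))\<^sup>2)" for n
    using tV[of n n] by (simp add: power2_norm_eq_inner)
  have tW2: "(LINT x|lebesgue_on \<Omega>. (norm (wgrad \<Omega> (v n) x))\<^sup>2) = (LINT x|lborel. (norm (W n x))\<^sup>2)" for n
    using tW[of n n] by (simp add: power2_norm_eq_inner)
  have V2: "integrable lborel (\<lambda>x. (norm (V n x))\<^sup>2)" for n
  proof (subst lebesgue_on_transfer(1)[OF _ \<Omega>, symmetric])
    show "AE x in lebesgue_on \<Omega>. (norm (v n x))\<^sup>2 = (norm (V n x))\<^sup>2" using V(3)[of n] by eventually_elim simp
    show "integrable (lebesgue_on \<Omega>) (\<lambda>x. (norm (v n x))\<^sup>2)" by (rule sw(2))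
  qed (use vm V in auto)
  have W2: "integrable lborel (\<lambda>x. (norm (W n x))\<^sup>2)" for n
  proof (subst lebesgue_on_transfer(1)[OF _ \<Omega>, symmetric])
    show "AE x in lebesgue_on \<Omega>. (norm (wgrad \<Omega> (v n) x))\<^sup>2 = (norm (W n x))\<^sup>2" using W(3)[of n] by eventually_elim simp
    show "integrable (lebesgue_on \<Omega>) (\<lambda>x. (norm (wgrad \<Omega> (v n) x))\<^sup>2)" by (rule sw(3))
  qed (use Gm W in auto)
  define N where "N n = (LINT x|lborel. (norm (V n x))\<^sup>2)" for n
  have N0: "N n \<ge> 0" for n by (simp add: N_def)
  have C0: "C \<ge> 0" by (rule order_trans[OF _ C[of 0]]) simp
  \<comment> \<open>Brings the norm in L2 to at most 1 and never enlarges a function; as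
    \<open>c n \<le> 1\<close>, the gradient bound and the limits of the Gram entries
    survive.\<close>
  define c where "c n = 1 / sqrt (max 1 (N n))" for n
  have c0: "c n > 0" "c n \<le> 1" for n by (auto simp: c_def)
  have c2: "(c n)\<^sup>2 = 1 / max 1 (N n)" for n by (simp add: c_def power_divide)
  have cN: "(c n)\<^sup>2 * N n \<le> 1" for n using N0[of n] by (simp add: c2 max_def)
  have cC: "(c n)\<^sup>2 * (LINT x|lborel. (norm (W n x))\<^sup>2) \<le> C" for n
  proof -
    have "(c n)\<^sup>2 \<le> 1" using c0[of n] by (simp add: power_le_one)
    moreover have "0 \<le> (LINT x|lborel. (norm (W n x))\<^sup>2)" by simp
    ultimately have "(c n)\<^sup>2 * (LINT x|lborel. (norm (W n x))\<^sup>2) \<le> 1 * (LINT x|lborel. (norm (W n x))\<^sup>2)"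
      by (rule mult_right_mono)
    then show ?thesis using C[of n] tW2[of n] by simp
  qed
  define B where "B n k = c n * c k * W12_inner \<Omega> (v n) (v k)" for n k
  have Bsym: "B n k = B k n" for n k by (simp add: B_def W12_inner_def inner_commute mult.commute)
  \<comment> \<open>The weak convergence is tested against the members \<open>v k\<close> of the
    sequence itself, which are admissible elements.\<close>
  have Blim: "(\<lambda>n. B n k) \<longlonglongrightarrow> 0" for k
  proof (rule Lim_null_comparison[where g="\<lambda>n. \<bar>W12_inner \<Omega> (v n) (v k)\<bar>"])
    show "\<forall>\<^sub>F n in sequentially. norm (B n k) \<le> \<bar>W12_inner \<Omega> (v n) (v k)\<bar>"
    proof (intro always_eventually allI)
      fix n
      have "\<bar>c n * c k\<bar> \<le> 1" using c0[of n] c0[of k] by (simp add: abs_mult mult_le_one)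
      then show "norm (B n k) \<le> \<bar>W12_inner \<Omega> (v n) (v k)\<bar>" by (simp add: B_def abs_mult mult_left_le_one_le)
    qed
    have "(\<lambda>n. W12_inner \<Omega> (v n) (v k)) \<longlonglongrightarrow> 0"
      using weak s12[of k] unfolding weak_conv_zero_W12_def by blast
    then show "(\<lambda>n. \<bar>W12_inner \<Omega> (v n) (v k)\<bar>) \<longlonglongrightarrow> 0" by (rule tendsto_rabs_zero)
  qed
  have Beq: "B n k = c n * c k * (LINT x|lborel. inner (V n x) (V k x)) + c n * c k * (LINT x|lborel. inner (W n x) (W k x))" for n k
    by (simp add: B_def W12_inner_def tV tW distrib_left)
  have Bdiag: "B n n \<le> 1 + C" for n
    using cN[of n] cC[of n] by (simp add: Beq power2_norm_eq_inner N_def power2_eq_square[of "c n"])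
  define u where "u i n x = c n * V n x $ i" for i n x
  define g where "g i n x = c n *\<^sub>R W n x $ i" for i n x
  have pair: "sobolev_pair \<Omega> (u i n) (g i n)" for i n
    unfolding u_def[abs_def] g_def[abs_def]
    by (rule sobolev_pair_scale, rule sobolev_pair_component[OF op sw(1) V(1,2,3) W(1,2,3) V2 W2 bd])
  \<comment> \<open>Cauchy-Schwarz on the ball gives the constant \<open>K\<close>. The Gram sum
    dominates the squared norm of \<open>?S\<close> because its gradient part is a square and may be
    dropped.\<close>
  have wk: "(\<lambda>n. LINT x:ball z r|lborel. u i n x) \<longlonglongrightarrow> 0" for i z r
  proof (rule weakly_null_functional[OF Bsym Blim Bdiag, where K="measure lborel (ball z r)"])
    fix J :: "nat set" assume J: "finite J"
    let ?S = "\<lambda>x. \<Sum>j\<in>J. c j *\<^sub>R V j x"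
    have uint: "integrable lborel (u i n)" for n by (rule sobolev_pair_integrable(1)[OF pair bd op])
    have Si: "(\<Sum>j\<in>J. u i j x) = ?S x $ i" for x by (simp add: u_def)
    have gV: "integrable lborel (\<lambda>x. (norm (?S x))\<^sup>2)"
      "(LINT x|lborel. (norm (?S x))\<^sup>2) = (\<Sum>j\<in>J. \<Sum>k\<in>J. c j * c k * (LINT x|lborel. inner (V j x) (V k x)))"
      using gram_expansion[of V lborel c J] V(1) V2 by simp_all
    have gW: "(LINT x|lborel. (norm (\<Sum>j\<in>J. c j *\<^sub>R W j x))\<^sup>2) = (\<Sum>j\<in>J. \<Sum>k\<in>J. c j * c k * (LINT x|lborel. inner (W j x) (W k x)))"
      using gram_expansion(2)[of W lborel c J] W(1) W2 by simp
    have Sm: "(\<lambda>x. \<Sum>j\<in>J. u i j x) \<in> borel_measurable lborel"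
      using uint by (intro borel_measurable_sum borel_measurable_integrable)
    have S2: "((\<Sum>j\<in>J. u i j x))\<^sup>2 \<le> (norm (?S x))\<^sup>2" for x
    proof -
      have "\<bar>?S x $ i\<bar> \<le> norm (?S x)" by (rule component_le_norm_cart)
      from power_mono[OF this, of 2] show ?thesis unfolding Si by simp
    qed
    have S2i: "integrable lborel (\<lambda>x. (\<Sum>j\<in>J. u i j x)\<^sup>2)"
      by (rule Bochner_Integration.integrable_bound[OF gV(1)]) (use Sm S2 in auto)
    have ind: "set_integrable lborel (ball z r) (u i j)" for j
      using integrable_mult_indicator[OF _ uint[of j], of "ball z r"] by (simp add: set_integrable_def)
    have "(\<Sum>j\<in>J. LINT x:ball z r|lborel. u i j x) = (LINT x:ball z r|lborel. (\<Sum>j\<in>J. u i j x))"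
      using ind unfolding set_lebesgue_integral_def set_integrable_def
      by (simp add: sum_distrib_left Bochner_Integration.integral_sum)
    then have "(\<Sum>j\<in>J. LINT x:ball z r|lborel. u i j x)\<^sup>2 = (LINT x:ball z r|lborel. (\<Sum>j\<in>J. u i j x))\<^sup>2" by simp
    also have "\<dots> \<le> measure lborel (ball z r) * (LINT x:ball z r|lborel. (\<Sum>j\<in>J. u i j x)\<^sup>2)"
    proof (rule set_integral_square_le(2)[OF _ _ Sm])
      show "set_integrable lborel (ball z r) (\<lambda>x. (\<Sum>j\<in>J. u i j x)\<^sup>2)"
        using integrable_mult_indicator[OF _ S2i, of "ball z r"] by (simp add: set_integrable_def)
    qed (use emeasure_lborel_ball_finite[of z r] in auto)
    also have "\<dots> \<le> measure lborel (ball z r) * (LINT x|lborel. (norm (?S x))\<^sup>2)"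
    proof (rule mult_left_mono)
      show "(LINT x:ball z r|lborel. (\<Sum>j\<in>J. u i j x)\<^sup>2) \<le> (LINT x|lborel. (norm (?S x))\<^sup>2)"
        unfolding set_lebesgue_integral_def
        by (rule integral_mono_AE'[OF gV(1)]) (use S2 in \<open>auto simp: indicator_def\<close>)
    qed simp
    also have "\<dots> \<le> measure lborel (ball z r) * (\<Sum>j\<in>J. \<Sum>k\<in>J. B j k)"
    proof (rule mult_left_mono)
      have "0 \<le> (LINT x|lborel. (norm (\<Sum>j\<in>J. c j *\<^sub>R W j x))\<^sup>2)" by simp
      then show "(LINT x|lborel. (norm (?S x))\<^sup>2) \<le> (\<Sum>j\<in>J. \<Sum>k\<in>J. B j k)"
        unfolding gV(2) gW Beq sum.distrib by linarith
    qed simp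
    finally show "(\<Sum>j\<in>J. LINT x:ball z r|lborel. u i j x)\<^sup>2 \<le> measure lborel (ball z r) * (\<Sum>j\<in>J. \<Sum>k\<in>J. B j k)" .
  qed simp
  have comp_le: "(LINT x|lborel. (u i n x)\<^sup>2) \<le> (c n)\<^sup>2 * N n" for i n
  proof -
    have "(LINT x|lborel. (u i n x)\<^sup>2) \<le> (LINT x|lborel. (c n)\<^sup>2 * (norm (V n x))\<^sup>2)"
    proof (rule integral_mono_AE')
      show "AE x in lborel. (u i n x)\<^sup>2 \<le> (c n)\<^sup>2 * (norm (V n x))\<^sup>2"
      proof (rule AE_I2)
        fix x
        have "\<bar>V n x $ i\<bar> \<le> norm (V n x)" by (rule component_le_norm_cart)
        from power_mono[OF this, of 2] show "(u i n x)\<^sup>2 \<le> (c n)\<^sup>2 * (norm (V n x))\<^sup>2"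
          by (simp add: u_def power_mult_distrib mult_left_mono)
      qed
    qed (use V2 in auto)
    then show ?thesis by (simp add: N_def)
  qed
  have grad_le: "(LINT x|lborel. (norm (g i n x))\<^sup>2) \<le> C" for i n
  proof -
    have "(LINT x|lborel. (norm (g i n x))\<^sup>2) \<le> (LINT x|lborel. (c n)\<^sup>2 * (norm (W n x))\<^sup>2)"
    proof (rule integral_mono_AE')
      show "AE x in lborel. (norm (g i n x))\<^sup>2 \<le> (c n)\<^sup>2 * (norm (W n x))\<^sup>2"
      proof (rule AE_I2)
        fix x
        have "norm (W n x $ i) \<le> norm (W n x)" by (rule Finite_Cartesian_Product.norm_nth_le)
        from power_mono[OF this, of 2] show "(norm (g i n x))\<^sup>2 \<le> (c n)\<^sup>2 * (norm (W n x))\<^sup>2"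
          by (simp add: g_def power_mult_distrib mult_left_mono)
      qed
    qed (use W2 in auto)
    then show ?thesis using cC[of n] by simp
  qed
  have "(\<lambda>n. LINT x|lborel. (u i n x)\<^sup>2) \<longlonglongrightarrow> 0" for i
  proof (rule rellich[OF pair dom])
    show "(LINT x|lborel. (u i n x)\<^sup>2) \<le> 1 + C" for n using comp_le[of i n] cN[of n] C0 by linarith
    show "(LINT x|lborel. (norm (g i n x))\<^sup>2) \<le> 1 + C" for n using grad_le[of i n] by linarith
  qed (rule wk)
  then have "(\<lambda>n. \<Sum>i\<in>UNIV. LINT x|lborel. (u i n x)\<^sup>2) \<longlonglongrightarrow> (\<Sum>i\<in>(UNIV::'m set). 0)"
    by (intro tendsto_sum)
  moreover have "(\<Sum>i\<in>UNIV. LINT x|lborel. (u i n x)\<^sup>2) = N n / max 1 (N n)" for n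
  proof -
    have i: "integrable lborel (\<lambda>x. (u i n x)\<^sup>2)" for i using pair[of i n] by (simp add: sobolev_pair_def)
    have "(\<Sum>i\<in>UNIV. LINT x|lborel. (u i n x)\<^sup>2) = (LINT x|lborel. (\<Sum>i\<in>UNIV. (u i n x)\<^sup>2))"
      by (rule Bochner_Integration.integral_sum[symmetric]) (rule i)
    also have "(\<lambda>x. \<Sum>i\<in>UNIV. (u i n x)\<^sup>2) = (\<lambda>x. (c n)\<^sup>2 * (norm (V n x))\<^sup>2)"
      by (simp add: u_def power_mult_distrib power2_norm_eq_inner inner_vec_def sum_distrib_left)
        (simp add: power2_eq_square)
    finally show ?thesis by (simp add: N_def[symmetric] c2)
  qed
  ultimately have lim: "(\<lambda>n. N n / max 1 (N n)) \<longlonglongrightarrow> 0" by simp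
  \<comment> \<open>A quotient below 1 forces \<open>N n < 1\<close>, so the normalisation is
    eventually trivial and the limit passes to \<open>N\<close> itself.\<close>
  then have "eventually (\<lambda>n. N n / max 1 (N n) < 1) sequentially" by (rule order_tendstoD(2)) simp
  then have "eventually (\<lambda>n. N n / max 1 (N n) = N n) sequentially"
    by eventually_elim (auto simp: max_def split: if_splits)
  then have "N \<longlonglongrightarrow> 0" using lim by (rule Lim_transform_eventually[rotated])
  then show ?thesis unfolding tV2 N_def .
qed

section \<open>Localisation of the energy\<close>

lemma bounded_bilinear_tens_app: "bounded_bilinear (tens_app :: real^'d^'m^'d^'m \<Rightarrow> real^'d^'m \<Rightarrow> real^'d^'m)"
proof -
  have "bilinear (tens_app :: real^'d^'m^'d^'m \<Rightarrow> real^'d^'m \<Rightarrow> real^'d^'m)"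
    unfolding bilinear_def linear_iff tens_app_def
    by (simp add: vec_eq_iff sum.distrib distrib_left distrib_right sum_distrib_left mult_ac)
  then show ?thesis by (simp add: bilinear_conv_bounded_bilinear)
qed

lemma tens_app_form_bound:
  "\<exists>K>0. \<forall>(T :: real^'d^'m^'d^'m) F G. \<bar>inner (tens_app T F) G\<bar> \<le> norm T * K * norm F * norm G"
proof -
  obtain K where K: "K > 0" "\<And>(T :: real^'d^'m^'d^'m) F. norm (tens_app T F) \<le> norm T * norm F * K"
    using bounded_bilinear.pos_bounded[OF bounded_bilinear_tens_app] by blast
  have "\<bar>inner (tens_app T F) G\<bar> \<le> norm T * K * norm F * norm G" for T :: "real^'d^'m^'d^'m" and F G
  proof -
    have "\<bar>inner (tens_app T F) G\<bar> \<le> norm (tens_app T F) * norm G" by (rule Cauchy_Schwarz_ineq2)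
    also have "\<dots> \<le> (norm T * norm F * K) * norm G" by (rule mult_right_mono[OF K(2)]) simp
    finally show ?thesis by (simp add: mult_ac)
  qed
  then show ?thesis using K(1) by blast
qed

lemma Fden_continuous:
  assumes "continuous_on UNIV (U x)"
  shows "continuous_on UNIV (Fden U L x a)"
  unfolding Fden_def
  by (intro continuous_intros continuous_on_compose2[OF assms]
      bounded_linear.continuous_on[OF bounded_bilinear.bounded_linear_right[OF bounded_bilinear_tens_app]]) auto

text \<open>A bound on \<open>a *\<^sub>R G\<close> confines the argument of \<open>U\<close> to a
  compact ball, so the growth is quadratic uniformly in \<open>a\<close>.\<close>

lemma Fden_growth:
  fixes U :: "real^'d \<Rightarrow> real^'d^'m \<Rightarrow> real"
  assumes "continuous_on UNIV (U x)"
  shows "\<exists>S. \<forall>a G. norm (a *\<^sub>R G) \<le> C \<longrightarrow> \<bar>Fden U L x a G\<bar> \<le> S * (norm G)\<^sup>2"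
proof -
  obtain K where K: "K > 0" "\<And>(T :: real^'d^'m^'d^'m) F G. \<bar>inner (tens_app T F) G\<bar> \<le> norm T * K * norm F * norm G"
    using tens_app_form_bound by blast
  have "compact (U x ` cball 0 C)" by (intro compact_continuous_image compact_cball continuous_on_subset[OF assms]) simp
  then obtain S where S: "\<And>F. F \<in> cball 0 C \<Longrightarrow> \<bar>U x F\<bar> \<le> S"
    by (fastforce dest!: compact_imp_bounded simp: bounded_iff)
  have "\<bar>Fden U L x a G\<bar> \<le> (S + norm (L x) * K) * (norm G)\<^sup>2" if "norm (a *\<^sub>R G) \<le> C" for a G
  proof -
    have "\<bar>U x (a *\<^sub>R G)\<bar> * (norm G)\<^sup>2 \<le> S * (norm G)\<^sup>2" using S[of "a *\<^sub>R G"] that by (intro mult_right_mono) auto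
    moreover have "\<bar>inner (tens_app (L x) G) G\<bar> \<le> norm (L x) * K * (norm G)\<^sup>2"
      using K(2)[of "L x" G G] by (simp add: power2_eq_square mult_ac)
    ultimately show ?thesis unfolding Fden_def
      using abs_triangle_ineq[of "U x (a *\<^sub>R G) * (norm G)\<^sup>2" "1/2 * inner (tens_app (L x) G) G"]
      by (simp add: abs_mult distrib_right)
  qed
  then show ?thesis by blast
qed

text \<open>Where \<open>a |H|\<close> is not small, \<open>|G| \<le> C/a\<close> is controlled by \<open>|H|\<close>; hence no smallness of \<open>a H\<close> itself is needed.\<close>

lemma Fden_perturbation:
  fixes U :: "real^'d \<Rightarrow> real^'d^'m \<Rightarrow> real"
  assumes cont: "continuous_on UNIV (U x)" and \<epsilon>: "\<epsilon> > 0" and C: "C \<ge> 0"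
  shows "\<exists>K. \<forall>a>0. \<forall>G H. norm (a *\<^sub>R G) \<le> C \<longrightarrow> norm (a *\<^sub>R H) \<le> C \<longrightarrow>
    \<bar>Fden U L x a (G + H) - Fden U L x a G\<bar> \<le> \<epsilon> * (norm G)\<^sup>2 + K * (norm H)\<^sup>2"
proof -
  obtain K0 where K0: "K0 > 0" "\<And>(T :: real^'d^'m^'d^'m) F G. \<bar>inner (tens_app T F) G\<bar> \<le> norm T * K0 * norm F * norm G"
    using tens_app_form_bound by blast
  define \<Lambda> where "\<Lambda> = norm (L x) * K0"
  have \<Lambda>: "\<Lambda> \<ge> 0" "\<And>F G. \<bar>inner (tens_app (L x) F) G\<bar> \<le> \<Lambda> * norm F * norm G"
    using K0 by (auto simp: \<Lambda>_def)
  \<comment> \<open>Radius \<open>2 * C\<close>, because \<open>U\<close> is also evaluated at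
    \<open>a *\<^sub>R (G + H)\<close>.\<close>
  have contc: "continuous_on (cball 0 (2 * C)) (U x)" by (rule continuous_on_subset[OF cont]) simp
  have "compact (U x ` cball 0 (2 * C))" by (intro compact_continuous_image compact_cball contc)
  then obtain S where S: "\<And>F. F \<in> cball 0 (2 * C) \<Longrightarrow> \<bar>U x F\<bar> \<le> S"
    by (fastforce dest!: compact_imp_bounded simp: bounded_iff)
  have S0: "S \<ge> 0" using S[of 0] C by simp
  have "uniformly_continuous_on (cball 0 (2 * C)) (U x)"
    by (rule compact_uniformly_continuous[OF contc compact_cball])
  then obtain \<delta> where \<delta>: "\<delta> > 0" "\<And>F F'. F \<in> cball 0 (2 * C) \<Longrightarrow> F' \<in> cball 0 (2 * C) \<Longrightarrow> dist F' F < \<delta> \<Longrightarrow> dist (U x F') (U x F) < \<epsilon> / 2"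
    unfolding uniformly_continuous_on_def using \<epsilon> by (metis half_gt_zero)
  define A where "A = S + \<Lambda>"
  have A0: "A \<ge> 0" using S0 \<Lambda> by (simp add: A_def)
  \<comment> \<open>The first two terms absorb \<open>2 * g * h + h\<^sup>2\<close> by Young's
    inequality. The last belongs to the regime \<open>norm (a *\<^sub>R H) \<ge> \<delta>\<close>,
    where \<open>norm G \<le> C / \<delta> * norm H\<close>.\<close>
  define K where "K = A + 2 * A\<^sup>2 / \<epsilon> + S * ((C / \<delta> + 1)\<^sup>2 + (C / \<delta>)\<^sup>2)"
  have "\<bar>Fden U L x a (G + H) - Fden U L x a G\<bar> \<le> \<epsilon> * (norm G)\<^sup>2 + K * (norm H)\<^sup>2"
    if a: "a > 0" and G: "norm (a *\<^sub>R G) \<le> C" and H: "norm (a *\<^sub>R H) \<le> C" for a G H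
  proof -
    define g h where "g = norm G" and "h = norm H"
    have g0: "g \<ge> 0" and h0: "h \<ge> 0" by (auto simp: g_def h_def)
    have in1: "a *\<^sub>R G \<in> cball 0 (2 * C)" using G C by simp
    have in2: "a *\<^sub>R (G + H) \<in> cball 0 (2 * C)"
      using norm_triangle_ineq[of "a *\<^sub>R G" "a *\<^sub>R H"] G H by (simp add: scaleR_add_right)
    have sq: "(norm (G + H))\<^sup>2 \<le> (g + h)\<^sup>2" unfolding g_def h_def by (intro power_mono norm_triangle_ineq) simp
    have sqd: "\<bar>(norm (G + H))\<^sup>2 - g\<^sup>2\<bar> \<le> 2 * g * h + h\<^sup>2"
    proof -
      have "(norm (G + H))\<^sup>2 - g\<^sup>2 = 2 * inner G H + h\<^sup>2"
        by (simp add: g_def h_def power2_norm_eq_inner inner_add_left inner_add_right inner_commute)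
      moreover have "\<bar>inner G H\<bar> \<le> g * h" unfolding g_def h_def by (rule Cauchy_Schwarz_ineq2)
      ultimately show ?thesis using zero_le_power2[of h] by linarith
    qed
    \<comment> \<open>Half of \<open>\<epsilon>\<close> is spent on the cross term; the other half
      is left for the modulus of continuity of \<open>U\<close>.\<close>
    have young: "A * (2 * g * h) \<le> \<epsilon> / 2 * g\<^sup>2 + 2 * A\<^sup>2 / \<epsilon> * h\<^sup>2"
    proof -
      have "0 \<le> (\<epsilon> * g - 2 * A * h)\<^sup>2 / (2 * \<epsilon>)" using \<epsilon> by simp
      also have "\<dots> = \<epsilon> / 2 * g\<^sup>2 + 2 * A\<^sup>2 / \<epsilon> * h\<^sup>2 - A * (2 * g * h)"
        using \<epsilon> by (simp add: field_simps power2_eq_square)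
      finally show ?thesis by simp
    qed
    have quad: "\<bar>inner (tens_app (L x) (G + H)) (G + H) - inner (tens_app (L x) G) G\<bar> \<le> \<Lambda> * (2 * g * h + h\<^sup>2)"
    proof -
      have "inner (tens_app (L x) (G + H)) (G + H) - inner (tens_app (L x) G) G
          = inner (tens_app (L x) G) H + inner (tens_app (L x) H) G + inner (tens_app (L x) H) H"
        by (simp add: bounded_bilinear.add_right[OF bounded_bilinear_tens_app] inner_add_left inner_add_right)
      moreover have "\<bar>inner (tens_app (L x) G) H\<bar> \<le> \<Lambda> * (g * h)" "\<bar>inner (tens_app (L x) H) G\<bar> \<le> \<Lambda> * (g * h)"
        "\<bar>inner (tens_app (L x) H) H\<bar> \<le> \<Lambda> * h\<^sup>2"
        using \<Lambda>(2)[of G H] \<Lambda>(2)[of H G] \<Lambda>(2)[of H H] by (simp_all add: g_def h_def power2_eq_square mult_ac)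
      moreover have "\<Lambda> * (2 * g * h + h\<^sup>2) = \<Lambda> * (g * h) + \<Lambda> * (g * h) + \<Lambda> * h\<^sup>2" by (simp add: algebra_simps)
      ultimately show ?thesis by linarith
    qed
    define X where "X = U x (a *\<^sub>R (G + H)) * (norm (G + H))\<^sup>2 - U x (a *\<^sub>R G) * g\<^sup>2"
    have split: "\<bar>Fden U L x a (G + H) - Fden U L x a G\<bar> \<le> \<bar>X\<bar> + \<Lambda> * (2 * g * h + h\<^sup>2)"
    proof -
      have "Fden U L x a (G + H) - Fden U L x a G = X + 1/2 * (inner (tens_app (L x) (G + H)) (G + H) - inner (tens_app (L x) G) G)"
        by (simp add: Fden_def X_def g_def algebra_simps)
      moreover have "\<bar>X + 1/2 * q\<bar> \<le> \<bar>X\<bar> + c" if "\<bar>q\<bar> \<le> c" for q c using that by linarith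
      ultimately show ?thesis using quad by simp
    qed
    have Xb: "\<bar>X\<bar> \<le> S * (2 * g * h + h\<^sup>2) + \<epsilon> / 2 * g\<^sup>2 + S * ((C / \<delta> + 1)\<^sup>2 + (C / \<delta>)\<^sup>2) * h\<^sup>2"
    proof (cases "norm (a *\<^sub>R H) < \<delta>")
      case True
      have "X = U x (a *\<^sub>R (G + H)) * ((norm (G + H))\<^sup>2 - g\<^sup>2) + (U x (a *\<^sub>R (G + H)) - U x (a *\<^sub>R G)) * g\<^sup>2"
        by (simp add: X_def algebra_simps)
      moreover have "\<bar>U x (a *\<^sub>R (G + H)) * ((norm (G + H))\<^sup>2 - g\<^sup>2)\<bar> \<le> S * (2 * g * h + h\<^sup>2)"
        unfolding abs_mult by (rule mult_mono[OF S[OF in2] sqd S0]) simp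
      moreover have "\<bar>(U x (a *\<^sub>R (G + H)) - U x (a *\<^sub>R G)) * g\<^sup>2\<bar> \<le> \<epsilon> / 2 * g\<^sup>2"
      proof -
        have "dist (a *\<^sub>R (G + H)) (a *\<^sub>R G) < \<delta>" using True by (simp add: dist_norm scaleR_add_right)
        from \<delta>(2)[OF in1 in2 this] have "\<bar>U x (a *\<^sub>R (G + H)) - U x (a *\<^sub>R G)\<bar> \<le> \<epsilon> / 2"
          by (simp add: dist_real_def)
        from mult_right_mono[OF this, of "g\<^sup>2"] show ?thesis by (simp add: abs_mult)
      qed
      moreover have "0 \<le> S * ((C / \<delta> + 1)\<^sup>2 + (C / \<delta>)\<^sup>2) * h\<^sup>2" using S0 by simp
      ultimately show ?thesis by linarith
    next
      case False
      have gh: "g \<le> C / \<delta> * h"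
      proof -
        have "\<delta> \<le> a * h" using False a by (simp add: h_def)
        then have "g * \<delta> \<le> g * (a * h)" using g0 by (rule mult_left_mono)
        also have "\<dots> = (a * g) * h" by simp
        also have "\<dots> \<le> C * h" using G a h0 by (intro mult_right_mono) (simp_all add: g_def)
        finally show ?thesis using \<delta>(1) by (simp add: field_simps)
      qed
      have gh': "g + h \<le> (C / \<delta> + 1) * h" using gh by (simp only: distrib_right mult_1)
      have g2: "g\<^sup>2 \<le> (C / \<delta>)\<^sup>2 * h\<^sup>2" "(g + h)\<^sup>2 \<le> (C / \<delta> + 1)\<^sup>2 * h\<^sup>2"
        using power_mono[OF gh g0, of 2] power_mono[OF gh', of 2] g0 h0 by (simp_all only: power_mult_distrib add_nonneg_nonneg)
      have "\<bar>U x (a *\<^sub>R (G + H)) * (norm (G + H))\<^sup>2\<bar> \<le> S * ((C / \<delta> + 1)\<^sup>2 * h\<^sup>2)"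
        using mult_mono[OF S[OF in2] order_trans[OF sq g2(2)] S0] by (simp add: abs_mult)
      moreover have "\<bar>U x (a *\<^sub>R G) * g\<^sup>2\<bar> \<le> S * ((C / \<delta>)\<^sup>2 * h\<^sup>2)"
        using mult_mono[OF S[OF in1] g2(1) S0] by (simp add: abs_mult)
      moreover have "0 \<le> S * (2 * g * h + h\<^sup>2)" "0 \<le> \<epsilon> / 2 * g\<^sup>2" using S0 g0 h0 \<epsilon> by simp_all
      moreover have "S * ((C / \<delta> + 1)\<^sup>2 + (C / \<delta>)\<^sup>2) * h\<^sup>2 = S * ((C / \<delta> + 1)\<^sup>2 * h\<^sup>2) + S * ((C / \<delta>)\<^sup>2 * h\<^sup>2)"
        by (simp add: algebra_simps)
      ultimately show ?thesis unfolding X_def by linarith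
    qed
    have "\<bar>X\<bar> + \<Lambda> * (2 * g * h + h\<^sup>2) \<le> A * (2 * g * h) + A * h\<^sup>2 + \<epsilon> / 2 * g\<^sup>2 + S * ((C / \<delta> + 1)\<^sup>2 + (C / \<delta>)\<^sup>2) * h\<^sup>2"
      using Xb by (simp add: A_def algebra_simps)
    also have "\<dots> \<le> \<epsilon> * g\<^sup>2 + K * h\<^sup>2" using young by (simp add: K_def algebra_simps)
    finally show ?thesis using split unfolding g_def h_def by linarith
  qed
  then show ?thesis by blast
qed

lemma Fden_integrable:
  fixes U :: "real^'d \<Rightarrow> real^'d^'m \<Rightarrow> real"
  assumes cont: "continuous_on UNIV (U x)" and G: "G \<in> borel_measurable M" "integrable M (\<lambda>y. (norm (G y))\<^sup>2)"
    and b: "AE y in M. norm (a *\<^sub>R G y) \<le> C"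
  shows "integrable M (\<lambda>y. Fden U L x a (G y))"
proof -
  obtain S where S: "\<And>a G. norm (a *\<^sub>R G) \<le> C \<Longrightarrow> \<bar>Fden U L x a G\<bar> \<le> S * (norm G)\<^sup>2"
    using Fden_growth[where U=U and x=x, OF cont] by blast
  show ?thesis
  proof (rule Bochner_Integration.integrable_bound)
    show "integrable M (\<lambda>y. S * (norm (G y))\<^sup>2)" using G(2) by simp
    show "(\<lambda>y. Fden U L x a (G y)) \<in> borel_measurable M"
      by (rule borel_measurable_continuous_on[OF Fden_continuous[where U=U and x=x, OF cont] G(1)])
    show "AE y in M. norm (Fden U L x a (G y)) \<le> norm (S * (norm (G y))\<^sup>2)"
      using b by eventually_elim (use S in \<open>fastforce\<close>)
  qed
qed

text \<open>\<open>\<epsilon>\<close> is fixed first, small against the bounded integrals of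
  \<open>(norm (G n y))\<^sup>2\<close>. The constant \<open>K0\<close>, which may be large for
  small \<open>\<epsilon>\<close>, then multiplies a null sequence.\<close>

lemma Fden_perturbation_integral:
  fixes U :: "real^'d \<Rightarrow> real^'d^'m \<Rightarrow> real" and G H :: "nat \<Rightarrow> 'a \<Rightarrow> real^'d^'m"
  assumes cont: "continuous_on UNIV (U x)" and a: "\<And>n. a n > 0"
    and G: "\<And>n. G n \<in> borel_measurable M" "\<And>n. integrable M (\<lambda>y. (norm (G n y))\<^sup>2)" "\<And>n. (LINT y|M. (norm (G n y))\<^sup>2) \<le> C'"
    and H: "\<And>n. H n \<in> borel_measurable M" "\<And>n. integrable M (\<lambda>y. (norm (H n y))\<^sup>2)" "(\<lambda>n. LINT y|M. (norm (H n y))\<^sup>2) \<longlonglongrightarrow> 0"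
    and bG: "\<And>n. AE y in M. norm (a n *\<^sub>R G n y) \<le> C" and bH: "\<And>n. AE y in M. norm (a n *\<^sub>R H n y) \<le> C" and C: "C \<ge> 0"
    and lim: "(\<lambda>n. LINT y|M. Fden U L x (a n) (G n y)) \<longlonglongrightarrow> l"
  shows "(\<lambda>n. LINT y|M. Fden U L x (a n) (G n y + H n y)) \<longlonglongrightarrow> l"
proof -
  have iG: "integrable M (\<lambda>y. Fden U L x (a n) (G n y))" for n
    by (rule Fden_integrable[where U=U and x=x, OF cont G(1,2) bG])
  have GH2: "integrable M (\<lambda>y. (norm (G n y + H n y))\<^sup>2)" for n
  proof (rule Bochner_Integration.integrable_bound)
    show "integrable M (\<lambda>y. 2 * (norm (G n y))\<^sup>2 + 2 * (norm (H n y))\<^sup>2)" using G(2) H(2) by simp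
    show "AE y in M. norm ((norm (G n y + H n y))\<^sup>2) \<le> norm (2 * (norm (G n y))\<^sup>2 + 2 * (norm (H n y))\<^sup>2)"
    proof (rule AE_I2)
      fix y
      have "(norm (G n y + H n y))\<^sup>2 \<le> (norm (G n y) + norm (H n y))\<^sup>2" by (intro power_mono norm_triangle_ineq) simp
      also have "\<dots> \<le> 2 * (norm (G n y))\<^sup>2 + 2 * (norm (H n y))\<^sup>2" by (rule square_sum_le)
      finally show "norm ((norm (G n y + H n y))\<^sup>2) \<le> norm (2 * (norm (G n y))\<^sup>2 + 2 * (norm (H n y))\<^sup>2)" by simp
    qed
  qed (use G(1) H(1) in simp)
  have iGH: "integrable M (\<lambda>y. Fden U L x (a n) (G n y + H n y))" for n
  proof (rule Fden_integrable[where U=U and x=x, OF cont _ GH2])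
    show "AE y in M. norm (a n *\<^sub>R (G n y + H n y)) \<le> C + C"
      using bG[of n] bH[of n] by eventually_elim (metis add_mono norm_triangle_le scaleR_add_right)
  qed (use G(1) H(1) in simp)
  have C': "C' \<ge> 0" by (rule order_trans[OF _ G(3)[of 0]]) simp
  have "(\<lambda>n. (LINT y|M. Fden U L x (a n) (G n y + H n y)) - (LINT y|M. Fden U L x (a n) (G n y))) \<longlonglongrightarrow> 0"
  proof (rule LIMSEQ_I)
    fix e :: real assume e: "e > 0"
    define \<epsilon> where "\<epsilon> = e / (2 * (C' + 1))"
    have \<epsilon>: "\<epsilon> > 0" using e C' by (simp add: \<epsilon>_def)
    obtain K0 where K0: "\<And>a G H. a > 0 \<Longrightarrow> norm (a *\<^sub>R G) \<le> C \<Longrightarrow> norm (a *\<^sub>R H) \<le> C \<Longrightarrow>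
       \<bar>Fden U L x a (G + H) - Fden U L x a G\<bar> \<le> \<epsilon> * (norm G)\<^sup>2 + K0 * (norm H)\<^sup>2"
      using Fden_perturbation[where U=U and x=x, OF cont \<epsilon> C] by blast
    have "(\<lambda>n. K0 * (LINT y|M. (norm (H n y))\<^sup>2)) \<longlonglongrightarrow> K0 * 0" by (rule tendsto_mult_left[OF H(3)])
    then have "eventually (\<lambda>n. K0 * (LINT y|M. (norm (H n y))\<^sup>2) < e / 2) sequentially"
      by (rule order_tendstoD(2)) (use e in simp)
    then obtain N where N: "\<And>n. n \<ge> N \<Longrightarrow> K0 * (LINT y|M. (norm (H n y))\<^sup>2) < e / 2" by (auto simp: eventually_sequentially)
    have "norm ((LINT y|M. Fden U L x (a n) (G n y + H n y)) - (LINT y|M. Fden U L x (a n) (G n y)) - 0) < e" if n: "n \<ge> N" for n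
    proof -
      have "norm ((LINT y|M. Fden U L x (a n) (G n y + H n y)) - (LINT y|M. Fden U L x (a n) (G n y)))
          = norm (LINT y|M. Fden U L x (a n) (G n y + H n y) - Fden U L x (a n) (G n y))"
        using iG iGH by simp
      also have "\<dots> \<le> (LINT y|M. norm (Fden U L x (a n) (G n y + H n y) - Fden U L x (a n) (G n y)))"
        by (rule integral_norm_bound)
      also have "\<dots> \<le> (LINT y|M. \<epsilon> * (norm (G n y))\<^sup>2 + K0 * (norm (H n y))\<^sup>2)"
      proof (rule integral_mono_AE)
        show "AE y in M. norm (Fden U L x (a n) (G n y + H n y) - Fden U L x (a n) (G n y)) \<le> \<epsilon> * (norm (G n y))\<^sup>2 + K0 * (norm (H n y))\<^sup>2"
          using bG[of n] bH[of n] by eventually_elim (use K0[OF a] in simp)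
      qed (use iG iGH G(2) H(2) in auto)
      also have "\<dots> = \<epsilon> * (LINT y|M. (norm (G n y))\<^sup>2) + K0 * (LINT y|M. (norm (H n y))\<^sup>2)"
        using G(2) H(2) by simp
      also have "\<epsilon> * (LINT y|M. (norm (G n y))\<^sup>2) \<le> \<epsilon> * C'" by (rule mult_left_mono[OF G(3)]) (use \<epsilon> in simp)
      also have "\<epsilon> * C' \<le> e / 2" using e C' by (simp add: \<epsilon>_def field_simps)
      finally show ?thesis using N[OF n] by simp
    qed
    then show "\<exists>N. \<forall>n\<ge>N. norm ((LINT y|M. Fden U L x (a n) (G n y + H n y)) - (LINT y|M. Fden U L x (a n) (G n y)) - 0) < e" by blast
  qed
  from tendsto_add[OF this lim] show ?thesis by simp
qed

section \<open>Limits supplied by the representation measures\<close>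

lemma repr_measuresD:
  assumes "repr_measures \<Omega> \<alpha> v s \<pi> \<mu> lam"
  shows "strict_mono s" "sets \<pi> = sets borel" "finite_measure \<pi>" "emeasure \<pi> (UNIV - closure \<Omega>) = 0"
    and "\<exists>R. \<forall>x\<in>closure \<Omega>. prob_space (\<mu> x) \<and> sets (\<mu> x) = sets borel \<and> emeasure (\<mu> x) (UNIV - cball 0 R) = 0"
    and "\<forall>x\<in>closure \<Omega>. prob_space (lam x) \<and> sets (lam x) = sets borel \<and> emeasure (lam x) (UNIV - sphere 0 1) = 0"
  using assms unfolding repr_measures_def Let_def by blast+

text \<open>The weak-star convergence is taken with test function 1, since the localisation will sit
  in the integrands \<open>U\<close> and \<open>L\<close>.\<close>

lemma repr_measures_limit:
  assumes rep: "repr_measures \<Omega> \<alpha> v s \<pi> \<mu> lam"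
    and U: "continuous_on (closure \<Omega> \<times> UNIV) (\<lambda>(x, F). U x F)" "\<And>x. x \<in> closure \<Omega> \<Longrightarrow> U x 0 = 0"
    and L: "continuous_on (closure \<Omega>) L"
  shows "set_integrable \<pi> (closure \<Omega>) (\<lambda>x. Ifun U L x (\<mu> x) (lam x))"
    and "(\<lambda>n. LINT x|lebesgue_on \<Omega>. Fden U L x (\<alpha> (s n)) (wgrad \<Omega> (v (s n)) x))
      \<longlonglongrightarrow> (LINT x:closure \<Omega>|\<pi>. Ifun U L x (\<mu> x) (lam x))"
proof -
  have all: "set_integrable \<pi> (closure \<Omega>) (\<lambda>x. Ifun U L x (\<mu> x) (lam x)) \<and>
        (\<forall>\<phi>. continuous_on (closure \<Omega>) \<phi> \<longrightarrow>
           (\<lambda>n. LINT x|lebesgue_on \<Omega>. \<phi> x * Fden U L x (\<alpha> (s n)) (wgrad \<Omega> (v (s n)) x))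
             \<longlonglongrightarrow> (LINT x:closure \<Omega>|\<pi>. \<phi> x * Ifun U L x (\<mu> x) (lam x)))"
    using rep U L unfolding repr_measures_def Let_def by blast
  then show "set_integrable \<pi> (closure \<Omega>) (\<lambda>x. Ifun U L x (\<mu> x) (lam x))" by blast
  have "continuous_on (closure \<Omega>) (\<lambda>x. 1 :: real)" by simp
  then have "(\<lambda>n. LINT x|lebesgue_on \<Omega>. 1 * Fden U L x (\<alpha> (s n)) (wgrad \<Omega> (v (s n)) x))
             \<longlonglongrightarrow> (LINT x:closure \<Omega>|\<pi>. 1 * Ifun U L x (\<mu> x) (lam x))"
    using all by (elim conjE allE[of _ "\<lambda>x. 1"]) blast
  then show "(\<lambda>n. LINT x|lebesgue_on \<Omega>. Fden U L x (\<alpha> (s n)) (wgrad \<Omega> (v (s n)) x))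
      \<longlonglongrightarrow> (LINT x:closure \<Omega>|\<pi>. Ifun U L x (\<mu> x) (lam x))" by simp
qed

text \<open>With \<open>U = 0\<close> and \<open>T\<close> the identity tensor the density is half
  the squared norm of the gradient; its integrals converge and are therefore bounded.\<close>

lemma repr_measures_gradient_bounded:
  fixes v :: "nat \<Rightarrow> real^'d \<Rightarrow> real^'m"
  assumes "repr_measures \<Omega> \<alpha> v s \<pi> \<mu> lam"
  shows "\<exists>C. \<forall>n. (LINT x|lebesgue_on \<Omega>. (norm (wgrad \<Omega> (v (s n)) x))\<^sup>2) \<le> C"
proof -
  define T :: "real^'d^'m^'d^'m" where "T = (\<chi> i j k l. if k = i \<and> l = j then 1 else 0)"
  have T: "tens_app T G = G" for G
  proof -
    have "(\<Sum>k\<in>UNIV. \<Sum>l\<in>UNIV. T $ i $ j $ k $ l * G $ k $ l) = (\<Sum>k\<in>UNIV. if k = i then G $ k $ j else 0)" for i j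
    proof (rule sum.cong[OF refl])
      fix k
      show "(\<Sum>l\<in>UNIV. T $ i $ j $ k $ l * G $ k $ l) = (if k = i then G $ k $ j else 0)"
        by (cases "k = i") (simp_all add: T_def if_distrib[of "\<lambda>x. x * _"] cong: if_cong)
    qed
    then show ?thesis by (simp add: tens_app_def vec_eq_iff)
  qed
  have "(\<lambda>n. LINT x|lebesgue_on \<Omega>. Fden (\<lambda>x F. 0) (\<lambda>x. T) x (\<alpha> (s n)) (wgrad \<Omega> (v (s n)) x))
      \<longlonglongrightarrow> (LINT x:closure \<Omega>|\<pi>. Ifun (\<lambda>x F. 0) (\<lambda>x. T) x (\<mu> x) (lam x))"
    by (rule repr_measures_limit(2)[OF assms]) auto
  then have "Bseq (\<lambda>n. LINT x|lebesgue_on \<Omega>. 1/2 * (norm (wgrad \<Omega> (v (s n)) x))\<^sup>2)"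
    by (intro convergent_imp_Bseq convergentI) (simp add: Fden_def T power2_norm_eq_inner)
  then obtain K where "\<And>n. norm (LINT x|lebesgue_on \<Omega>. 1/2 * (norm (wgrad \<Omega> (v (s n)) x))\<^sup>2) \<le> K"
    by (auto simp: Bseq_def)
  then have "(LINT x|lebesgue_on \<Omega>. (norm (wgrad \<Omega> (v (s n)) x))\<^sup>2) \<le> 2 * K" for n
    by (simp add: abs_le_iff) (metis (no_types) mult.commute pos_divide_le_eq zero_less_numeral)
  then show ?thesis by blast
qed

text \<open>The given bound concerns some weak gradient of the scaled function. The product rule
  with the constant cut-off \<open>a\<close>, together with uniqueness, transfers it to
  \<open>wgrad\<close>.\<close>

lemma wgrad_scaled_bound:
  fixes v :: "real^'d \<Rightarrow> real^'m"
  assumes op: "open \<Omega>" and v: "sobolev12 \<Omega> v" and G: "weak_grad \<Omega> (\<lambda>x. a *\<^sub>R v x) G"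
    and b: "AE x in lebesgue_on \<Omega>. norm (a *\<^sub>R v x) \<le> C \<and> norm (G x) \<le> C"
  shows "AE x in lebesgue_on \<Omega>. norm (a *\<^sub>R v x) \<le> C \<and> norm (a *\<^sub>R wgrad \<Omega> v x) \<le> C"
proof -
  have "smooth_fun (\<lambda>x :: real^'d. a)"
    by (rule smooth_fun_algebra[of "{}"]) (auto intro: fun_alg.const)
  then have "weak_grad \<Omega> (\<lambda>x. a *\<^sub>R v x) (\<lambda>x. a *\<^sub>R wgrad \<Omega> v x + (\<chi> i. v x $ i *\<^sub>R 0))"
    by (rule weak_grad_cutoff[OF op sobolev12_wgrad(1)[OF op v], where M="\<bar>a\<bar>" and D="\<lambda>x. 0"]) auto
  from weak_grad_unique[OF op this G] b show ?thesis
    by eventually_elim (simp add: vec_eq_iff[symmetric] zero_vec_def[symmetric])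
qed

lemma norm_tensor: "norm (\<chi> i. a $ i *\<^sub>R b) = norm (a :: real^'m) * norm (b :: real^'d)"
proof -
  have "(norm (\<chi> i. a $ i *\<^sub>R b))\<^sup>2 = (norm a * norm b)\<^sup>2"
    by (simp add: power_mult_distrib power2_norm_eq_inner inner_vec_def[where 'b='m] sum_distrib_right mult.assoc)
  then show ?thesis by (simp add: power2_eq_iff_nonneg)
qed

text \<open>To be used for an \<open>f\<close> that involves \<open>wgrad\<close>, whose values on
  the frontier are arbitrary. The frontier is null and Lebesgue measure is complete, so even the
  measurability of \<open>f\<close> is inherited from \<open>g\<close>.\<close>

lemma lebesgue_integral_closure_eq:
  fixes f g :: "'a::euclidean_space \<Rightarrow> real"
  assumes op: "open \<Omega>" and fr: "negligible (frontier \<Omega>)" and A: "A \<in> sets borel"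
    and g: "g \<in> borel_measurable (lebesgue_on \<Omega>)" and ae: "AE x in lebesgue_on \<Omega>. x \<in> A \<longrightarrow> f x = g x"
    and z: "\<And>x. x \<in> \<Omega> \<Longrightarrow> x \<notin> A \<Longrightarrow> g x = 0"
  shows "(LINT x|lebesgue_on (A \<inter> closure \<Omega>). f x) = (LINT x|lebesgue_on \<Omega>. g x)"
proof -
  have \<Omega>: "\<Omega> \<in> sets borel" using op by simp
  have gm: "(\<lambda>x. indicator \<Omega> x *\<^sub>R g x) \<in> borel_measurable lebesgue"
    using g \<Omega> borel_measurable_restrict_space_iff[of \<Omega> lebesgue g] by simp
  have "AE x in lebesgue. x \<notin> frontier \<Omega>"
    using fr unfolding negligible_iff_null_sets by (rule AE_not_in)
  moreover have "AE x in lebesgue. x \<in> \<Omega> \<longrightarrow> x \<in> A \<longrightarrow> f x = g x"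
    using ae by (subst (asm) AE_restrict_space_iff) (use \<Omega> in auto)
  ultimately have eq: "AE x in lebesgue. indicator \<Omega> x *\<^sub>R g x = indicator (A \<inter> closure \<Omega>) x *\<^sub>R f x"
  proof eventually_elim
    case (elim x)
    have "x \<in> closure \<Omega> \<longleftrightarrow> x \<in> \<Omega>"
      using elim(1) op closure_subset by (auto simp: frontier_def interior_open)
    then show ?case using elim(2) z[of x] by (auto simp: indicator_def)
  qed
  have fm: "(\<lambda>x. indicator (A \<inter> closure \<Omega>) x *\<^sub>R f x) \<in> borel_measurable lebesgue"
    by (rule borel_measurable_AE[OF gm eq])
  have "(LINT x|lebesgue_on (A \<inter> closure \<Omega>). f x) = (LINT x|lebesgue. indicator (A \<inter> closure \<Omega>) x *\<^sub>R f x)"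
    by (rule integral_restrict_space) (use A in simp)
  also have "\<dots> = (LINT x|lebesgue. indicator \<Omega> x *\<^sub>R g x)"
    by (rule integral_cong_AE[OF fm gm]) (use eq in eventually_elim, simp)
  also have "\<dots> = (LINT x|lebesgue_on \<Omega>. g x)"
    by (rule integral_restrict_space[symmetric]) (use \<Omega> in simp)
  finally show ?thesis .
qed

lemma cutoff_energy_limit:
  fixes v :: "nat \<Rightarrow> real^'d \<Rightarrow> real^'m" and U :: "real^'d \<Rightarrow> real^'d^'m \<Rightarrow> real"
  assumes dom: "C1_domain \<Omega>" and U: "continuous_on UNIV (U x0)" "U x0 0 = 0"
    and weak: "weak_conv_zero_W12 \<Omega> v" and apos: "\<And>n. \<alpha> n > 0"
    and bdd: "\<And>n. \<exists>G. weak_grad \<Omega> (\<lambda>x. \<alpha> n *\<^sub>R v n x) G \<and>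
                 (AE x in lebesgue_on \<Omega>. norm (\<alpha> n *\<^sub>R v n x) \<le> C \<and> norm (G x) \<le> C)"
    and rep: "repr_measures \<Omega> \<alpha> v s \<pi> \<mu> lam" and \<theta>: "test_fun (ball x0 r) \<theta>"
  shows "(\<lambda>n. LINT x|lebesgue_on (ball x0 r \<inter> closure \<Omega>).
            Fden U L x0 (\<alpha> (s n)) (wgrad \<Omega> (\<lambda>y. \<theta> y *\<^sub>R v (s n) y) x))
      \<longlonglongrightarrow> (LINT x:closure \<Omega>|\<pi>. Ifun (\<lambda>x F. (\<theta> x)\<^sup>2 * U x0 (\<theta> x *\<^sub>R F)) (\<lambda>x. (\<theta> x)\<^sup>2 *\<^sub>R L x0) x (\<mu> x) (lam x))"
proof -
  have op: "open \<Omega>" using dom by (simp add: C1_domain_def)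
  have \<Omega>: "\<Omega> \<in> sets borel" using op by simp
  let ?M = "lebesgue_on \<Omega>"
  have s: "strict_mono s" by (rule repr_measuresD(1)[OF rep])
  obtain C' where C': "\<And>n. (LINT x|?M. (norm (wgrad \<Omega> (v (s n)) x))\<^sup>2) \<le> C'"
    using repr_measures_gradient_bounded[OF rep] by blast
  have s12: "sobolev12 \<Omega> (v n)" for n using weak by (simp add: weak_conv_zero_W12_def)
  \<comment> \<open>The gradient bound is available along the subsequence, so strong convergence is
    proved along it as well.\<close>
  have weak_s: "weak_conv_zero_W12 \<Omega> (\<lambda>n. v (s n))"
    unfolding weak_conv_zero_W12_def
  proof (intro conjI allI impI)
    fix w :: "real^'d \<Rightarrow> real^'m" assume "sobolev12 \<Omega> w"
    then have "(\<lambda>n. W12_inner \<Omega> (v n) w) \<longlonglongrightarrow> 0" using weak by (simp add: weak_conv_zero_W12_def)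
    from LIMSEQ_subseq_LIMSEQ[OF this s] show "(\<lambda>n. W12_inner \<Omega> (v (s n)) w) \<longlonglongrightarrow> 0" by (simp add: o_def)
  qed (rule s12)
  have L2: "(\<lambda>n. LINT x|?M. (norm (v (s n) x))\<^sup>2) \<longlonglongrightarrow> 0"
    by (rule weak_conv_zero_strong_L2[OF dom weak_s C'])
  have bd: "AE x in ?M. norm (\<alpha> n *\<^sub>R v n x) \<le> C \<and> norm (\<alpha> n *\<^sub>R wgrad \<Omega> (v n) x) \<le> C" for n
    using bdd[of n] wgrad_scaled_bound[OF op s12[of n]] by blast
  note sw = sobolev12_wgrad[OF op s12]
  have vm: "v n \<in> borel_measurable ?M" and Wm: "wgrad \<Omega> (v n) \<in> borel_measurable ?M" for n
    using sw(1)[of n] by (auto simp: weak_grad_def)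
  have \<theta>s: "smooth_fun \<theta>" using \<theta> by (simp add: test_fun_def)
  have \<theta>c: "continuous_on UNIV \<theta>" by (rule smooth_fun_continuous[OF \<theta>s])
  obtain M where M: "\<And>x. \<bar>\<theta> x\<bar> \<le> M" using test_fun_bounded[OF \<theta>] by blast
  have M0: "M \<ge> 0" using M[of x0] by linarith
  obtain D N where D: "\<And>x. (\<theta> has_derivative (\<lambda>h. inner (D x) h)) (at x)" "continuous_on UNIV D"
    and Dz: "\<And>x. x \<notin> closure {x. \<theta> x \<noteq> 0} \<Longrightarrow> D x = 0" and N: "\<And>x. norm (D x) \<le> N"
    using test_fun_gradient[OF \<theta>] by blast
  have N0: "N \<ge> 0" by (rule order_trans[OF norm_ge_zero N[of x0]])
  have lb: "f \<in> borel_measurable ?M" if "continuous_on UNIV f" for f :: "real^'d \<Rightarrow> 'z::topological_space"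
    using borel_measurable_continuous_onI[OF that] by (simp add: measurable_restrict_space1 measurable_completion)
  define G where "G n x = \<theta> x *\<^sub>R wgrad \<Omega> (v (s n)) x" for n x
  define H where "H n x = (\<chi> i. v (s n) x $ i *\<^sub>R D x)" for n x
  have Gm: "G n \<in> borel_measurable ?M" for n
    unfolding G_def[abs_def] by (rule borel_measurable_scaleR[OF lb[OF \<theta>c] Wm])
  have Hm: "H n \<in> borel_measurable ?M" for n
    unfolding H_def[abs_def]
    by (rule borel_measurable_continuous_Pair[OF vm lb[OF D(2)]]) (intro continuous_intros continuous_on_vec_lambda)
  have wg: "AE x in ?M. wgrad \<Omega> (\<lambda>y. \<theta> y *\<^sub>R v (s n) y) x = G n x + H n x" for n
    unfolding G_def H_def by (rule wgrad_AE_eq[OF op weak_grad_cutoff[OF op sw(1) \<theta>s M D]])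
  have nG: "norm (G n x) \<le> M * norm (wgrad \<Omega> (v (s n)) x)" for n x
    unfolding G_def by (simp add: mult_right_mono M)
  have nH: "norm (H n x) \<le> N * norm (v (s n) x)" for n x
    unfolding H_def norm_tensor by (subst mult.commute) (rule mult_right_mono[OF N], simp)
  have nG2: "(norm (G n x))\<^sup>2 \<le> M\<^sup>2 * (norm (wgrad \<Omega> (v (s n)) x))\<^sup>2" for n x
    using power_mono[OF nG, of n x 2] by (simp add: power_mult_distrib)
  have nH2: "(norm (H n x))\<^sup>2 \<le> N\<^sup>2 * (norm (v (s n) x))\<^sup>2" for n x
    using power_mono[OF nH, of n x 2] by (simp add: power_mult_distrib)
  have G2: "integrable ?M (\<lambda>x. (norm (G n x))\<^sup>2)" for n
    by (rule Bochner_Integration.integrable_bound[of _ "\<lambda>x. M\<^sup>2 * (norm (wgrad \<Omega> (v (s n)) x))\<^sup>2"])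
      (use sw(3) Gm nG2 in auto)
  have H2: "integrable ?M (\<lambda>x. (norm (H n x))\<^sup>2)" for n
    by (rule Bochner_Integration.integrable_bound[of _ "\<lambda>x. N\<^sup>2 * (norm (v (s n) x))\<^sup>2"])
      (use sw(2) Hm nH2 in auto)
  have G2C: "(LINT x|?M. (norm (G n x))\<^sup>2) \<le> M\<^sup>2 * C'" for n
  proof -
    have "(LINT x|?M. (norm (G n x))\<^sup>2) \<le> (LINT x|?M. M\<^sup>2 * (norm (wgrad \<Omega> (v (s n)) x))\<^sup>2)"
      by (rule integral_mono[OF G2]) (use sw(3) nG2 in auto)
    also have "\<dots> \<le> M\<^sup>2 * C'" by (simp add: mult_left_mono C')
    finally show ?thesis .
  qed
  have H20: "(\<lambda>n. LINT x|?M. (norm (H n x))\<^sup>2) \<longlonglongrightarrow> 0"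
  proof (rule tendsto_sandwich[OF _ _ tendsto_const])
    have "(\<lambda>n. N\<^sup>2 * (LINT x|?M. (norm (v (s n) x))\<^sup>2)) \<longlonglongrightarrow> N\<^sup>2 * 0" by (rule tendsto_mult_left[OF L2])
    then show "(\<lambda>n. N\<^sup>2 * (LINT x|?M. (norm (v (s n) x))\<^sup>2)) \<longlonglongrightarrow> 0" by simp
    show "eventually (\<lambda>n. 0 \<le> (LINT x|?M. (norm (H n x))\<^sup>2)) sequentially" by simp
    have "(LINT x|?M. (norm (H n x))\<^sup>2) \<le> N\<^sup>2 * (LINT x|?M. (norm (v (s n) x))\<^sup>2)" for n
    proof -
      have "(LINT x|?M. (norm (H n x))\<^sup>2) \<le> (LINT x|?M. N\<^sup>2 * (norm (v (s n) x))\<^sup>2)"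
        by (rule integral_mono[OF H2]) (use sw(2) nH2 in auto)
      then show ?thesis by simp
    qed
    then show "eventually (\<lambda>n. (LINT x|?M. (norm (H n x))\<^sup>2) \<le> N\<^sup>2 * (LINT x|?M. (norm (v (s n) x))\<^sup>2)) sequentially"
      by simp
  qed
  \<comment> \<open>One constant for both parts of the gradient: \<open>M\<close> bounds the
    cut-off, \<open>N\<close> its derivative, and \<open>max C 0\<close> is nonnegative whatever
    \<open>C\<close> is.\<close>
  define C1 where "C1 = max C 0 * max M N"
  have C1: "C1 \<ge> 0" using M0 by (simp add: C1_def)
  have bG: "AE x in ?M. norm (\<alpha> (s n) *\<^sub>R G n x) \<le> C1" for n
    using bd[of "s n"]
  proof eventually_elim
    case (elim x)
    have "norm (\<alpha> (s n) *\<^sub>R G n x) = norm (\<alpha> (s n) *\<^sub>R wgrad \<Omega> (v (s n)) x) * \<bar>\<theta> x\<bar>" by (simp add: G_def abs_mult)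
    also have "\<dots> \<le> max C 0 * max M N" by (rule mult_mono) (use elim M[of x] in auto)
    finally show ?case by (simp add: C1_def)
  qed
  have bH: "AE x in ?M. norm (\<alpha> (s n) *\<^sub>R H n x) \<le> C1" for n
    using bd[of "s n"]
  proof eventually_elim
    case (elim x)
    have "norm (\<alpha> (s n) *\<^sub>R H n x) = norm (\<alpha> (s n) *\<^sub>R v (s n) x) * norm (D x)" by (simp add: H_def norm_tensor)
    also have "\<dots> \<le> max C 0 * max M N" by (rule mult_mono) (use elim N[of x] in auto)
    finally show ?case by (simp add: C1_def)
  qed
  let ?U = "\<lambda>x F. (\<theta> x)\<^sup>2 * U x0 (\<theta> x *\<^sub>R F)" and ?L = "\<lambda>x. (\<theta> x)\<^sup>2 *\<^sub>R L x0"
  have "(\<lambda>n. LINT x|?M. Fden ?U ?L x (\<alpha> (s n)) (wgrad \<Omega> (v (s n)) x))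
      \<longlonglongrightarrow> (LINT x:closure \<Omega>|\<pi>. Ifun ?U ?L x (\<mu> x) (lam x))"
  proof (rule repr_measures_limit(2)[OF rep])
    have "continuous_on (closure \<Omega> \<times> UNIV) (\<lambda>p. (\<theta> (fst p))\<^sup>2 * U x0 (\<theta> (fst p) *\<^sub>R snd p))"
      by (intro continuous_intros continuous_on_compose2[OF U(1)] continuous_on_compose2[OF \<theta>c]) auto
    then show "continuous_on (closure \<Omega> \<times> UNIV) (\<lambda>(x, F). ?U x F)" by (simp add: case_prod_beta')
    show "continuous_on (closure \<Omega>) ?L"
      by (intro continuous_intros continuous_on_subset[OF \<theta>c]) auto
    show "(\<theta> x)\<^sup>2 * U x0 (\<theta> x *\<^sub>R 0) = 0" for x using U(2) by simp
  qed
  moreover have "Fden ?U ?L x a W = Fden U L x0 a (\<theta> x *\<^sub>R W)" for x a W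
    by (simp add: Fden_def power_mult_distrib bounded_bilinear.scaleR_left[OF bounded_bilinear_tens_app]
        bounded_bilinear.scaleR_right[OF bounded_bilinear_tens_app] mult_ac power2_eq_square)
  ultimately have lim: "(\<lambda>n. LINT x|?M. Fden U L x0 (\<alpha> (s n)) (G n x))
      \<longlonglongrightarrow> (LINT x:closure \<Omega>|\<pi>. Ifun ?U ?L x (\<mu> x) (lam x))" by (simp add: G_def)
  have "(\<lambda>n. LINT x|?M. Fden U L x0 (\<alpha> (s n)) (G n x + H n x))
      \<longlonglongrightarrow> (LINT x:closure \<Omega>|\<pi>. Ifun ?U ?L x (\<mu> x) (lam x))"
    by (rule Fden_perturbation_integral[where U=U and x=x0, OF U(1) apos Gm G2 G2C Hm H2 H20 bG bH C1 lim])
  moreover have "(LINT x|lebesgue_on (ball x0 r \<inter> closure \<Omega>). Fden U L x0 (\<alpha> (s n)) (wgrad \<Omega> (\<lambda>y. \<theta> y *\<^sub>R v (s n) y) x))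
      = (LINT x|?M. Fden U L x0 (\<alpha> (s n)) (G n x + H n x))" for n
  proof (rule lebesgue_integral_closure_eq[OF op C1_domain_frontier_null[OF dom]])
    show "(\<lambda>x. Fden U L x0 (\<alpha> (s n)) (G n x + H n x)) \<in> borel_measurable ?M"
      by (rule borel_measurable_continuous_on[OF Fden_continuous[where U=U and x=x0, OF U(1)]])
        (rule borel_measurable_add[OF Gm Hm])
    show "AE x in ?M. x \<in> ball x0 r \<longrightarrow> Fden U L x0 (\<alpha> (s n)) (wgrad \<Omega> (\<lambda>y. \<theta> y *\<^sub>R v (s n) y) x) = Fden U L x0 (\<alpha> (s n)) (G n x + H n x)"
      using wg[of n] by eventually_elim simp
    \<comment> \<open>The support of \<theta> lies in the ball, so both parts of the gradient vanish
      outside and the integral over the ball is one over the domain.\<close>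
    fix x assume "x \<notin> ball x0 r"
    then have "x \<notin> closure {x. \<theta> x \<noteq> 0}" using \<theta> unfolding test_fun_def by blast
    then have "\<theta> x = 0" "D x = 0" using Dz closure_subset[of "{x. \<theta> x \<noteq> 0}"] by auto
    then have "G n x + H n x = 0" by (simp add: G_def H_def vec_eq_iff)
    then show "Fden U L x0 (\<alpha> (s n)) (G n x + H n x) = 0" by (simp add: Fden_def)
  qed simp
  ultimately show ?thesis by simp
qed

lemma AE_in_support:
  assumes "prob_space M" "sets M = sets borel" "emeasure M (UNIV - K) = 0" "closed K"
  shows "AE F in M. F \<in> K"
proof -
  have "UNIV - K \<in> null_sets M" using assms by (auto simp: null_sets_def)
  from AE_not_in[OF this] show ?thesis by eventually_elim simp
qed

lemma continuous_on_slice: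
  assumes "continuous_on (A \<times> UNIV) (\<lambda>(x, F). U x F)" "x \<in> A"
  shows "continuous_on UNIV (U x)"
proof -
  have "continuous_on UNIV (\<lambda>F. (x, F))" by (intro continuous_on_Pair continuous_on_const continuous_on_id)
  from continuous_on_compose2[OF assms(1) this] show ?thesis using assms(2) by auto
qed

lemma integral_bounded_by_AE:
  fixes f :: "'a \<Rightarrow> real"
  assumes "prob_space M" "AE x in M. \<bar>f x\<bar> \<le> B"
  shows "\<bar>LINT x|M. f x\<bar> \<le> B"
proof -
  interpret prob_space M by fact
  \<comment> \<open>With a nonnegative \<open>B\<close> the bound also holds for a non-integrable
    \<open>f\<close>, whose integral is 0 by convention.\<close>
  have B: "B \<ge> 0"
  proof (rule ccontr)
    assume neg: "\<not> B \<ge> 0"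
    have "AE x in M. False" using assms(2) by eventually_elim (use neg in linarith)
    then show False by simp
  qed
  have "(LINT x|M. f x) \<le> (LINT x|M. B)"
    by (rule integral_mono_AE') (use assms(2) B in \<open>auto elim: eventually_mono\<close>)
  moreover have "(LINT x|M. - f x) \<le> (LINT x|M. B)"
    by (rule integral_mono_AE') (use assms(2) B in \<open>auto elim: eventually_mono\<close>)
  ultimately show ?thesis using prob_space by simp
qed

text \<open>\<open>B\<close> is chosen before the measures, so it dominates at all points of the
  domain simultaneously. This rests on the common supports: \<open>t *\<^sub>R F\<close> stays in a
  fixed compact ball, and the quadratic part scales exactly by \<open>t\<^sup>2\<close>.\<close>

lemma Ifun_scaling:
  fixes f :: "real^'d^'m \<Rightarrow> real" and T :: "real^'d^'m^'d^'m"
  assumes f: "continuous_on UNIV f" and M: "M \<ge> 0"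
  shows "\<exists>B. \<forall>\<mu> lam. prob_space \<mu> \<and> sets \<mu> = sets borel \<and> emeasure \<mu> (UNIV - cball 0 R) = 0 \<and>
      prob_space lam \<and> sets lam = sets borel \<and> emeasure lam (UNIV - sphere 0 1) = 0 \<longrightarrow>
      (\<forall>t. \<bar>t\<bar> \<le> M \<longrightarrow> \<bar>(LINT F|\<mu>. t\<^sup>2 * f (t *\<^sub>R F)) + 1/2 * (LINT F|lam. inner (tens_app (t\<^sup>2 *\<^sub>R T) F) F)\<bar> \<le> B) \<and>
      (\<forall>t l. (\<forall>k. \<bar>t k\<bar> \<le> M) \<and> t \<longlonglongrightarrow> l \<longrightarrow>
        (\<lambda>k. (LINT F|\<mu>. (t k)\<^sup>2 * f (t k *\<^sub>R F)) + 1/2 * (LINT F|lam. inner (tens_app ((t k)\<^sup>2 *\<^sub>R T) F) F))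
          \<longlonglongrightarrow> (LINT F|\<mu>. l\<^sup>2 * f (l *\<^sub>R F)) + 1/2 * (LINT F|lam. inner (tens_app (l\<^sup>2 *\<^sub>R T) F) F))"
proof -
  obtain K where K: "K > 0" "\<And>(T :: real^'d^'m^'d^'m) F G. \<bar>inner (tens_app T F) G\<bar> \<le> norm T * K * norm F * norm G"
    using tens_app_form_bound by blast
  \<comment> \<open>The absolute value keeps 0 in the ball, from which \<open>S \<ge> 0\<close> is
    read off.\<close>
  have "compact (f ` cball 0 (M * \<bar>R\<bar>))" by (intro compact_continuous_image compact_cball continuous_on_subset[OF f]) simp
  then obtain S where S: "\<And>F. F \<in> cball 0 (M * \<bar>R\<bar>) \<Longrightarrow> \<bar>f F\<bar> \<le> S"
    by (fastforce dest!: compact_imp_bounded simp: bounded_iff)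
  have S0: "S \<ge> 0" using S[of 0] M by simp
  have fb: "\<bar>t\<^sup>2 * f (t *\<^sub>R F)\<bar> \<le> M\<^sup>2 * S" if "\<bar>t\<bar> \<le> M" "F \<in> cball 0 R" for t F
  proof -
    have "norm F \<le> \<bar>R\<bar>" using that(2) by simp
    then have "\<bar>t\<bar> * norm F \<le> M * \<bar>R\<bar>" using that(1) M by (intro mult_mono) auto
    then have "\<bar>f (t *\<^sub>R F)\<bar> \<le> S" by (intro S) simp
    moreover have "t\<^sup>2 \<le> M\<^sup>2" using power_mono[OF that(1), of 2] by simp
    ultimately show ?thesis by (simp add: abs_mult mult_mono)
  qed
  have qb: "\<bar>inner (tens_app T F) F\<bar> \<le> norm T * K" if "F \<in> sphere 0 1" for F
    using K(2)[of T F F] that by simp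
  have qt: "(LINT F|lam. inner (tens_app (t\<^sup>2 *\<^sub>R T) F) F) = t\<^sup>2 * (LINT F|lam. inner (tens_app T F) F)" for t and lam :: "(real^'d^'m) measure"
    by (simp add: bounded_bilinear.scaleR_left[OF bounded_bilinear_tens_app])
  show ?thesis
  proof (intro exI[of _ "M\<^sup>2 * S + 1/2 * (M\<^sup>2 * (norm T * K))"] allI impI)
    fix \<mu> lam :: "(real^'d^'m) measure"
    assume "prob_space \<mu> \<and> sets \<mu> = sets borel \<and> emeasure \<mu> (UNIV - cball 0 R) = 0 \<and>
      prob_space lam \<and> sets lam = sets borel \<and> emeasure lam (UNIV - sphere 0 1) = 0"
    then have p\<mu>: "prob_space \<mu>" and s\<mu>: "sets \<mu> = sets borel" and z\<mu>: "emeasure \<mu> (UNIV - cball 0 R) = 0"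
      and pl: "prob_space lam" and sl: "sets lam = sets borel" and zl: "emeasure lam (UNIV - sphere 0 1) = 0" by auto
    interpret m: prob_space \<mu> by fact
    have ae: "AE F in \<mu>. F \<in> cball 0 R" by (rule AE_in_support[OF p\<mu> s\<mu> z\<mu>]) simp
    have ael: "AE F in lam. F \<in> sphere 0 1" by (rule AE_in_support[OF pl sl zl]) simp
    have Lb: "\<bar>LINT F|lam. inner (tens_app T F) F\<bar> \<le> norm T * K"
      by (rule integral_bounded_by_AE[OF pl]) (use ael in eventually_elim, rule qb)
    show "(\<forall>t. \<bar>t\<bar> \<le> M \<longrightarrow> \<bar>(LINT F|\<mu>. t\<^sup>2 * f (t *\<^sub>R F)) + 1/2 * (LINT F|lam. inner (tens_app (t\<^sup>2 *\<^sub>R T) F) F)\<bar> \<le> M\<^sup>2 * S + 1/2 * (M\<^sup>2 * (norm T * K))) \<and>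
      (\<forall>t l. (\<forall>k. \<bar>t k\<bar> \<le> M) \<and> t \<longlonglongrightarrow> l \<longrightarrow>
        (\<lambda>k. (LINT F|\<mu>. (t k)\<^sup>2 * f (t k *\<^sub>R F)) + 1/2 * (LINT F|lam. inner (tens_app ((t k)\<^sup>2 *\<^sub>R T) F) F))
          \<longlonglongrightarrow> (LINT F|\<mu>. l\<^sup>2 * f (l *\<^sub>R F)) + 1/2 * (LINT F|lam. inner (tens_app (l\<^sup>2 *\<^sub>R T) F) F))"
    proof (intro conjI allI impI)
      fix t assume t: "\<bar>t\<bar> \<le> M"
      have "\<bar>LINT F|\<mu>. t\<^sup>2 * f (t *\<^sub>R F)\<bar> \<le> M\<^sup>2 * S"
        by (rule integral_bounded_by_AE[OF p\<mu>]) (use ae in eventually_elim, rule fb[OF t])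
      moreover have "\<bar>t\<^sup>2 * (LINT F|lam. inner (tens_app T F) F)\<bar> \<le> M\<^sup>2 * (norm T * K)"
        unfolding abs_mult by (rule mult_mono[OF _ Lb]) (use power_mono[OF t, of 2] in auto)
      ultimately show "\<bar>(LINT F|\<mu>. t\<^sup>2 * f (t *\<^sub>R F)) + 1/2 * (LINT F|lam. inner (tens_app (t\<^sup>2 *\<^sub>R T) F) F)\<bar> \<le> M\<^sup>2 * S + 1/2 * (M\<^sup>2 * (norm T * K))"
        unfolding qt by linarith
    next
      fix t :: "nat \<Rightarrow> real" and l assume "(\<forall>k. \<bar>t k\<bar> \<le> M) \<and> t \<longlonglongrightarrow> l"
      then have tM: "\<And>k. \<bar>t k\<bar> \<le> M" and tl: "t \<longlonglongrightarrow> l" by auto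
      have fm: "(\<lambda>F. f (c *\<^sub>R F)) \<in> borel_measurable \<mu>" for c
      proof -
        have "continuous_on UNIV (\<lambda>F. f (c *\<^sub>R F))" by (intro continuous_on_compose2[OF f] continuous_intros) auto
        then show ?thesis using borel_measurable_continuous_onI s\<mu> measurable_cong_sets by blast
      qed
      have "(\<lambda>k. LINT F|\<mu>. (t k)\<^sup>2 * f (t k *\<^sub>R F)) \<longlonglongrightarrow> (LINT F|\<mu>. l\<^sup>2 * f (l *\<^sub>R F))"
      proof (rule integral_dominated_convergence[where w="\<lambda>_. M\<^sup>2 * S"])
        show "AE F in \<mu>. (\<lambda>k. (t k)\<^sup>2 * f (t k *\<^sub>R F)) \<longlonglongrightarrow> l\<^sup>2 * f (l *\<^sub>R F)"
        proof (rule AE_I2)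
          fix F
          have "isCont f (l *\<^sub>R F)" using f by (simp add: continuous_on_eq_continuous_at)
          then have "(\<lambda>k. f (t k *\<^sub>R F)) \<longlonglongrightarrow> f (l *\<^sub>R F)"
            by (rule isCont_tendsto_compose) (intro tendsto_intros tl)
          then show "(\<lambda>k. (t k)\<^sup>2 * f (t k *\<^sub>R F)) \<longlonglongrightarrow> l\<^sup>2 * f (l *\<^sub>R F)" by (intro tendsto_mult tendsto_power tl)
        qed
        show "AE F in \<mu>. norm ((t k)\<^sup>2 * f (t k *\<^sub>R F)) \<le> M\<^sup>2 * S" for k
          using ae by eventually_elim (unfold real_norm_def, rule fb[OF tM])
      qed (use fm in auto)
      then show "(\<lambda>k. (LINT F|\<mu>. (t k)\<^sup>2 * f (t k *\<^sub>R F)) + 1/2 * (LINT F|lam. inner (tens_app ((t k)\<^sup>2 *\<^sub>R T) F) F))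
          \<longlonglongrightarrow> (LINT F|\<mu>. l\<^sup>2 * f (l *\<^sub>R F)) + 1/2 * (LINT F|lam. inner (tens_app (l\<^sup>2 *\<^sub>R T) F) F)"
        unfolding qt by (intro tendsto_intros tl)
    qed
  qed
qed

text \<open>At fixed \<open>x\<close> the integrand depends on the cut-off only through the number
  \<open>\<theta> k x\<close>. It is continuous in this number and bounded uniformly in
  \<open>x\<close>, so dominated convergence applies to the finite measure \<pi>.\<close>

lemma cutoff_limit_indicator:
  fixes v :: "nat \<Rightarrow> real^'d \<Rightarrow> real^'m" and U :: "real^'d \<Rightarrow> real^'d^'m \<Rightarrow> real"
  assumes rep: "repr_measures \<Omega> \<alpha> v s \<pi> \<mu> lam" and U: "continuous_on UNIV (U x0)" "U x0 0 = 0"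
    and \<theta>: "\<And>k. continuous_on UNIV (\<theta> k)" "\<And>k x. \<bar>\<theta> k x\<bar> \<le> M"
    and lim: "\<And>x. x \<in> closure \<Omega> \<Longrightarrow> (\<lambda>k. \<theta> k x) \<longlonglongrightarrow> indicator A x" and A: "A \<in> sets borel"
  shows "(\<lambda>k. LINT x:closure \<Omega>|\<pi>. Ifun (\<lambda>x F. (\<theta> k x)\<^sup>2 * U x0 (\<theta> k x *\<^sub>R F)) (\<lambda>x. (\<theta> k x)\<^sup>2 *\<^sub>R L x0) x (\<mu> x) (lam x))
    \<longlonglongrightarrow> (LINT x:closure \<Omega>|\<pi>. indicator A x * Ifun (\<lambda>x. U x0) (\<lambda>x. L x0) x (\<mu> x) (lam x))"
proof -
  interpret p: finite_measure \<pi> by (rule repr_measuresD(3)[OF rep])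
  have sets: "sets \<pi> = sets borel" by (rule repr_measuresD(2)[OF rep])
  obtain R where \<mu>: "\<And>x. x \<in> closure \<Omega> \<Longrightarrow> prob_space (\<mu> x) \<and> sets (\<mu> x) = sets borel \<and> emeasure (\<mu> x) (UNIV - cball 0 R) = 0"
    using repr_measuresD(5)[OF rep] by blast
  have lam: "\<And>x. x \<in> closure \<Omega> \<Longrightarrow> prob_space (lam x) \<and> sets (lam x) = sets borel \<and> emeasure (lam x) (UNIV - sphere 0 1) = 0"
    using repr_measuresD(6)[OF rep] by blast
  have M: "M \<ge> 0" using order_trans[OF abs_ge_zero \<theta>(2)[of 0 0]] .
  define J where "J x t = (LINT F|\<mu> x. t\<^sup>2 * U x0 (t *\<^sub>R F)) + 1/2 * (LINT F|lam x. inner (tens_app (t\<^sup>2 *\<^sub>R L x0) F) F)" for x t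
  obtain B where B0: "\<And>\<mu> lam. prob_space \<mu> \<and> sets \<mu> = sets borel \<and> emeasure \<mu> (UNIV - cball 0 R) = 0 \<and>
      prob_space lam \<and> sets lam = sets borel \<and> emeasure lam (UNIV - sphere 0 1) = 0 \<Longrightarrow>
      (\<forall>t. \<bar>t\<bar> \<le> M \<longrightarrow> \<bar>(LINT F|\<mu>. t\<^sup>2 * U x0 (t *\<^sub>R F)) + 1/2 * (LINT F|lam. inner (tens_app (t\<^sup>2 *\<^sub>R L x0) F) F)\<bar> \<le> B) \<and>
      (\<forall>t l. (\<forall>k. \<bar>t k\<bar> \<le> M) \<and> t \<longlonglongrightarrow> l \<longrightarrow>
        (\<lambda>k. (LINT F|\<mu>. (t k)\<^sup>2 * U x0 (t k *\<^sub>R F)) + 1/2 * (LINT F|lam. inner (tens_app ((t k)\<^sup>2 *\<^sub>R L x0) F) F))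
          \<longlonglongrightarrow> (LINT F|\<mu>. l\<^sup>2 * U x0 (l *\<^sub>R F)) + 1/2 * (LINT F|lam. inner (tens_app (l\<^sup>2 *\<^sub>R L x0) F) F))"
    using Ifun_scaling[OF U(1) M, of R "L x0"] by blast
  have Jb: "\<bar>J x t\<bar> \<le> B" if "x \<in> closure \<Omega>" "\<bar>t\<bar> \<le> M" for x t
    using B0[of "\<mu> x" "lam x"] \<mu>[OF that(1)] lam[OF that(1)] that(2) by (simp add: J_def)
  have Jl: "(\<lambda>k. J x (t k)) \<longlonglongrightarrow> J x l" if "x \<in> closure \<Omega>" "\<And>k. \<bar>t k\<bar> \<le> M" "t \<longlonglongrightarrow> l" for x t l
    using B0[of "\<mu> x" "lam x"] \<mu>[OF that(1)] lam[OF that(1)] that(2,3) by (simp add: J_def)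
  have JI: "Ifun (\<lambda>x F. (\<theta> k x)\<^sup>2 * U x0 (\<theta> k x *\<^sub>R F)) (\<lambda>x. (\<theta> k x)\<^sup>2 *\<^sub>R L x0) x (\<mu> x) (lam x) = J x (\<theta> k x)" for k x
    by (simp add: Ifun_def J_def)
  \<comment> \<open>\<open>J x\<close> vanishes at 0 and is the unscaled functional at 1, so the
    indicator can be pulled out of the nonlinear expression.\<close>
  have J1: "indicator A x * Ifun (\<lambda>x. U x0) (\<lambda>x. L x0) x (\<mu> x) (lam x) = J x (indicator A x)" for x
    using U(2) by (cases "x \<in> A")
      (simp_all add: Ifun_def J_def bounded_bilinear.zero_left[OF bounded_bilinear_tens_app])
  \<comment> \<open>Measurability in \<open>x\<close> is extracted from the integrability that
    \<open>repr_measures\<close> grants for continuous integrands, the cut-off being part of the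
    integrand.\<close>
  have m: "(\<lambda>x. indicator (closure \<Omega>) x *\<^sub>R J x (\<theta> k x)) \<in> borel_measurable \<pi>" for k
  proof -
    have "continuous_on (closure \<Omega> \<times> UNIV) (\<lambda>p. (\<theta> k (fst p))\<^sup>2 * U x0 (\<theta> k (fst p) *\<^sub>R snd p))"
      by (intro continuous_intros continuous_on_compose2[OF U(1)] continuous_on_compose2[OF \<theta>(1)]) auto
    then have "continuous_on (closure \<Omega> \<times> UNIV) (\<lambda>(x, F). (\<theta> k x)\<^sup>2 * U x0 (\<theta> k x *\<^sub>R F))" by (simp add: case_prod_beta')
    moreover have "continuous_on (closure \<Omega>) (\<lambda>x. (\<theta> k x)\<^sup>2 *\<^sub>R L x0)"
      by (intro continuous_intros continuous_on_subset[OF \<theta>(1)]) auto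
    ultimately have "set_integrable \<pi> (closure \<Omega>) (\<lambda>x. J x (\<theta> k x))"
      unfolding JI[symmetric] by (intro repr_measures_limit(1)[OF rep]) (use U(2) in auto)
    then show ?thesis unfolding set_integrable_def by (rule borel_measurable_integrable)
  qed
  have m1: "(\<lambda>x. indicator (closure \<Omega>) x *\<^sub>R J x (indicator A x)) \<in> borel_measurable \<pi>"
  proof -
    have "continuous_on (closure \<Omega> \<times> UNIV) (\<lambda>p. U x0 (snd p))"
      by (intro continuous_on_compose2[OF U(1)] continuous_intros) auto
    then have "set_integrable \<pi> (closure \<Omega>) (\<lambda>x. Ifun (\<lambda>x. U x0) (\<lambda>x. L x0) x (\<mu> x) (lam x))"
      by (intro repr_measures_limit(1)[OF rep]) (use U(2) in \<open>auto simp: case_prod_beta'\<close>)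
    then have "(\<lambda>x. indicator A x * (indicator (closure \<Omega>) x *\<^sub>R Ifun (\<lambda>x. U x0) (\<lambda>x. L x0) x (\<mu> x) (lam x))) \<in> borel_measurable \<pi>"
      unfolding set_integrable_def using A sets
      by (intro borel_measurable_times borel_measurable_indicator borel_measurable_integrable) auto
    then show ?thesis unfolding J1[symmetric] by (simp add: mult.left_commute)
  qed
  have "(\<lambda>k. LINT x|\<pi>. indicator (closure \<Omega>) x *\<^sub>R J x (\<theta> k x)) \<longlonglongrightarrow> (LINT x|\<pi>. indicator (closure \<Omega>) x *\<^sub>R J x (indicator A x))"
  proof (rule integral_dominated_convergence[where w="\<lambda>_. \<bar>B\<bar>", OF m1 m])
    show "AE x in \<pi>. (\<lambda>k. indicator (closure \<Omega>) x *\<^sub>R J x (\<theta> k x)) \<longlonglongrightarrow> indicator (closure \<Omega>) x *\<^sub>R J x (indicator A x)"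
    proof (rule AE_I2)
      fix x
      show "(\<lambda>k. indicator (closure \<Omega>) x *\<^sub>R J x (\<theta> k x)) \<longlonglongrightarrow> indicator (closure \<Omega>) x *\<^sub>R J x (indicator A x)"
        using Jl[of x "\<lambda>k. \<theta> k x" "indicator A x"] lim[of x] \<theta>(2) by (cases "x \<in> closure \<Omega>") auto
    qed
    show "AE x in \<pi>. norm (indicator (closure \<Omega>) x *\<^sub>R J x (\<theta> k x)) \<le> \<bar>B\<bar>" for k
    proof (rule AE_I2)
      fix x
      show "norm (indicator (closure \<Omega>) x *\<^sub>R J x (\<theta> k x)) \<le> \<bar>B\<bar>"
        using Jb[of x "\<theta> k x"] \<theta>(2)[of k x] by (cases "x \<in> closure \<Omega>") auto
    qed
  qed simp
  then show ?thesis unfolding JI J1 set_lebesgue_integral_def .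
qed

text \<open>One modulus of continuity of \<open>U\<close> on the compact product serves all measures
  \<open>\<mu> y\<close> at once, as they share a ball; on the unit sphere the tensor form is
  bounded by \<open>K\<close> times the norm of the tensor.\<close>

lemma Ifun_frozen_close:
  fixes v :: "nat \<Rightarrow> real^'d \<Rightarrow> real^'m" and U :: "real^'d \<Rightarrow> real^'d^'m \<Rightarrow> real"
  assumes rep: "repr_measures \<Omega> \<alpha> v s \<pi> \<mu> lam" and bd: "bounded \<Omega>" and x0: "x0 \<in> closure \<Omega>"
    and U: "continuous_on (closure \<Omega> \<times> UNIV) (\<lambda>(x, F). U x F)" and L: "continuous_on (closure \<Omega>) L" and e: "e > 0"
  shows "\<exists>\<delta>>0. \<forall>y\<in>closure \<Omega>. dist y x0 < \<delta> \<longrightarrow>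
    \<bar>Ifun (\<lambda>x. U x0) (\<lambda>x. L x0) y (\<mu> y) (lam y) - Ifun U L y (\<mu> y) (lam y)\<bar> \<le> e"
proof -
  obtain R where \<mu>: "\<And>x. x \<in> closure \<Omega> \<Longrightarrow> prob_space (\<mu> x) \<and> sets (\<mu> x) = sets borel \<and> emeasure (\<mu> x) (UNIV - cball 0 R) = 0"
    using repr_measuresD(5)[OF rep] by blast
  have lam: "\<And>x. x \<in> closure \<Omega> \<Longrightarrow> prob_space (lam x) \<and> sets (lam x) = sets borel \<and> emeasure (lam x) (UNIV - sphere 0 1) = 0"
    using repr_measuresD(6)[OF rep] by blast
  obtain K where K: "K > 0" "\<And>(T :: real^'d^'m^'d^'m) F G. \<bar>inner (tens_app T F) G\<bar> \<le> norm T * K * norm F * norm G"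
    using tens_app_form_bound by blast
  let ?U = "\<lambda>(x, F). U x F" and ?S = "closure \<Omega> \<times> cball (0 :: real^'d^'m) R"
  have cs: "compact ?S" using bd by (intro compact_Times compact_cball) (simp add: compact_closure)
  have cont: "continuous_on ?S ?U" by (rule continuous_on_subset[OF U]) auto
  have "uniformly_continuous_on ?S ?U" by (rule compact_uniformly_continuous[OF cont cs])
  then obtain \<delta>1 where \<delta>1: "\<delta>1 > 0" "\<And>p q. p \<in> ?S \<Longrightarrow> q \<in> ?S \<Longrightarrow> dist q p < \<delta>1 \<Longrightarrow> dist (?U q) (?U p) < e / 2"
    unfolding uniformly_continuous_on_def using e by (metis half_gt_zero)
  \<comment> \<open>\<open>e / K\<close> bounds the tensor form by \<open>e\<close>, which the
    factor 1/2 in \<open>Ifun\<close> halves.\<close>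
  have "\<exists>\<delta>2>0. \<forall>y\<in>closure \<Omega>. dist y x0 < \<delta>2 \<longrightarrow> dist (L y) (L x0) < e / K"
    using L x0 e K(1) unfolding continuous_on_iff by (meson divide_pos_pos)
  then obtain \<delta>2 where \<delta>2: "\<delta>2 > 0" "\<And>y. y \<in> closure \<Omega> \<Longrightarrow> dist y x0 < \<delta>2 \<Longrightarrow> dist (L y) (L x0) < e / K" by blast
  have "\<bar>Ifun (\<lambda>x. U x0) (\<lambda>x. L x0) y (\<mu> y) (lam y) - Ifun U L y (\<mu> y) (lam y)\<bar> \<le> e"
    if y: "y \<in> closure \<Omega>" "dist y x0 < min \<delta>1 \<delta>2" for y
  proof -
    interpret m: prob_space "\<mu> y" using \<mu>[OF y(1)] by blast
    interpret l: prob_space "lam y" using lam[OF y(1)] by blast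
    have ae: "AE F in \<mu> y. F \<in> cball 0 R" by (rule AE_in_support) (use \<mu>[OF y(1)] in auto)
    have ael: "AE F in lam y. F \<in> sphere 0 1" by (rule AE_in_support) (use lam[OF y(1)] in auto)
    have iU: "integrable (\<mu> y) (\<lambda>F. U z F)" if z: "z \<in> closure \<Omega>" for z
    proof -
      have cz: "continuous_on UNIV (\<lambda>F. U z F)"
        by (rule continuous_on_slice[OF U z])
      have "compact (U z ` cball 0 R)" by (intro compact_continuous_image compact_cball continuous_on_subset[OF cz]) simp
      then obtain S where "\<And>F. F \<in> cball 0 R \<Longrightarrow> \<bar>U z F\<bar> \<le> S"
        by (fastforce dest!: compact_imp_bounded simp: bounded_iff)
      then have "AE F in \<mu> y. norm (U z F) \<le> S" using ae by (auto elim!: eventually_mono)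
      moreover have "(\<lambda>F. U z F) \<in> borel_measurable (\<mu> y)"
        using borel_measurable_continuous_onI[OF cz] \<mu>[OF y(1)] measurable_cong_sets by blast
      ultimately show ?thesis by (intro m.integrable_const_bound)
    qed
    have iL: "integrable (lam y) (\<lambda>F. inner (tens_app T F) F)" for T
    proof -
      have "continuous_on UNIV (\<lambda>F. inner (tens_app T F) F)"
        by (intro continuous_intros bounded_linear.continuous_on[OF bounded_bilinear.bounded_linear_right[OF bounded_bilinear_tens_app]])
      then have "(\<lambda>F. inner (tens_app T F) F) \<in> borel_measurable (lam y)"
        using borel_measurable_continuous_onI lam[OF y(1)] measurable_cong_sets by blast
      moreover have "AE F in lam y. norm (inner (tens_app T F) F) \<le> norm T * K"
        using ael
      proof eventually_elim
        case (elim F)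
        then show ?case using K(2)[of T F F] by simp
      qed
      ultimately show ?thesis by (intro l.integrable_const_bound)
    qed
    have dU: "\<bar>LINT F|\<mu> y. U x0 F - U y F\<bar> \<le> e / 2"
    proof (rule integral_bounded_by_AE)
      show "AE F in \<mu> y. \<bar>U x0 F - U y F\<bar> \<le> e / 2"
        using ae
      proof eventually_elim
        case (elim F)
        have "dist (?U (x0, F)) (?U (y, F)) < e / 2"
          by (rule \<delta>1(2)) (use elim y x0 in \<open>auto simp: dist_Pair_Pair dist_commute\<close>)
        then show ?case by (simp add: dist_real_def)
      qed
    qed (use \<mu>[OF y(1)] in blast)
    have dL: "\<bar>LINT F|lam y. inner (tens_app (L x0) F) F - inner (tens_app (L y) F) F\<bar> \<le> e"
    proof (rule integral_bounded_by_AE)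
      show "AE F in lam y. \<bar>inner (tens_app (L x0) F) F - inner (tens_app (L y) F) F\<bar> \<le> e"
        using ael
      proof eventually_elim
        case (elim F)
        have "inner (tens_app (L x0) F) F - inner (tens_app (L y) F) F = inner (tens_app (L x0 - L y) F) F"
          by (simp add: bounded_bilinear.diff_left[OF bounded_bilinear_tens_app] inner_diff_left)
        also have "\<bar>\<dots>\<bar> \<le> norm (L x0 - L y) * K" using K(2)[of "L x0 - L y" F F] elim by simp
        also have "\<dots> \<le> e / K * K"
          using \<delta>2(2)[OF y(1)] y(2) K(1) by (intro mult_right_mono) (auto simp: dist_norm norm_minus_commute)
        finally show ?case using K(1) by simp
      qed
    qed (use lam[OF y(1)] in blast)
    have "Ifun (\<lambda>x. U x0) (\<lambda>x. L x0) y (\<mu> y) (lam y) - Ifun U L y (\<mu> y) (lam y)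
        = (LINT F|\<mu> y. U x0 F - U y F) + 1/2 * (LINT F|lam y. inner (tens_app (L x0) F) F - inner (tens_app (L y) F) F)"
      using iU[OF x0] iU[OF y(1)] iL by (simp add: Ifun_def)
    then show ?thesis using dU dL by linarith
  qed
  then show ?thesis using \<delta>1(1) \<delta>2(1) by (intro exI[of _ "min \<delta>1 \<delta>2"]) auto
qed

text \<open>The density hypothesis settles the averages of the unfrozen functional. Freezing its
  first argument at \<open>x0\<close> changes an average over a ball of radius below
  \<open>\<delta>\<close> by at most \<open>e / 2\<close>.\<close>

lemma frozen_average_limit:
  fixes v :: "nat \<Rightarrow> real^'d \<Rightarrow> real^'m" and U :: "real^'d \<Rightarrow> real^'d^'m \<Rightarrow> real"
  assumes rep: "repr_measures \<Omega> \<alpha> v s \<pi> \<mu> lam" and bd: "bounded \<Omega>" and x0: "x0 \<in> closure \<Omega>" "x0 \<in> measure_supp \<pi>"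
    and U: "continuous_on (closure \<Omega> \<times> UNIV) (\<lambda>(x, F). U x F)" "\<And>x. x \<in> closure \<Omega> \<Longrightarrow> U x 0 = 0"
    and L: "continuous_on (closure \<Omega>) L"
    and dens: "has_ball_density_limit \<pi> (\<lambda>x. indicator (closure \<Omega>) x * Ifun U L x (\<mu> x) (lam x)) x0"
  shows "((\<lambda>r. 1 / measure \<pi> (ball x0 r \<inter> closure \<Omega>) *
      (LINT x:closure \<Omega>|\<pi>. indicator (ball x0 r) x * Ifun (\<lambda>x. U x0) (\<lambda>x. L x0) x (\<mu> x) (lam x)))
      \<longlongrightarrow> Ifun U L x0 (\<mu> x0) (lam x0)) (at_right 0)"
proof (rule tendstoI)
  fix e :: real assume e: "e > 0"
  interpret p: finite_measure \<pi> by (rule repr_measuresD(3)[OF rep])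
  have sets: "sets \<pi> = sets borel" by (rule repr_measuresD(2)[OF rep])
  have spU: "space \<pi> = UNIV" using sets by (metis sets_eq_imp_space_eq space_borel)
  define f where "f x = indicator (closure \<Omega>) x * Ifun U L x (\<mu> x) (lam x)" for x
  define g where "g x = indicator (closure \<Omega>) x * Ifun (\<lambda>x. U x0) (\<lambda>x. L x0) x (\<mu> x) (lam x)" for x
  have fi: "integrable \<pi> f"
    using repr_measures_limit(1)[OF rep U L] by (simp add: set_integrable_def f_def[abs_def])
  have U0: "continuous_on UNIV (\<lambda>F. U x0 F)"
    by (rule continuous_on_slice[OF U(1) x0(1)])
  have "continuous_on (closure \<Omega> \<times> UNIV) (\<lambda>p. U x0 (snd p))"
    by (intro continuous_on_compose2[OF U0] continuous_intros) auto
  then have "set_integrable \<pi> (closure \<Omega>) (\<lambda>x. Ifun (\<lambda>x. U x0) (\<lambda>x. L x0) x (\<mu> x) (lam x))"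
    by (intro repr_measures_limit(1)[OF rep]) (use U(2)[OF x0(1)] in \<open>auto simp: case_prod_beta'\<close>)
  then have gi: "integrable \<pi> g" by (simp add: set_integrable_def g_def[abs_def])
  have pos: "\<forall>r>0. measure \<pi> (ball x0 r) > 0"
    using x0(2) by (simp add: measure_supp_def p.emeasure_eq_measure)
  \<comment> \<open>\<open>\<pi>\<close> has no mass outside the closure, so the normalisation
    agrees with that of the differentiation theorem.\<close>
  have meq: "measure \<pi> (ball x0 r \<inter> closure \<Omega>) = measure \<pi> (ball x0 r)" for r
  proof -
    have "UNIV - closure \<Omega> \<in> null_sets \<pi>" using repr_measuresD(4)[OF rep] sets by (auto simp: null_sets_def)
    then have "measure \<pi> (ball x0 r - (UNIV - closure \<Omega>)) = measure \<pi> (ball x0 r)"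
      by (intro measure_Diff_null_set) (use sets in auto)
    moreover have "ball x0 r - (UNIV - closure \<Omega>) = ball x0 r \<inter> closure \<Omega>" by blast
    ultimately show ?thesis by simp
  qed
  obtain \<delta> where \<delta>: "\<delta> > 0" "\<And>y. y \<in> closure \<Omega> \<Longrightarrow> dist y x0 < \<delta> \<Longrightarrow>
    \<bar>Ifun (\<lambda>x. U x0) (\<lambda>x. L x0) y (\<mu> y) (lam y) - Ifun U L y (\<mu> y) (lam y)\<bar> \<le> e / 2"
    using Ifun_frozen_close[OF rep bd x0(1) U(1) L, of "e / 2"] e by auto
  have fx0: "f x0 = Ifun U L x0 (\<mu> x0) (lam x0)" using x0(1) by (simp add: f_def)
  have "((\<lambda>r. (LINT y:ball x0 r|\<pi>. f y) / measure \<pi> (ball x0 r)) \<longlongrightarrow> f x0) (at_right 0)"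
    using dens pos unfolding f_def by blast
  then have "eventually (\<lambda>r. dist ((LINT y:ball x0 r|\<pi>. f y) / measure \<pi> (ball x0 r)) (f x0) < e / 2) (at_right 0)"
    by (rule tendstoD) (use e in simp)
  moreover have "eventually (\<lambda>r. 0 < r \<and> r < \<delta>) (at_right 0)" using \<delta>(1) by (auto simp: eventually_at_right_field)
  ultimately show "eventually (\<lambda>r. dist (1 / measure \<pi> (ball x0 r \<inter> closure \<Omega>) *
      (LINT x:closure \<Omega>|\<pi>. indicator (ball x0 r) x * Ifun (\<lambda>x. U x0) (\<lambda>x. L x0) x (\<mu> x) (lam x)))
      (Ifun U L x0 (\<mu> x0) (lam x0)) < e) (at_right 0)"
  proof eventually_elim
    case (elim r)
    let ?b = "measure \<pi> (ball x0 r)"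
    have b: "?b > 0" using pos elim by blast
    have si: "set_integrable \<pi> (ball x0 r) h" if "integrable \<pi> h" for h :: "real^'d \<Rightarrow> real"
      using that sets unfolding set_integrable_def by (intro integrable_mult_indicator) auto
    have g_eq: "(LINT x:closure \<Omega>|\<pi>. indicator (ball x0 r) x * Ifun (\<lambda>x. U x0) (\<lambda>x. L x0) x (\<mu> x) (lam x)) = (LINT x:ball x0 r|\<pi>. g x)"
      unfolding set_lebesgue_integral_def g_def by (intro Bochner_Integration.integral_cong) auto
    have "\<bar>(LINT x:ball x0 r|\<pi>. g x) - (LINT x:ball x0 r|\<pi>. f x)\<bar> = \<bar>LINT x:ball x0 r|\<pi>. g x - f x\<bar>"
      using si gi fi by (simp add: set_integral_diff)
    also have "\<dots> \<le> (LINT x:ball x0 r|\<pi>. \<bar>g x - f x\<bar>)"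
      using set_integral_norm_bound[OF si, of "\<lambda>x. g x - f x"] gi fi by simp
    also have "\<dots> \<le> (LINT x:ball x0 r|\<pi>. e / 2)"
    proof (rule set_integral_mono)
      show "set_integrable \<pi> (ball x0 r) (\<lambda>x. \<bar>g x - f x\<bar>)" by (rule si) (use gi fi in simp)
      show "set_integrable \<pi> (ball x0 r) (\<lambda>x. e / 2)" by (rule si) simp
      fix x assume "x \<in> ball x0 r"
      then have "dist x x0 < \<delta>" using elim by (simp add: dist_commute)
      then show "\<bar>g x - f x\<bar> \<le> e / 2" using \<delta>(2)[of x] e by (auto simp: g_def f_def indicator_def)
    qed
    also have "\<dots> = e / 2 * ?b" using sets by (simp add: set_lebesgue_integral_def spU)
    finally have "\<bar>(LINT x:ball x0 r|\<pi>. g x) / ?b - (LINT x:ball x0 r|\<pi>. f x) / ?b\<bar> \<le> e / 2"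
      using b by (simp add: diff_divide_distrib[symmetric] pos_divide_le_eq)
    then show ?case using elim unfolding meq g_eq fx0 dist_real_def by (simp only: mult_1 times_divide_eq_left)
  qed
qed

theorem theorem8p1:
  fixes \<Omega> \<Gamma> :: "(real^'d::finite) set"
    and v :: "nat \<Rightarrow> real^'d \<Rightarrow> real^'m::finite"
    and \<alpha> :: "nat \<Rightarrow> real" and s :: "nat \<Rightarrow> nat"
    and U :: "real^'d \<Rightarrow> real^'d^'m \<Rightarrow> real"
    and L :: "real^'d \<Rightarrow> real^'d^'m^'d^'m"
    and \<pi> :: "(real^'d) measure"
    and \<mu> lam :: "real^'d \<Rightarrow> (real^'d^'m) measure"
  assumes dom: "C1_domain \<Omega>"
    and \<Gamma>: "\<Gamma> \<subseteq> frontier \<Omega>" "openin (top_of_set (frontier \<Omega>)) \<Gamma>"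
    and U: "continuous_on (closure \<Omega> \<times> UNIV) (\<lambda>(x, F). U x F)" "\<forall>x\<in>closure \<Omega>. U x 0 = 0"
    and L: "continuous_on (closure \<Omega>) L"
    and weak: "weak_conv_zero_W12 \<Omega> v"
    and apos: "\<forall>n. \<alpha> n > 0"
    and bdd: "\<exists>C. \<forall>n. \<exists>G. weak_grad \<Omega> (\<lambda>x. \<alpha> n *\<^sub>R v n x) G \<and>
                 (AE x in lebesgue_on \<Omega>. norm (\<alpha> n *\<^sub>R v n x) \<le> C \<and> norm (G x) \<le> C)"
    and rep: "repr_measures \<Omega> \<alpha> v s \<pi> \<mu> lam"
  shows "AE x0 in \<pi>. x0 \<in> (\<Omega> \<union> closure \<Gamma>) \<inter> measure_supp \<pi> \<longrightarrow>
    (\<forall>\<theta> :: real \<Rightarrow> nat \<Rightarrow> real^'d \<Rightarrow> real.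
       (\<forall>r>0. \<forall>k. test_fun (ball x0 r) (\<theta> r k)) \<and>
       (\<exists>M. \<forall>r>0. \<forall>k x. \<bar>\<theta> r k x\<bar> \<le> M) \<and>
       (\<forall>r>0. \<forall>x\<in>closure \<Omega>. (\<lambda>k. \<theta> r k x) \<longlonglongrightarrow> indicator (ball x0 r \<inter> closure \<Omega>) x)
     \<longrightarrow>
       (\<exists>h g. (\<forall>r>0. \<forall>k. (\<lambda>n. (1 / measure \<pi> (ball x0 r \<inter> closure \<Omega>)) *
                 (LINT x|lebesgue_on (ball x0 r \<inter> closure \<Omega>).
                    Fden U L x0 (\<alpha> (s n)) (wgrad \<Omega> (\<lambda>y. \<theta> r k y *\<^sub>R v (s n) y) x)))
               \<longlonglongrightarrow> h r k) \<and>
             (\<forall>r>0. (\<lambda>k. h r k) \<longlonglongrightarrow> g r) \<and>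
             (g \<longlongrightarrow> Ifun U L x0 (\<mu> x0) (lam x0)) (at_right 0)))"
proof -
  obtain C where C: "\<And>n. \<exists>G. weak_grad \<Omega> (\<lambda>x. \<alpha> n *\<^sub>R v n x) G \<and>
                 (AE x in lebesgue_on \<Omega>. norm (\<alpha> n *\<^sub>R v n x) \<le> C \<and> norm (G x) \<le> C)"
    using bdd by blast
  have bd: "bounded \<Omega>" using dom by (simp add: C1_domain_def)
  have U0: "U x 0 = 0" if "x \<in> closure \<Omega>" for x using U(2) that by blast
  have a: "\<alpha> n > 0" for n using apos by blast
  have sub: "\<Omega> \<union> closure \<Gamma> \<subseteq> closure \<Omega>"
    using \<Gamma>(1) closure_subset[of \<Omega>] closure_minimal[OF \<Gamma>(1) frontier_closed] by (auto simp: frontier_def)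
  have fi: "integrable \<pi> (\<lambda>x. indicator (closure \<Omega>) x * Ifun U L x (\<mu> x) (lam x))"
    using repr_measures_limit(1)[OF rep U(1) U0 L] by (simp add: set_integrable_def)
  \<comment> \<open>The only exceptional set of the proof; it depends on \<open>U\<close> and
    \<open>L\<close> but on no cut-off.\<close>
  have "AE x0 in \<pi>. has_ball_density_limit \<pi> (\<lambda>x. indicator (closure \<Omega>) x * Ifun U L x (\<mu> x) (lam x)) x0"
    by (rule lebesgue_besicovitch_differentiation[OF repr_measuresD(3,2)[OF rep] fi])
  then show ?thesis
  proof eventually_elim
    case (elim x0)
    show ?case
    proof (intro impI allI)
      fix \<theta> :: "real \<Rightarrow> nat \<Rightarrow> real^'d \<Rightarrow> real"
      assume x0: "x0 \<in> (\<Omega> \<union> closure \<Gamma>) \<inter> measure_supp \<pi>"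
      assume "(\<forall>r>0. \<forall>k. test_fun (ball x0 r) (\<theta> r k)) \<and>
       (\<exists>M. \<forall>r>0. \<forall>k x. \<bar>\<theta> r k x\<bar> \<le> M) \<and>
       (\<forall>r>0. \<forall>x\<in>closure \<Omega>. (\<lambda>k. \<theta> r k x) \<longlonglongrightarrow> indicator (ball x0 r \<inter> closure \<Omega>) x)"
      then obtain M where \<theta>: "\<And>r k. r > 0 \<Longrightarrow> test_fun (ball x0 r) (\<theta> r k)" and M: "\<And>r k x. r > 0 \<Longrightarrow> \<bar>\<theta> r k x\<bar> \<le> M"
        and lim: "\<And>r x. r > 0 \<Longrightarrow> x \<in> closure \<Omega> \<Longrightarrow> (\<lambda>k. \<theta> r k x) \<longlonglongrightarrow> indicator (ball x0 r \<inter> closure \<Omega>) x" by blast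
      have xc: "x0 \<in> closure \<Omega>" and xs: "x0 \<in> measure_supp \<pi>" using x0 sub by auto
      have Ux: "continuous_on UNIV (U x0)"
        by (rule continuous_on_slice[OF U(1) xc])
      \<comment> \<open>The normalising factor depends on \<open>r\<close> alone and passes through
        the limits in \<open>n\<close> and \<open>k\<close>.\<close>
      define c where "c r = 1 / measure \<pi> (ball x0 r \<inter> closure \<Omega>)" for r
      define h where "h r k = c r * (LINT x:closure \<Omega>|\<pi>.
          Ifun (\<lambda>x F. (\<theta> r k x)\<^sup>2 * U x0 (\<theta> r k x *\<^sub>R F)) (\<lambda>x. (\<theta> r k x)\<^sup>2 *\<^sub>R L x0) x (\<mu> x) (lam x))" for r k
      define g where "g r = c r * (LINT x:closure \<Omega>|\<pi>. indicator (ball x0 r) x * Ifun (\<lambda>x. U x0) (\<lambda>x. L x0) x (\<mu> x) (lam x))" for r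
      have 1: "(\<lambda>n. c r * (LINT x|lebesgue_on (ball x0 r \<inter> closure \<Omega>).
                    Fden U L x0 (\<alpha> (s n)) (wgrad \<Omega> (\<lambda>y. \<theta> r k y *\<^sub>R v (s n) y) x))) \<longlonglongrightarrow> h r k" if "r > 0" for r k
        unfolding h_def
        by (rule tendsto_mult_left[OF cutoff_energy_limit[where U=U and ?x0.0=x0, OF dom Ux U0[OF xc] weak a C rep \<theta>[OF that]]])
      have 2: "(\<lambda>k. h r k) \<longlonglongrightarrow> g r" if r: "r > 0" for r
      proof -
        have li: "(\<lambda>k. \<theta> r k x) \<longlonglongrightarrow> indicator (ball x0 r) x" if "x \<in> closure \<Omega>" for x
          using lim[OF r that] that by (simp add: indicator_def)
        have ct: "continuous_on UNIV (\<theta> r k)" for k by (rule test_fun_continuous[OF \<theta>[OF r]])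
        show ?thesis unfolding h_def g_def
          by (rule tendsto_mult_left[OF cutoff_limit_indicator[where U=U and ?x0.0=x0, OF rep Ux U0[OF xc] ct M[OF r] li]]) simp_all
      qed
      have 3: "(g \<longlongrightarrow> Ifun U L x0 (\<mu> x0) (lam x0)) (at_right 0)"
        unfolding g_def[abs_def] c_def by (rule frozen_average_limit[OF rep bd xc xs U(1) U0 L elim])
      show "\<exists>h g. (\<forall>r>0. \<forall>k. (\<lambda>n. (1 / measure \<pi> (ball x0 r \<inter> closure \<Omega>)) *
                 (LINT x|lebesgue_on (ball x0 r \<inter> closure \<Omega>).
                    Fden U L x0 (\<alpha> (s n)) (wgrad \<Omega> (\<lambda>y. \<theta> r k y *\<^sub>R v (s n) y) x)))
               \<longlonglongrightarrow> h r k) \<and>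
             (\<forall>r>0. (\<lambda>k. h r k) \<longlonglongrightarrow> g r) \<and>
             (g \<longlongrightarrow> Ifun U L x0 (\<mu> x0) (lam x0)) (at_right 0)"
        using 1 2 3 unfolding c_def by blast
    qed
  qed
qed

end
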